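(* Let $R$ be a commutative ring, let $A$ be an $R$-complex centered at $R$ equipped with a multiplication $\mu$, written $\star$, giving it the structure of an MDG $R$-algebra, and let $S=\mathrm{S}_R(A)$ be the symmetric DG $R$-algebra of $A$, with inclusion $\iota\colon A\hookrightarrow S$. Let $\mathfrak{s}=\mathfrak{s}(\mu)$ be the $S$-ideal generated by all elements $[a_1,a_2]=a_1\star a_2-a_1a_2$ with $a_1,a_2\in A$, where $a_1a_2$ is the product in $S$. Let $A^{\mathrm{as}}=A/\langle A\rangle$ be the maximal associative quotient of $A$, regarded as a DG $S$-algebra via the unique DG algebra homomorphism $\pi^{\mathrm{as}}\colon S\twoheadrightarrow A^{\mathrm{as}}$ extending the quotient map $A\twoheadrightarrow A^{\mathrm{as}}$. Then $$A^{\mathrm{as}}=\mathrm{coker}(\mathfrak{s}\hookrightarrow S)=S/\mathfrak{s};$$ more specifically, there is a unique isomorphism $A^{\mathrm{as}}\to S/\mathfrak{s}$ of DG $S$-algebras. In particular, $$\langle A\rangle=A\cap\mathfrak{s}=\mathfrak{s}^{\leq1}=\ker(\mathfrak{s}\to S^{\geq2}),$$ where $\mathfrak{s}^{\le 1}=\mathfrak{s}\cap S^{\le 1}$ and $\mathfrak{s}\to S^{\ge 2}$ is the composite of the inclusion with the quotient map $\rho\colon S\twoheadrightarrow S/A=S^{\geq 2}$. Thus the canonical maps form a commutative diagram of $R$-complexes in which the following four sequences are exact: $$0\to\mathfrak{s}\to S\xrightarrow{\pi}A^{\mathrm{as}}\to0,\qquad 0\to A\xrightarrow{\iota}S\xrightarrow{\rho}S^{\geq2}\to0,$$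 $$0\to\mathfrak{s}^{\leq1}\to A\to A^{\mathrm{as}}\to0,\qquad 0\to\mathfrak{s}^{\leq1}\to\mathfrak{s}\to S^{\geq2}\to0,$$ where the maps $\mathfrak{s}\to S\to A^{\mathrm{as}}$ are DG $S$-module homomorphisms, the maps $A\to S\to S^{\ge2}$ and $\mathfrak{s}^{\le1}\to\mathfrak{s}\to S^{\ge2}$ are chain maps of $R$-complexes, and the maps $\mathfrak{s}^{\le1}\to A\to A^{\mathrm{as}}$ are MDG $A$-module homomorphisms.
   Context: An $R$-complex has an $R$-linear differential of degree $-1$. An $R$-complex $A$ is centered at $R$ if $A_0=R$ and $A_i=0$ for $i<0$; $A_+=\bigoplus_{i>0}A_i$. An MDG $R$-algebra is an $R$-complex $A$ with a chain map $A\otimes_R A\to A$, $a_1\otimes a_2\mapsto a_1\star a_2$, which is unital (here with identity $1\in A_0=R$) and strictly graded-commutative ($a_1\star a_2=(-1)^{|a_1||a_2|}a_2\star a_1$, and $a\star a=0$ for $|a|$ odd), not necessarily associative. A DG algebra is an associative MDG algebra. $\langle A\rangle$ is the smallest subcomplex of $A$ closed under multiplication by $A$ containing all associators $(a_1\star a_2)\star a_3-a_1\star(a_2\star a_3)$. An MDG $A$-module is an $R$-complex $X$ with a unital chain map $A\otimes_RX\to X$; MDG $A$-module homomorphisms are chain maps commuting with $A$-scalar multiplication. Symmetric DG algebra: $S=\mathrm{S}_R(A)$ has underlying graded $R$-algebra the quotient of the tensor algebra $\bigoplus_{m\ge0}A_+^{\otimes_R m}$ by the two-sided ideal generated by $(-1)^{|a_1||a_2|}a_2\otimes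 a_1-a_1\otimes a_2$ for homogeneous $a_1,a_2\in A_+$ and $a\otimes a$ for homogeneous $a\in A_+$ with $|a|$ odd. Its differential extends that of $A$ and satisfies $\mathrm{d}(a_1\cdots a_m)=\sum_{j}(-1)^{|a_1|+\cdots+|a_{j-1}|}a_1\cdots\mathrm{d}(a_j)\cdots a_m$. $S^m$ denotes the $R$-span of products of $m$ elements of $A_+$ (total degree $m$), so $A=S^{\le1}=R\oplus A_+$ is a subcomplex of $S$. $S^{\ge2}=\bigoplus_{m\ge2}S^m$ is regarded as the quotient complex $S/A$ (its differential is that of $S$ with components in $A$ dropped). *)

theory Defs
  imports "HOL-Algebra.Module" "HOL-Algebra.QuotRing"
begin

section \<open>Complexes of modules over a commutative ring\<close>

text \<open>
  A graded module is a module together with a family of submodules \<open>homog X i\<close>, \<open>i\<close> an integer,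
  whose internal direct sum is the whole module.  The fields \<open>mult\<close> and \<open>one\<close> which the record
  inherits from \<^typ>\<open>('r, 'a) module\<close> are disregarded for plain complexes; for (M)DG algebras
  they hold the multiplication and the identity.
\<close>

record ('r, 'a) graded_complex = "('r, 'a) module" +
  homog :: "int \<Rightarrow> 'a set"
  diff :: "'a \<Rightarrow> 'a"

definition is_hdecomp ::
    "('r, 'a, 'm) graded_complex_scheme \<Rightarrow> 'a \<Rightarrow> (int \<Rightarrow> 'a) \<Rightarrow> bool" where
  "is_hdecomp X x c \<longleftrightarrow>
     (\<forall>i. c i \<in> homog X i) \<and> finite {i. c i \<noteq> \<zero>\<^bsub>X\<^esub>} \<and> x = finsum X c {i. c i \<noteq> \<zero>\<^bsub>X\<^esub>}"

definition hcomp :: "('r, 'a, 'm) graded_complex_scheme \<Rightarrow> 'a \<Rightarrow> int \<Rightarrow> 'a" where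
  "hcomp X x = (THE c. is_hdecomp X x c)"

text \<open>\<open>ksign X i x\<close> is \<open>(-1)\<^sup>i x\<close>.\<close>

definition ksign :: "('a, 'm) ring_scheme \<Rightarrow> int \<Rightarrow> 'a \<Rightarrow> 'a" where
  "ksign X i x = (if even i then x else \<ominus>\<^bsub>X\<^esub> x)"

locale rcomplex = module R X
  for R :: "('r, 'p) ring_scheme" and X :: "('r, 'a, 'm) graded_complex_scheme" +
  assumes homog_submodule: "\<And>i. submodule (homog X i) R X"
    and homog_direct_sum: "\<And>x. x \<in> carrier X \<Longrightarrow> \<exists>!c. is_hdecomp X x c"
    and diff_add: "\<And>x y. \<lbrakk>x \<in> carrier X; y \<in> carrier X\<rbrakk>
          \<Longrightarrow> diff X (x \<oplus>\<^bsub>X\<^esub> y) = diff X x \<oplus>\<^bsub>X\<^esub> diff X y"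
    and diff_smult: "\<And>r x. \<lbrakk>r \<in> carrier R; x \<in> carrier X\<rbrakk>
          \<Longrightarrow> diff X (r \<odot>\<^bsub>X\<^esub> x) = r \<odot>\<^bsub>X\<^esub> diff X x"
    and diff_degree: "\<And>i x. x \<in> homog X i \<Longrightarrow> diff X x \<in> homog X (i - 1)"
    and diff_diff: "\<And>x. x \<in> carrier X \<Longrightarrow> diff X (diff X x) = \<zero>\<^bsub>X\<^esub>"

locale chain_map = X: rcomplex R X + Y: rcomplex R Y
  for R :: "('r, 'p) ring_scheme" and X :: "('r, 'a, 'm) graded_complex_scheme"
    and Y :: "('r, 'b, 'n) graded_complex_scheme" +
  fixes f :: "'a \<Rightarrow> 'b"
  assumes map_closed: "\<And>x. x \<in> carrier X \<Longrightarrow> f x \<in> carrier Y"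
    and map_add: "\<And>x y. \<lbrakk>x \<in> carrier X; y \<in> carrier X\<rbrakk> \<Longrightarrow> f (x \<oplus>\<^bsub>X\<^esub> y) = f x \<oplus>\<^bsub>Y\<^esub> f y"
    and map_smult: "\<And>r x. \<lbrakk>r \<in> carrier R; x \<in> carrier X\<rbrakk> \<Longrightarrow> f (r \<odot>\<^bsub>X\<^esub> x) = r \<odot>\<^bsub>Y\<^esub> f x"
    and map_degree: "\<And>i x. x \<in> homog X i \<Longrightarrow> f x \<in> homog Y i"
    and map_diff: "\<And>x. x \<in> carrier X \<Longrightarrow> f (diff X x) = diff Y (f x)"

definition short_exact ::
    "('r, 'a, 'm) graded_complex_scheme \<Rightarrow> ('a \<Rightarrow> 'b) \<Rightarrow> ('r, 'b, 'n) graded_complex_scheme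
      \<Rightarrow> ('b \<Rightarrow> 'c) \<Rightarrow> ('r, 'c, 'k) graded_complex_scheme \<Rightarrow> bool" where
  "short_exact X f Y g Z \<longleftrightarrow>
     inj_on f (carrier X) \<and> f ` carrier X = a_kernel Y Z g \<and> g ` carrier Y = carrier Z"

subsection \<open>Subcomplexes and quotients\<close>

definition lin_span :: "('r, 'p) ring_scheme \<Rightarrow> ('r, 'a, 'm) module_scheme \<Rightarrow> 'a set \<Rightarrow> 'a set" where
  "lin_span R X B = \<Inter>{H. submodule H R X \<and> B \<subseteq> H}"

definition subcomplex ::
    "('r, 'p) ring_scheme \<Rightarrow> ('r, 'a, 'm) graded_complex_scheme \<Rightarrow> 'a set \<Rightarrow> bool" where
  "subcomplex R X Y \<longleftrightarrow> submodule Y R X \<and> (\<forall>y\<in>Y. \<forall>i. hcomp X y i \<in> Y) \<and> (\<forall>y\<in>Y. diff X y \<in> Y)"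

definition sub_cplx ::
    "('r, 'a, 'm) graded_complex_scheme \<Rightarrow> 'a set \<Rightarrow> ('r, 'a, 'm) graded_complex_scheme" where
  "sub_cplx X Y = X\<lparr>carrier := Y, homog := \<lambda>i. homog X i \<inter> Y\<rparr>"

text \<open>
  Quotients extend \<^const>\<open>FactRing\<close> by the induced scalar multiplication, grading and differential.
  When the subset is not closed under multiplication, the field \<open>mult\<close> is meaningless.
\<close>

definition quot_mod :: "('r, 'a, 'm) module_scheme \<Rightarrow> 'a set \<Rightarrow> ('r, 'a set) module" where
  "quot_mod X N = ring.extend (X Quot N)
     (module.fields (\<lambda>r C. \<Union>x\<in>C. N +>\<^bsub>X\<^esub> (r \<odot>\<^bsub>X\<^esub> x)))"

definition quot_cplx ::
    "('r, 'a, 'm) graded_complex_scheme \<Rightarrow> 'a set \<Rightarrow> ('r, 'a set) graded_complex" where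
  "quot_cplx X N = module.extend (quot_mod X N)
     (graded_complex.fields
        (\<lambda>i. (\<lambda>x. N +>\<^bsub>X\<^esub> x) ` homog X i)
        (\<lambda>C. \<Union>x\<in>C. N +>\<^bsub>X\<^esub> diff X x))"

section \<open>MDG algebras and modules\<close>

text \<open>
  A chain map out of \<open>A \<otimes>\<^sub>R X\<close> is given by an \<open>R\<close>-bilinear map on \<open>A \<times> X\<close> which adds degrees and
  satisfies the Leibniz rule with respect to \<open>d(a \<otimes> x) = da \<otimes> x + (-1)\<^bsup>|a|\<^esup> a \<otimes> dx\<close>.
\<close>

locale chain_pairing = A: rcomplex R A + X: rcomplex R X + Y: rcomplex R Y
  for R :: "('r, 'p) ring_scheme" and A :: "('r, 'a, 'm) graded_complex_scheme"
    and X :: "('r, 'b, 'n) graded_complex_scheme" and Y :: "('r, 'c, 'k) graded_complex_scheme" +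
  fixes act :: "'a \<Rightarrow> 'b \<Rightarrow> 'c"
  assumes act_closed: "\<And>a x. \<lbrakk>a \<in> carrier A; x \<in> carrier X\<rbrakk> \<Longrightarrow> act a x \<in> carrier Y"
    and act_add_left: "\<And>a b x. \<lbrakk>a \<in> carrier A; b \<in> carrier A; x \<in> carrier X\<rbrakk>
          \<Longrightarrow> act (a \<oplus>\<^bsub>A\<^esub> b) x = act a x \<oplus>\<^bsub>Y\<^esub> act b x"
    and act_add_right: "\<And>a x y. \<lbrakk>a \<in> carrier A; x \<in> carrier X; y \<in> carrier X\<rbrakk>
          \<Longrightarrow> act a (x \<oplus>\<^bsub>X\<^esub> y) = act a x \<oplus>\<^bsub>Y\<^esub> act a y"
    and act_smult_left: "\<And>r a x. \<lbrakk>r \<in> carrier R; a \<in> carrier A; x \<in> carrier X\<rbrakk>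
          \<Longrightarrow> act (r \<odot>\<^bsub>A\<^esub> a) x = r \<odot>\<^bsub>Y\<^esub> act a x"
    and act_smult_right: "\<And>r a x. \<lbrakk>r \<in> carrier R; a \<in> carrier A; x \<in> carrier X\<rbrakk>
          \<Longrightarrow> act a (r \<odot>\<^bsub>X\<^esub> x) = r \<odot>\<^bsub>Y\<^esub> act a x"
    and act_degree: "\<And>i j a x. \<lbrakk>a \<in> homog A i; x \<in> homog X j\<rbrakk> \<Longrightarrow> act a x \<in> homog Y (i + j)"
    and act_diff: "\<And>i a x. \<lbrakk>a \<in> homog A i; x \<in> carrier X\<rbrakk>
          \<Longrightarrow> diff Y (act a x) = act (diff A a) x \<oplus>\<^bsub>Y\<^esub> ksign Y i (act a (diff X x))"

locale mdg_algebra = chain_pairing R A A A "mult A"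
  for R :: "('r, 'p) ring_scheme" and A :: "('r, 'a, 'm) graded_complex_scheme" +
  assumes one_degree: "\<one>\<^bsub>A\<^esub> \<in> homog A 0"
    and one_left: "\<And>a. a \<in> carrier A \<Longrightarrow> \<one>\<^bsub>A\<^esub> \<otimes>\<^bsub>A\<^esub> a = a"
    and one_right: "\<And>a. a \<in> carrier A \<Longrightarrow> a \<otimes>\<^bsub>A\<^esub> \<one>\<^bsub>A\<^esub> = a"
    and graded_comm: "\<And>i j a b. \<lbrakk>a \<in> homog A i; b \<in> homog A j\<rbrakk>
          \<Longrightarrow> a \<otimes>\<^bsub>A\<^esub> b = ksign A (i * j) (b \<otimes>\<^bsub>A\<^esub> a)"
    and odd_square: "\<And>i a. \<lbrakk>odd i; a \<in> homog A i\<rbrakk> \<Longrightarrow> a \<otimes>\<^bsub>A\<^esub> a = \<zero>\<^bsub>A\<^esub>"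

locale dg_algebra = mdg_algebra +
  assumes assoc: "\<And>a b c. \<lbrakk>a \<in> carrier A; b \<in> carrier A; c \<in> carrier A\<rbrakk>
          \<Longrightarrow> (a \<otimes>\<^bsub>A\<^esub> b) \<otimes>\<^bsub>A\<^esub> c = a \<otimes>\<^bsub>A\<^esub> (b \<otimes>\<^bsub>A\<^esub> c)"

text \<open>The identification of \<open>A\<^sub>0\<close> with \<open>R\<close> is \<open>r \<mapsto> r \<cdot> 1\<close>.\<close>

definition centered_at_base ::
    "('r, 'p) ring_scheme \<Rightarrow> ('r, 'a, 'm) graded_complex_scheme \<Rightarrow> bool" where
  "centered_at_base R A \<longleftrightarrow>
     bij_betw (\<lambda>r. r \<odot>\<^bsub>A\<^esub> \<one>\<^bsub>A\<^esub>) (carrier R) (homog A 0) \<and> (\<forall>i<0. homog A i = {\<zero>\<^bsub>A\<^esub>})"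

locale dg_algebra_hom = dom: dg_algebra R B + cod: dg_algebra R C + chain_map R B C f
  for R :: "('r, 'p) ring_scheme" and B :: "('r, 'b, 'm) graded_complex_scheme"
    and C :: "('r, 'c, 'n) graded_complex_scheme" and f :: "'b \<Rightarrow> 'c" +
  assumes hom_one: "f \<one>\<^bsub>B\<^esub> = \<one>\<^bsub>C\<^esub>"
    and hom_mult: "\<And>x y. \<lbrakk>x \<in> carrier B; y \<in> carrier B\<rbrakk> \<Longrightarrow> f (x \<otimes>\<^bsub>B\<^esub> y) = f x \<otimes>\<^bsub>C\<^esub> f y"

text \<open>
  A DG \<open>S\<close>-algebra is a DG algebra \<open>B\<close> with a structure map \<open>p: S \<rightarrow> B\<close>, that is,
  \<^term>\<open>dg_algebra_hom R S B p\<close>; isomorphisms are those compatible with the structure maps.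
\<close>

definition dg_over_iso ::
    "('r, 'p) ring_scheme \<Rightarrow> ('r, 's, 'm) graded_complex_scheme
      \<Rightarrow> ('r, 'b, 'n) graded_complex_scheme \<Rightarrow> ('s \<Rightarrow> 'b)
      \<Rightarrow> ('r, 'c, 'k) graded_complex_scheme \<Rightarrow> ('s \<Rightarrow> 'c) \<Rightarrow> ('b \<Rightarrow> 'c) \<Rightarrow> bool" where
  "dg_over_iso R S B p C q f \<longleftrightarrow>
     dg_algebra_hom R B C f \<and> bij_betw f (carrier B) (carrier C) \<and> (\<forall>s\<in>carrier S. f (p s) = q s)"

locale mdg_module = A: mdg_algebra R A + chain_pairing R A X X act
  for R :: "('r, 'p) ring_scheme" and A :: "('r, 'a, 'm) graded_complex_scheme"
    and X :: "('r, 'b, 'n) graded_complex_scheme" and act :: "'a \<Rightarrow> 'b \<Rightarrow> 'b" +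
  assumes act_one: "\<And>x. x \<in> carrier X \<Longrightarrow> act \<one>\<^bsub>A\<^esub> x = x"

locale dg_module = A: dg_algebra R A + mdg_module R A X act
  for R :: "('r, 'p) ring_scheme" and A :: "('r, 'a, 'm) graded_complex_scheme"
    and X :: "('r, 'b, 'n) graded_complex_scheme" and act :: "'a \<Rightarrow> 'b \<Rightarrow> 'b" +
  assumes act_assoc: "\<And>a b x. \<lbrakk>a \<in> carrier A; b \<in> carrier A; x \<in> carrier X\<rbrakk>
          \<Longrightarrow> act (a \<otimes>\<^bsub>A\<^esub> b) x = act a (act b x)"

locale mdg_module_hom =
    dom: mdg_module R A X actX + cod: mdg_module R A Y actY + chain_map R X Y f
  for R :: "('r, 'p) ring_scheme" and A :: "('r, 'a, 'm) graded_complex_scheme"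
    and X :: "('r, 'b, 'n) graded_complex_scheme" and actX :: "'a \<Rightarrow> 'b \<Rightarrow> 'b"
    and Y :: "('r, 'c, 'k) graded_complex_scheme" and actY :: "'a \<Rightarrow> 'c \<Rightarrow> 'c"
    and f :: "'b \<Rightarrow> 'c" +
  assumes hom_act: "\<And>a x. \<lbrakk>a \<in> carrier A; x \<in> carrier X\<rbrakk> \<Longrightarrow> f (actX a x) = actY a (f x)"

locale dg_module_hom =
    dom: dg_module R A X actX + cod: dg_module R A Y actY + mdg_module_hom R A X actX Y actY f
  for R :: "('r, 'p) ring_scheme" and A :: "('r, 'a, 'm) graded_complex_scheme"
    and X :: "('r, 'b, 'n) graded_complex_scheme" and actX :: "'a \<Rightarrow> 'b \<Rightarrow> 'b"
    and Y :: "('r, 'c, 'k) graded_complex_scheme" and actY :: "'a \<Rightarrow> 'c \<Rightarrow> 'c"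
    and f :: "'b \<Rightarrow> 'c"

subsection \<open>The maximal associative quotient\<close>

definition associators :: "('a, 'm) ring_scheme \<Rightarrow> 'a set" where
  "associators A = {(a \<otimes>\<^bsub>A\<^esub> b) \<otimes>\<^bsub>A\<^esub> c \<ominus>\<^bsub>A\<^esub> a \<otimes>\<^bsub>A\<^esub> (b \<otimes>\<^bsub>A\<^esub> c) | a b c.
     a \<in> carrier A \<and> b \<in> carrier A \<and> c \<in> carrier A}"

definition assoc_sub :: "('r, 'p) ring_scheme \<Rightarrow> ('r, 'a, 'm) graded_complex_scheme \<Rightarrow> 'a set" where
  "assoc_sub R A = \<Inter>{Y. subcomplex R A Y \<and> associators A \<subseteq> Y \<and>
     (\<forall>a\<in>carrier A. \<forall>y\<in>Y. a \<otimes>\<^bsub>A\<^esub> y \<in> Y \<and> y \<otimes>\<^bsub>A\<^esub> a \<in> Y)}"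

definition max_assoc ::
    "('r, 'p) ring_scheme \<Rightarrow> ('r, 'a, 'm) graded_complex_scheme \<Rightarrow> ('r, 'a set) graded_complex" where
  "max_assoc R A = quot_cplx A (assoc_sub R A)"

definition max_assoc_proj ::
    "('r, 'p) ring_scheme \<Rightarrow> ('r, 'a, 'm) graded_complex_scheme \<Rightarrow> 'a \<Rightarrow> 'a set" where
  "max_assoc_proj R A a = assoc_sub R A +>\<^bsub>A\<^esub> a"

section \<open>The symmetric DG algebra\<close>

definition pos_part :: "('r, 'a, 'm) graded_complex_scheme \<Rightarrow> 'a set" where
  "pos_part A = {a \<in> carrier A. \<forall>i\<le>0. hcomp A a i = \<zero>\<^bsub>A\<^esub>}"

text \<open>
  The direct sum over \<open>m\<close> of the free \<open>R\<close>-modules on the \<open>m\<close>-tuples of elements of a set \<open>P\<close>: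
  finitely supported functions on words over \<open>P\<close>, multiplied by concatenation of words.
\<close>

definition free_alg :: "('r, 'p) ring_scheme \<Rightarrow> 'a set \<Rightarrow> ('r, 'a list \<Rightarrow> 'r) module" where
  "free_alg R P =
     \<lparr>carrier = {f. (\<forall>w. f w \<in> carrier R) \<and> (\<forall>w. w \<notin> lists P \<longrightarrow> f w = \<zero>\<^bsub>R\<^esub>)
                    \<and> finite {w. f w \<noteq> \<zero>\<^bsub>R\<^esub>}},
      mult = \<lambda>f g w. finsum R (\<lambda>k. f (take k w) \<otimes>\<^bsub>R\<^esub> g (drop k w)) {..length w},
      one = \<lambda>w. if w = [] then \<one>\<^bsub>R\<^esub> else \<zero>\<^bsub>R\<^esub>,
      zero = \<lambda>w. \<zero>\<^bsub>R\<^esub>,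
      add = \<lambda>f g w. f w \<oplus>\<^bsub>R\<^esub> g w,
      smult = \<lambda>r f w. r \<otimes>\<^bsub>R\<^esub> f w\<rparr>"

definition word :: "('r, 'p) ring_scheme \<Rightarrow> 'a list \<Rightarrow> 'a list \<Rightarrow> 'r" where
  "word R u = (\<lambda>w. if w = u then \<one>\<^bsub>R\<^esub> else \<zero>\<^bsub>R\<^esub>)"

text \<open>
  The multilinearity relations among \<open>m\<close>-tuples, for all \<open>m\<close> at once.  Their span is the direct sum
  over \<open>m\<close> of the relation modules that define the tensor powers \<open>A\<^sub>+\<^bsup>\<otimes>m\<^esup>\<close>.
\<close>

definition multilin_rel ::
    "('r, 'p) ring_scheme \<Rightarrow> ('r, 'a, 'm) graded_complex_scheme \<Rightarrow> ('a list \<Rightarrow> 'r) set" where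
  "multilin_rel R A = (let P = pos_part A; F = free_alg R P in
     {word R (u @ (a \<oplus>\<^bsub>A\<^esub> b) # v) \<ominus>\<^bsub>F\<^esub> (word R (u @ a # v) \<oplus>\<^bsub>F\<^esub> word R (u @ b # v)) | u v a b.
        u \<in> lists P \<and> v \<in> lists P \<and> a \<in> P \<and> b \<in> P}
     \<union> {word R (u @ (r \<odot>\<^bsub>A\<^esub> a) # v) \<ominus>\<^bsub>F\<^esub> (r \<odot>\<^bsub>F\<^esub> word R (u @ a # v)) | u v r a.
        u \<in> lists P \<and> v \<in> lists P \<and> r \<in> carrier R \<and> a \<in> P})"

type_synonym ('r, 'a) tens = "('a list \<Rightarrow> 'r) set"
type_synonym ('r, 'a) symm = "('r, 'a) tens set"

definition tensor_alg ::
    "('r, 'p) ring_scheme \<Rightarrow> ('r, 'a, 'm) graded_complex_scheme \<Rightarrow> ('r, ('r, 'a) tens) module" where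
  "tensor_alg R A = (let F = free_alg R (pos_part A) in quot_mod F (lin_span R F (multilin_rel R A)))"

definition tensor_gen ::
    "('r, 'p) ring_scheme \<Rightarrow> ('r, 'a, 'm) graded_complex_scheme \<Rightarrow> 'a \<Rightarrow> ('r, 'a) tens" where
  "tensor_gen R A a = (let F = free_alg R (pos_part A) in
     lin_span R F (multilin_rel R A) +>\<^bsub>F\<^esub> word R [a])"

definition sym_rel ::
    "('r, 'p) ring_scheme \<Rightarrow> ('r, 'a, 'm) graded_complex_scheme \<Rightarrow> ('r, 'a) tens set" where
  "sym_rel R A = (let T = tensor_alg R A; g = tensor_gen R A in
     {ksign T (i * j) (g b \<otimes>\<^bsub>T\<^esub> g a) \<ominus>\<^bsub>T\<^esub> g a \<otimes>\<^bsub>T\<^esub> g b | i j a b.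
        i > 0 \<and> j > 0 \<and> a \<in> homog A i \<and> b \<in> homog A j}
     \<union> {g a \<otimes>\<^bsub>T\<^esub> g a | i a. i > 0 \<and> odd i \<and> a \<in> homog A i})"

definition sym_alg ::
    "('r, 'p) ring_scheme \<Rightarrow> ('r, 'a, 'm) graded_complex_scheme \<Rightarrow> ('r, ('r, 'a) symm) module" where
  "sym_alg R A = quot_mod (tensor_alg R A) (Idl\<^bsub>tensor_alg R A\<^esub> (sym_rel R A))"

text \<open>
  The inclusion of \<open>A = R \<oplus> A\<^sub>+\<close>: the component of \<open>a\<close> in \<open>A\<^sub>0\<close> has the form \<open>r \<cdot> 1\<close> and is sent
  to \<open>r \<cdot> 1\<close>; the remaining part lies in \<open>A\<^sub>+\<close> and is sent to its class in tensor degree one.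
\<close>

definition sym_incl ::
    "('r, 'p) ring_scheme \<Rightarrow> ('r, 'a, 'm) graded_complex_scheme \<Rightarrow> 'a \<Rightarrow> ('r, 'a) symm" where
  "sym_incl R A a =
     ((THE r. r \<in> carrier R \<and> r \<odot>\<^bsub>A\<^esub> \<one>\<^bsub>A\<^esub> = hcomp A a 0) \<odot>\<^bsub>sym_alg R A\<^esub> \<one>\<^bsub>sym_alg R A\<^esub>)
     \<oplus>\<^bsub>sym_alg R A\<^esub>
     (Idl\<^bsub>tensor_alg R A\<^esub> (sym_rel R A) +>\<^bsub>tensor_alg R A\<^esub> tensor_gen R A (a \<ominus>\<^bsub>A\<^esub> hcomp A a 0))"

definition sym_prod ::
    "('r, 'p) ring_scheme \<Rightarrow> ('r, 'a, 'm) graded_complex_scheme \<Rightarrow> 'a list \<Rightarrow> ('r, 'a) symm" where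
  "sym_prod R A as =
     foldr (\<lambda>a s. sym_incl R A a \<otimes>\<^bsub>sym_alg R A\<^esub> s) as \<one>\<^bsub>sym_alg R A\<^esub>"

text \<open>The list \<open>as\<close> consists of homogeneous elements of \<open>A\<^sub>+\<close>, of degrees \<open>ns\<close>.\<close>

definition homog_list :: "('r, 'a, 'm) graded_complex_scheme \<Rightarrow> 'a list \<Rightarrow> int list \<Rightarrow> bool" where
  "homog_list A as ns \<longleftrightarrow> list_all2 (\<lambda>a n. n > 0 \<and> a \<in> homog A n) as ns"

definition sym_homog ::
    "('r, 'p) ring_scheme \<Rightarrow> ('r, 'a, 'm) graded_complex_scheme \<Rightarrow> int \<Rightarrow> ('r, 'a) symm set" where
  "sym_homog R A i =
     lin_span R (sym_alg R A) {sym_prod R A as | as ns. homog_list A as ns \<and> sum_list ns = i}"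

definition is_sym_diff ::
    "('r, 'p) ring_scheme \<Rightarrow> ('r, 'a, 'm) graded_complex_scheme
      \<Rightarrow> (('r, 'a) symm \<Rightarrow> ('r, 'a) symm) \<Rightarrow> bool" where
  "is_sym_diff R A d \<longleftrightarrow> (let S = sym_alg R A in
     d \<in> carrier S \<rightarrow>\<^sub>E carrier S \<and>
     (\<forall>x\<in>carrier S. \<forall>y\<in>carrier S. d (x \<oplus>\<^bsub>S\<^esub> y) = d x \<oplus>\<^bsub>S\<^esub> d y) \<and>
     (\<forall>r\<in>carrier R. \<forall>x\<in>carrier S. d (r \<odot>\<^bsub>S\<^esub> x) = r \<odot>\<^bsub>S\<^esub> d x) \<and>
     (\<forall>a\<in>carrier A. d (sym_incl R A a) = sym_incl R A (diff A a)) \<and>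
     (\<forall>as ns. homog_list A as ns \<longrightarrow>
        d (sym_prod R A as) =
          finsum S (\<lambda>j. ksign S (sum_list (take j ns)) (sym_prod R A (as[j := diff A (as ! j)])))
            {..<length as}))"

definition sym_dg ::
    "('r, 'p) ring_scheme \<Rightarrow> ('r, 'a, 'm) graded_complex_scheme
      \<Rightarrow> ('r, ('r, 'a) symm) graded_complex" where
  "sym_dg R A = module.extend (sym_alg R A)
     (graded_complex.fields (sym_homog R A) (THE d. is_sym_diff R A d))"

text \<open>\<open>S\<^sup>m\<close>, and the (direct) sums \<open>S\<^bsup>\<le>1\<^esup>\<close> and \<open>S\<^bsup>\<ge>2\<^esup>\<close> as submodules of \<open>S\<close>.\<close>

definition sym_pow ::
    "('r, 'p) ring_scheme \<Rightarrow> ('r, 'a, 'm) graded_complex_scheme \<Rightarrow> nat \<Rightarrow> ('r, 'a) symm set" where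
  "sym_pow R A m =
     lin_span R (sym_alg R A) {sym_prod R A as | as. as \<in> lists (pos_part A) \<and> length as = m}"

definition sym_le1 ::
    "('r, 'p) ring_scheme \<Rightarrow> ('r, 'a, 'm) graded_complex_scheme \<Rightarrow> ('r, 'a) symm set" where
  "sym_le1 R A = lin_span R (sym_alg R A) (\<Union>m\<in>{..1}. sym_pow R A m)"

definition sym_ge2 ::
    "('r, 'p) ring_scheme \<Rightarrow> ('r, 'a, 'm) graded_complex_scheme \<Rightarrow> ('r, 'a) symm set" where
  "sym_ge2 R A = lin_span R (sym_alg R A) (\<Union>m\<in>{2..}. sym_pow R A m)"

text \<open>\<open>S\<^bsup>\<ge>2\<^esup>\<close> as a complex is the quotient complex \<open>S/A\<close>.\<close>

definition sym_ge2_cplx ::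
    "('r, 'p) ring_scheme \<Rightarrow> ('r, 'a, 'm) graded_complex_scheme
      \<Rightarrow> ('r, ('r, 'a) symm set) graded_complex" where
  "sym_ge2_cplx R A = quot_cplx (sym_dg R A) (sym_incl R A ` carrier A)"

definition sym_ge2_proj ::
    "('r, 'p) ring_scheme \<Rightarrow> ('r, 'a, 'm) graded_complex_scheme
      \<Rightarrow> ('r, 'a) symm \<Rightarrow> ('r, 'a) symm set" where
  "sym_ge2_proj R A s = (sym_incl R A ` carrier A) +>\<^bsub>sym_dg R A\<^esub> s"

definition mult_ideal ::
    "('r, 'p) ring_scheme \<Rightarrow> ('r, 'a, 'm) graded_complex_scheme \<Rightarrow> ('r, 'a) symm set" where
  "mult_ideal R A = (let S = sym_dg R A; \<iota> = sym_incl R A in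
     Idl\<^bsub>S\<^esub> {\<iota> (a \<otimes>\<^bsub>A\<^esub> b) \<ominus>\<^bsub>S\<^esub> \<iota> a \<otimes>\<^bsub>S\<^esub> \<iota> b | a b. a \<in> carrier A \<and> b \<in> carrier A})"

text \<open>
  DG algebra homomorphisms \<open>S \<rightarrow> A\<^bsup>as\<^esup>\<close> extending the quotient map \<open>A \<rightarrow> A\<^bsup>as\<^esup>\<close>; extensionality
  makes uniqueness meaningful for total functions.
\<close>

definition is_pi_as ::
    "('r, 'p) ring_scheme \<Rightarrow> ('r, 'a, 'm) graded_complex_scheme
      \<Rightarrow> (('r, 'a) symm \<Rightarrow> 'a set) \<Rightarrow> bool" where
  "is_pi_as R A \<pi> \<longleftrightarrow>
     \<pi> \<in> extensional (carrier (sym_dg R A)) \<and>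
     dg_algebra_hom R (sym_dg R A) (max_assoc R A) \<pi> \<and>
     (\<forall>a\<in>carrier A. \<pi> (sym_incl R A a) = max_assoc_proj R A a)"

definition pi_as ::
    "('r, 'p) ring_scheme \<Rightarrow> ('r, 'a, 'm) graded_complex_scheme \<Rightarrow> ('r, 'a) symm \<Rightarrow> 'a set" where
  "pi_as R A = (THE \<pi>. is_pi_as R A \<pi>)"

end

theory Submission
  imports Defs "HOL-Algebra.UnivPoly"
begin

text \<open>
  Everything about \<open>S\<close> is read off from its universal property by mapping it to well-chosen rings:
  polynomials over \<open>S\<close> give the grading, upper triangular matrices over \<open>S\<close> give the differential,
  the trivial extension of \<open>R\<close> by \<open>A\<close> splits off \<open>A\<close>, and \<open>A\<^bsup>as\<^esup>\<close> itself gives \<open>\<pi>\<close>.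
  The ideal \<open>\<ss>\<close> lies in the kernel of \<open>\<pi>\<close> because the quotient map of \<open>A\<close> is multiplicative.
  Conversely, every element of \<open>S\<close> is congruent modulo \<open>\<ss>\<close> to an element of \<open>A\<close>, and the
  elements of \<open>A\<close> that lie in \<open>\<ss>\<close> form a subcomplex that absorbs multiplication and contains all
  associators, as \<open>S/\<ss>\<close> is associative; hence it contains \<open>\<langle>A\<rangle>\<close>, and the kernel of \<open>\<pi>\<close> is \<open>\<ss>\<close>.
\<close>

section \<open>Modules, spans and quotients\<close>

text \<open>\<open>S\<close> is a double quotient of functions on words, so neither the directness
  of its grading, nor a well-defined differential, nor the injectivity of
  \<open>A \<rightarrow> S\<close> can be read off from representatives. Each amounts to the
  existence of a suitable map out of \<open>S\<close>, and ring homomorphisms out of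
  \<open>S\<close> are prescribed on \<open>A\<close> alone. A derivation is not a ring
  homomorphism, but the twisted Leibniz rule d(xy) = s(x) d(y) + d(x) y is exactly the corner entry
  of a product of two triangular matrices. Likewise the projections onto graded pieces are not
  multiplicative, yet together, as coefficients of a polynomial, they are.

  A second difficulty: \<open>\<ss>\<close> is generated merely as a ring ideal, while
  \<langle>A\<rangle> is a subcomplex. Comparing them requires \<open>\<ss>\<close> to be closed
  under homogeneous components and under the differential. This holds because the defect [a, b] is a
  difference of two chain maps in the pair (a, b), so that the differential of a defect is again a
  combination of defects.\<close>

lemma additive_finsum:
  assumes "abelian_monoid X" "abelian_monoid Y"
    and f: "\<And>x. x \<in> carrier X \<Longrightarrow> f x \<in> carrier Y"
    and f0: "f \<zero>\<^bsub>X\<^esub> = \<zero>\<^bsub>Y\<^esub>"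
    and fadd: "\<And>x y. \<lbrakk>x \<in> carrier X; y \<in> carrier X\<rbrakk> \<Longrightarrow> f (x \<oplus>\<^bsub>X\<^esub> y) = f x \<oplus>\<^bsub>Y\<^esub> f y"
    and g: "g \<in> I \<rightarrow> carrier X"
  shows "f (finsum X g I) = finsum Y (\<lambda>i. f (g i)) I"
proof -
  interpret X: abelian_monoid X by fact
  interpret Y: abelian_monoid Y by fact
  show ?thesis
  proof (cases "finite I")
    case True
    then show ?thesis using g
    proof (induction I rule: finite_induct)
      case empty
      then show ?case by (simp add: f0)
    next
      case (insert i I)
      have gI: "g \<in> I \<rightarrow> carrier X" "g i \<in> carrier X" using insert.prems by auto
      have "(\<lambda>i. f (g i)) \<in> I \<rightarrow> carrier Y" using gI f by auto
      then show ?case using insert.hyps insert.IH[OF gI(1)] gI f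
        by (simp add: fadd)
    qed
  next
    \<comment> \<open>Over an infinite index set \<open>finsum\<close> is zero by convention, on
      both sides.\<close>
    case False
    then show ?thesis by (simp add: f0)
  qed
qed

lemma additive_map:
  assumes "abelian_group X" "abelian_group Y"
    and f: "\<And>x. x \<in> carrier X \<Longrightarrow> f x \<in> carrier Y"
    and fadd: "\<And>x y. \<lbrakk>x \<in> carrier X; y \<in> carrier X\<rbrakk> \<Longrightarrow> f (x \<oplus>\<^bsub>X\<^esub> y) = f x \<oplus>\<^bsub>Y\<^esub> f y"
  shows additive_map_zero: "f \<zero>\<^bsub>X\<^esub> = \<zero>\<^bsub>Y\<^esub>"
    and additive_map_neg: "x \<in> carrier X \<Longrightarrow> f (\<ominus>\<^bsub>X\<^esub> x) = \<ominus>\<^bsub>Y\<^esub> f x"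
    and additive_map_minus: "\<lbrakk>x \<in> carrier X; y \<in> carrier X\<rbrakk> \<Longrightarrow> f (x \<ominus>\<^bsub>X\<^esub> y) = f x \<ominus>\<^bsub>Y\<^esub> f y"
    and additive_map_finsum: "g \<in> I \<rightarrow> carrier X \<Longrightarrow> f (finsum X g I) = finsum Y (\<lambda>i. f (g i)) I"
proof -
  interpret X: abelian_group X by fact
  interpret Y: abelian_group Y by fact
  have gh: "group_hom (add_monoid X) (add_monoid Y) f"
    using f fadd by (auto intro!: group_hom.intro group_hom_axioms.intro X.a_group Y.a_group simp: hom_def)
  interpret abelian_group_hom X Y f
    by (intro abelian_group_hom.intro abelian_group_hom_axioms.intro assms(1,2) gh)
  show 0: "f \<zero>\<^bsub>X\<^esub> = \<zero>\<^bsub>Y\<^esub>" by simp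
  show neg: "f (\<ominus>\<^bsub>X\<^esub> x) = \<ominus>\<^bsub>Y\<^esub> f x" if "x \<in> carrier X" for x using that by simp
  show "f (x \<ominus>\<^bsub>X\<^esub> y) = f x \<ominus>\<^bsub>Y\<^esub> f y" if "x \<in> carrier X" "y \<in> carrier X"
    using that by (simp add: a_minus_def fadd)
  show "f (finsum X g I) = finsum Y (\<lambda>i. f (g i)) I" if "g \<in> I \<rightarrow> carrier X"
    by (rule additive_finsum) (use X.abelian_monoid_axioms Y.abelian_monoid_axioms f 0 fadd that in auto)
qed

lemma a_kernel_eq: "a_kernel X Y f = {x \<in> carrier X. f x = \<zero>\<^bsub>Y\<^esub>}"
  by (simp add: a_kernel_def kernel_def)

text \<open>Derived operations such as \<open>a_inv\<close> and \<open>finsum\<close> depend on a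
  few record fields only. This group of lemmas carries statements between records of different types
  that share those fields, for instance from an algebra to the complex built on it.\<close>

lemma a_inv_cong:
  "\<lbrakk>carrier X = carrier Y; add X = add Y; zero X = zero Y\<rbrakk> \<Longrightarrow> a_inv X = a_inv Y"
  by (rule ext) (simp add: a_inv_def m_inv_def)

lemma finsum_record_cong:
  "\<lbrakk>carrier X = carrier Y; add X = add Y; zero X = zero Y\<rbrakk> \<Longrightarrow> finsum X = finsum Y"
  by (intro ext) (simp add: finsum_def finprod_def)

lemma abelian_group_cong:
  assumes "abelian_group X" "carrier X = carrier Y" "add X = add Y" "zero X = zero Y"
  shows "abelian_group Y"
proof -
  interpret X: abelian_group X by fact
  show ?thesis
    unfolding abelian_group_def abelian_monoid_def abelian_group_axioms_def
    using X.a_comm_group X.a_comm_monoid assms(2-4)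
    unfolding comm_group_def group_def group_axioms_def Group.comm_monoid_def Group.monoid_def
      comm_monoid_axioms_def Units_def by simp
qed

lemma subgroup_add_monoid_cong:
  assumes "carrier X = carrier Y" "add X = add Y" "zero X = zero Y"
  shows "subgroup H (add_monoid X) = subgroup H (add_monoid Y)"
  using fun_cong[OF a_inv_cong[OF assms], unfolded a_inv_def] assms by (simp add: subgroup_def)

lemma module_cong:
  assumes "module R X" "carrier X = carrier Y" "add X = add Y" "zero X = zero Y" "smult X = smult Y"
  shows "module R Y"
  using assms abelian_group_cong[of X Y] by (simp add: module_def module_axioms_def)

lemma submodule_cong:
  assumes "carrier X = carrier Y" "add X = add Y" "zero X = zero Y" "smult X = smult Y"
  shows "submodule H R X = submodule H R Y"
  using subgroup_add_monoid_cong[OF assms(1-3)] assms(4)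
  by (simp add: submodule_def submodule_axioms_def)

lemma lin_span_cong:
  assumes "carrier X = carrier Y" "add X = add Y" "zero X = zero Y" "smult X = smult Y"
  shows "lin_span R X B = lin_span R Y B"
  unfolding lin_span_def submodule_cong[OF assms] ..

lemma (in abelian_group) minus_eq_zero_iff:
  "\<lbrakk>x \<in> carrier G; y \<in> carrier G\<rbrakk> \<Longrightarrow> x \<ominus> y = \<zero> \<longleftrightarrow> x = y"
  by (metis minus_eq r_neg minus_equality minus_minus a_inv_closed)

context module
begin

text \<open>Closure under negatives comes from the scalar minus one.\<close>

lemma submoduleI_smult:
  assumes "H \<subseteq> carrier M" "\<zero>\<^bsub>M\<^esub> \<in> H"
    and "\<And>a b. \<lbrakk>a \<in> H; b \<in> H\<rbrakk> \<Longrightarrow> a \<oplus>\<^bsub>M\<^esub> b \<in> H"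
    and "\<And>a x. \<lbrakk>a \<in> carrier R; x \<in> H\<rbrakk> \<Longrightarrow> a \<odot>\<^bsub>M\<^esub> x \<in> H"
  shows "submodule H R M"
proof (rule submoduleI)
  fix a assume a: "a \<in> H"
  then have "\<ominus>\<^bsub>M\<^esub> a = (\<ominus> \<one>) \<odot>\<^bsub>M\<^esub> a" using assms(1) smult_l_minus[of "\<one>" a] by auto
  then show "\<ominus>\<^bsub>M\<^esub> a \<in> H" using assms(4)[of "\<ominus> \<one>" a] a by simp
qed (use assms in auto)

lemma submodule_zero: "submodule H R M \<Longrightarrow> \<zero>\<^bsub>M\<^esub> \<in> H"
  using subgroup.one_closed[of H "add_monoid M"] by (simp add: submodule_def)

lemma submodule_minus: "\<lbrakk>submodule H R M; x \<in> H; y \<in> H\<rbrakk> \<Longrightarrow> x \<ominus>\<^bsub>M\<^esub> y \<in> H"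
  by (simp add: a_minus_def submoduleE)

lemma submodule_finsum:
  assumes "submodule H R M" "\<And>i. i \<in> I \<Longrightarrow> g i \<in> H"
  shows "finsum M g I \<in> H"
proof (cases "finite I")
  case True
  then show ?thesis using assms(2)
  proof (induction I rule: finite_induct)
    case empty
    then show ?case using submodule_zero[OF assms(1)] by simp
  next
    case (insert i I)
    have "g \<in> I \<rightarrow> carrier M" "g i \<in> carrier M"
      using insert.prems submoduleE(1)[OF assms(1)] by auto
    then show ?case using insert submoduleE(5)[OF assms(1)] by simp
  qed
next
  case False
  then show ?thesis using submodule_zero[OF assms(1)] by simp
qed

lemma submodule_Int: "\<lbrakk>submodule H R M; submodule K R M\<rbrakk> \<Longrightarrow> submodule (H \<inter> K) R M"
  by (rule submoduleI_smult) (auto simp: submoduleE(4,5) submodule_zero dest: submoduleE(1))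

lemma lin_span_submodule:
  assumes "B \<subseteq> carrier M"
  shows "submodule (lin_span R M B) R M"
proof (rule submoduleI_smult)
  show "lin_span R M B \<subseteq> carrier M"
    using assms carrier_is_submodule by (auto simp: lin_span_def)
qed (auto simp: lin_span_def submoduleE(4,5) submodule_zero)

lemma lin_span_incl: "b \<in> B \<Longrightarrow> b \<in> lin_span R M B"
  by (auto simp: lin_span_def)

lemma lin_span_least: "\<lbrakk>submodule H R M; B \<subseteq> H\<rbrakk> \<Longrightarrow> lin_span R M B \<subseteq> H"
  by (auto simp: lin_span_def)

lemma lin_span_carrier: "B \<subseteq> carrier M \<Longrightarrow> lin_span R M B \<subseteq> carrier M"
  by (rule lin_span_least[OF carrier_is_submodule])

lemma lin_span_induct [consumes 2, case_names zero base add smult]: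
  assumes x: "x \<in> lin_span R M B" and B: "B \<subseteq> carrier M"
    and "P \<zero>\<^bsub>M\<^esub>" and "\<And>b. b \<in> B \<Longrightarrow> P b"
    and "\<And>x y. \<lbrakk>x \<in> carrier M; y \<in> carrier M; P x; P y\<rbrakk> \<Longrightarrow> P (x \<oplus>\<^bsub>M\<^esub> y)"
    and "\<And>r x. \<lbrakk>r \<in> carrier R; x \<in> carrier M; P x\<rbrakk> \<Longrightarrow> P (r \<odot>\<^bsub>M\<^esub> x)"
  shows "P x"
proof -
  have "submodule {x \<in> carrier M. P x} R M"
    by (rule submoduleI_smult) (use assms in auto)
  from lin_span_least[OF this, of B] show ?thesis using assms by auto
qed

end

locale module_quot = module R M for R (structure) and M (structure) +
  fixes N assumes N: "submodule N R M"
begin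

sublocale abelian_subgroup N M
  by (rule abelian_subgroupI3) (use N in \<open>auto simp: additive_subgroup_def submodule_def M.abelian_group_axioms\<close>)

lemma coset_eq_iff:
  assumes "x \<in> carrier M" "y \<in> carrier M"
  shows "N +>\<^bsub>M\<^esub> x = N +>\<^bsub>M\<^esub> y \<longleftrightarrow> x \<ominus>\<^bsub>M\<^esub> y \<in> N"
proof -
  have "x \<ominus>\<^bsub>M\<^esub> y \<in> N \<longleftrightarrow> x \<in> N +>\<^bsub>M\<^esub> y"
    using a_rcos_module[OF assms(2,1)] by (simp add: a_minus_def)
  also have "\<dots> \<longleftrightarrow> N +>\<^bsub>M\<^esub> x = N +>\<^bsub>M\<^esub> y"
    using a_rcos_self[OF assms(1)] a_repr_independence'[OF _ assms(2), of x] by auto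
  finally show ?thesis by simp
qed

lemma coset_eq_zero_iff:
  assumes "x \<in> carrier M"
  shows "N +>\<^bsub>M\<^esub> x = N \<longleftrightarrow> x \<in> N"
  using assms a_rcos_const a_rcos_self by auto

text \<open>Operations on quotients are defined as unions over all representatives. When the
  operation is constant on a coset, the union collapses to its value at any single
  representative.\<close>

lemma UN_coset:
  assumes "x \<in> carrier M"
    and "\<And>y. \<lbrakk>y \<in> carrier M; y \<ominus>\<^bsub>M\<^esub> x \<in> N\<rbrakk> \<Longrightarrow> G y = G x"
  shows "(\<Union>y\<in>N +>\<^bsub>M\<^esub> x. G y) = G x"
proof -
  have "G y = G x" if "y \<in> N +>\<^bsub>M\<^esub> x" for y
    by (rule assms(2))
      (use a_elemrcos_carrier[OF assms(1) that] a_rcos_module_imp[OF assms(1) that]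
        in \<open>simp_all add: a_minus_def\<close>)
  then show ?thesis using a_rcos_self[OF assms(1)] by blast
qed

lemma quot_mod_sel [simp]:
  "carrier (quot_mod M N) = (\<lambda>x. N +>\<^bsub>M\<^esub> x) ` carrier M"
  "zero (quot_mod M N) = N"
  "one (quot_mod M N) = N +>\<^bsub>M\<^esub> \<one>\<^bsub>M\<^esub>"
  "add (quot_mod M N) = set_add M"
  "mult (quot_mod M N) = rcoset_mult M N"
  by (simp_all add: quot_mod_def ring.defs module.defs FactRing_def A_RCOSETS_def' UNION_singleton_eq_range)

lemma quot_smult:
  assumes "r \<in> carrier R" "x \<in> carrier M"
  shows "r \<odot>\<^bsub>quot_mod M N\<^esub> (N +>\<^bsub>M\<^esub> x) = N +>\<^bsub>M\<^esub> (r \<odot>\<^bsub>M\<^esub> x)"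
proof -
  have "(\<Union>y\<in>N +>\<^bsub>M\<^esub> x. N +>\<^bsub>M\<^esub> (r \<odot>\<^bsub>M\<^esub> y)) = N +>\<^bsub>M\<^esub> (r \<odot>\<^bsub>M\<^esub> x)"
  proof (rule UN_coset)
    fix y assume y: "y \<in> carrier M" "y \<ominus>\<^bsub>M\<^esub> x \<in> N"
    have "r \<odot>\<^bsub>M\<^esub> y \<ominus>\<^bsub>M\<^esub> r \<odot>\<^bsub>M\<^esub> x = r \<odot>\<^bsub>M\<^esub> (y \<ominus>\<^bsub>M\<^esub> x)"
      using assms y by (simp add: a_minus_def smult_r_distr smult_r_minus)
    then show "N +>\<^bsub>M\<^esub> (r \<odot>\<^bsub>M\<^esub> y) = N +>\<^bsub>M\<^esub> (r \<odot>\<^bsub>M\<^esub> x)"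
      using assms y submoduleE(4)[OF N] by (simp add: coset_eq_iff)
  qed (use assms in auto)
  then show ?thesis by (simp add: quot_mod_def ring.defs module.defs)
qed

lemma quot_mod_module: "module R (quot_mod M N)"
proof (rule moduleI)
  have "abelian_group (M Quot N)"
    by (rule comm_group_abelian_groupI)
      (simp add: FactRing_def a_factorgroup_is_comm_group[unfolded A_FactGroup_def'])
  then show "abelian_group (quot_mod M N)"
    by (rule abelian_group_cong) (simp_all add: quot_mod_def ring.defs)
qed (auto simp: quot_smult a_rcos_sum smult_l_distr smult_r_distr smult_assoc1 R.is_cring)

end

section \<open>Algebras over a commutative ring\<close>

text \<open>The ring \<open>X\<close> is not assumed commutative, since \<open>S\<close> commutes
  only up to signs. The two rules together make the elements r \<cdot> 1 central.\<close>

locale ralgebra = module R X + X?: ring X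
  for R :: "('r, 'p) ring_scheme" and X :: "('r, 'a, 'm) module_scheme" +
  assumes smult_mult_left: "\<And>r x y. \<lbrakk>r \<in> carrier R; x \<in> carrier X; y \<in> carrier X\<rbrakk>
      \<Longrightarrow> (r \<odot>\<^bsub>X\<^esub> x) \<otimes>\<^bsub>X\<^esub> y = r \<odot>\<^bsub>X\<^esub> (x \<otimes>\<^bsub>X\<^esub> y)"
    and smult_mult_right: "\<And>r x y. \<lbrakk>r \<in> carrier R; x \<in> carrier X; y \<in> carrier X\<rbrakk>
      \<Longrightarrow> x \<otimes>\<^bsub>X\<^esub> (r \<odot>\<^bsub>X\<^esub> y) = r \<odot>\<^bsub>X\<^esub> (x \<otimes>\<^bsub>X\<^esub> y)"

lemma ring_cong:
  assumes "ring X" "carrier X = carrier Y" "add X = add Y" "zero X = zero Y"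
    "mult X = mult Y" "one X = one Y"
  shows "ring Y"
proof -
  interpret X: ring X by fact
  show ?thesis
  proof (rule ringI)
    show "abelian_group Y" by (rule abelian_group_cong[OF X.is_abelian_group assms(2-4)])
    show "Group.monoid Y"
      by (rule monoidI) (simp_all add: assms(2-6)[symmetric] X.m_assoc)
  qed (simp_all add: assms(2-6)[symmetric] X.l_distr X.r_distr)
qed

lemma ralgebra_cong:
  assumes "ralgebra R X" "carrier X = carrier Y" "add X = add Y" "zero X = zero Y"
    "mult X = mult Y" "one X = one Y" "smult X = smult Y"
  shows "ralgebra R Y"
proof -
  interpret X: ralgebra R X by fact
  show ?thesis
    by (intro ralgebra.intro ralgebra_axioms.intro ring_cong[OF X.ring_axioms assms(2-6)]
        module_cong[OF X.module_axioms assms(2-4,7)])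
      (simp_all add: assms(2-7)[symmetric] X.smult_mult_left X.smult_mult_right)
qed

context ralgebra
begin

lemma ideal_submodule:
  assumes "ideal I X"
  shows "submodule I R X"
proof -
  interpret I: ideal I X by fact
  show ?thesis
  proof (rule submoduleI_smult[OF I.a_subset I.zero_closed I.a_closed])
    fix r x assume r: "r \<in> carrier R" "x \<in> I"
    have "r \<odot>\<^bsub>X\<^esub> x = (r \<odot>\<^bsub>X\<^esub> \<one>\<^bsub>X\<^esub>) \<otimes>\<^bsub>X\<^esub> x"
      using r I.Icarr[of x] by (simp add: smult_mult_left)
    then show "r \<odot>\<^bsub>X\<^esub> x \<in> I" using r I.I_l_closed[of x "r \<odot>\<^bsub>X\<^esub> \<one>\<^bsub>X\<^esub>"] by simp
  qed
qed

lemma ideal_module_quot: "ideal I X \<Longrightarrow> module_quot R X I"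
  by (intro module_quot.intro module_quot_axioms.intro module_axioms ideal_submodule)

lemma quot_mod_ralgebra:
  assumes "ideal I X"
  shows "ralgebra R (quot_mod X I)"
proof -
  interpret I: ideal I X by fact
  interpret Q: module_quot R X I by (rule ideal_module_quot) fact
  have "ring (quot_mod X I)"
    by (rule ring_cong[OF I.quotient_is_ring]) (simp_all add: quot_mod_def ring.defs)
  then show ?thesis
    by (intro ralgebra.intro ralgebra_axioms.intro Q.quot_mod_module)
      (auto simp: Q.quot_smult I.rcoset_mult_add smult_mult_left smult_mult_right)
qed

lemma coset_ring_hom:
  assumes "ideal I X"
  shows "(\<lambda>x. I +>\<^bsub>X\<^esub> x) \<in> ring_hom X (quot_mod X I)"
proof -
  interpret I: ideal I X by fact
  interpret Q: module_quot R X I by (rule ideal_module_quot) fact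
  show ?thesis
    by (rule ring_hom_memI) (simp_all add: I.rcoset_mult_add I.a_rcos_sum)
qed

end

text \<open>Preimages are chosen by \<open>inv_into\<close>; as \<open>h\<close> is constant on the
  fibres of \<open>g\<close>, the choice does not affect the value. This is how maps out of
  quotients are produced.\<close>

lemma factor_through_image:
  assumes "\<And>x y. \<lbrakk>x \<in> A; y \<in> A; g x = g y\<rbrakk> \<Longrightarrow> h x = h y"
  shows "\<exists>h'. \<forall>x\<in>A. h' (g x) = h x"
proof (intro exI ballI)
  fix x assume "x \<in> A"
  then show "h (inv_into A g (g x)) = h x"
    by (intro assms) (auto intro: inv_into_into f_inv_into_f)
qed

lemma (in ralgebra) quot_mod_lift:
  assumes I: "ideal I X" and "ring B" and h: "h \<in> ring_hom X B" and hI: "\<And>x. x \<in> I \<Longrightarrow> h x = \<zero>\<^bsub>B\<^esub>"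
  obtains h' where "h' \<in> ring_hom (quot_mod X I) B"
    and "\<And>x. x \<in> carrier X \<Longrightarrow> h' (I +>\<^bsub>X\<^esub> x) = h x"
proof -
  interpret I: ideal I X by fact
  interpret Q: module_quot R X I by (rule ideal_module_quot) fact
  interpret B: ring B by fact
  interpret h: ring_hom_ring X B h
    by (rule ring_hom_ringI2) (use h X.ring_axioms B.ring_axioms in auto)
  have "h x = h y" if "x \<in> carrier X" "y \<in> carrier X" "I +>\<^bsub>X\<^esub> x = I +>\<^bsub>X\<^esub> y" for x y
  proof -
    have "h x \<ominus>\<^bsub>B\<^esub> h y = h (x \<ominus>\<^bsub>X\<^esub> y)" using that by (simp add: a_minus_def)
    also have "\<dots> = \<zero>\<^bsub>B\<^esub>" using that hI Q.coset_eq_iff by simp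
    finally show ?thesis using that by (simp add: B.minus_eq_zero_iff)
  qed
  then obtain h' where h': "\<And>x. x \<in> carrier X \<Longrightarrow> h' (I +>\<^bsub>X\<^esub> x) = h x"
    using factor_through_image[of "carrier X" "\<lambda>x. I +>\<^bsub>X\<^esub> x" h] by blast
  have "h' \<in> ring_hom (quot_mod X I) B"
    by (rule ring_hom_memI) (auto simp: h' I.rcoset_mult_add I.a_rcos_sum)
  then show ?thesis using h' that by blast
qed

section \<open>The free algebra on words\<close>

text \<open>This is the multiplication of \<open>free_alg\<close> under a name of its own. It makes
  sense without finite support, so its laws can be proved by recursion on the word for arbitrary
  functions, including the shifted ones \<open>\<lambda>w. f (x # w)\<close>.\<close>

definition conv :: "('r, 'p) ring_scheme \<Rightarrow> ('a list \<Rightarrow> 'r) \<Rightarrow> ('a list \<Rightarrow> 'r) \<Rightarrow> 'a list \<Rightarrow> 'r" where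
  "conv R f g w = finsum R (\<lambda>k. f (take k w) \<otimes>\<^bsub>R\<^esub> g (drop k w)) {..length w}"

definition wprod :: "('b, 'n) ring_scheme \<Rightarrow> ('a \<Rightarrow> 'b) \<Rightarrow> 'a list \<Rightarrow> 'b" where
  "wprod B h w = foldr (\<lambda>a s. h a \<otimes>\<^bsub>B\<^esub> s) w \<one>\<^bsub>B\<^esub>"

lemma wprod_simps [simp]:
  "wprod B h [] = \<one>\<^bsub>B\<^esub>"
  "wprod B h (a # w) = h a \<otimes>\<^bsub>B\<^esub> wprod B h w"
  by (simp_all add: wprod_def)

context ring
begin

lemma wprod_closed [simp]: "\<lbrakk>h \<in> P \<rightarrow> carrier R; w \<in> lists P\<rbrakk> \<Longrightarrow> wprod R h w \<in> carrier R"
  by (induction w) auto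

lemma wprod_append:
  "\<lbrakk>h \<in> P \<rightarrow> carrier R; u \<in> lists P; v \<in> lists P\<rbrakk>
    \<Longrightarrow> wprod R h (u @ v) = wprod R h u \<otimes> wprod R h v"
proof (induction u)
  case (Cons a u)
  then have "h a \<in> carrier R" "wprod R h u \<in> carrier R" "wprod R h v \<in> carrier R" by auto
  then show ?case using Cons by (simp add: m_assoc)
qed simp

end

context cring
begin

lemma conv_Nil: "\<lbrakk>f [] \<in> carrier R; g [] \<in> carrier R\<rbrakk> \<Longrightarrow> conv R f g [] = f [] \<otimes> g []"
  by (simp add: conv_def)

text \<open>In a splitting of \<open>x # w\<close> the prefix is either empty or begins with
  \<open>x\<close>. The resulting recursion takes the place of a reindexing of double sums.\<close>

lemma conv_Cons:
  assumes "\<And>w. f w \<in> carrier R" "\<And>w. g w \<in> carrier R"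
  shows "conv R f g (x # w) = f [] \<otimes> g (x # w) \<oplus> conv R (\<lambda>w. f (x # w)) g w"
proof -
  have "conv R f g (x # w) = finsum R (\<lambda>k. f (take k (x # w)) \<otimes> g (drop k (x # w))) {..Suc (length w)}"
    by (simp add: conv_def)
  also have "\<dots> = conv R (\<lambda>w. f (x # w)) g w \<oplus> f [] \<otimes> g (x # w)"
    by (subst finsum_Suc2) (auto simp: assms conv_def)
  finally show ?thesis using assms by (simp add: a_comm conv_def)
qed

lemma conv_closed [simp]:
  "\<lbrakk>\<And>w. f w \<in> carrier R; \<And>w. g w \<in> carrier R\<rbrakk> \<Longrightarrow> conv R f g w \<in> carrier R"
  by (simp add: conv_def)

lemma conv_add_left:
  assumes "\<And>w. f w \<in> carrier R" "\<And>w. f' w \<in> carrier R" "\<And>w. g w \<in> carrier R"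
  shows "conv R (\<lambda>w. f w \<oplus> f' w) g w = conv R f g w \<oplus> conv R f' g w"
  using assms by (simp add: conv_def l_distr Pi_def)

lemma conv_add_right:
  assumes "\<And>w. f w \<in> carrier R" "\<And>w. g w \<in> carrier R" "\<And>w. g' w \<in> carrier R"
  shows "conv R f (\<lambda>w. g w \<oplus> g' w) w = conv R f g w \<oplus> conv R f g' w"
  using assms by (simp add: conv_def r_distr Pi_def)

lemma conv_smult_left:
  assumes "\<And>w. f w \<in> carrier R" "\<And>w. g w \<in> carrier R" "r \<in> carrier R"
  shows "conv R (\<lambda>w. r \<otimes> f w) g w = r \<otimes> conv R f g w"
  using assms by (simp add: conv_def finsum_rdistr Pi_def m_assoc)

lemma conv_smult_right:
  assumes "\<And>w. f w \<in> carrier R" "\<And>w. g w \<in> carrier R" "r \<in> carrier R"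
  shows "conv R f (\<lambda>w. r \<otimes> g w) w = r \<otimes> conv R f g w"
  using assms by (simp add: conv_def finsum_rdistr Pi_def m_lcomm)

lemma conv_zero_left:
  assumes "\<And>w. g w \<in> carrier R"
  shows "conv R (\<lambda>_. \<zero>) g w = \<zero>"
  using assms by (simp add: conv_def)

text \<open>The recursion for \<open>conv\<close> strips the first letter from the left factor, so
  the induction hypothesis is applied to a shifted \<open>f\<close>, and \<open>f\<close> has to be
  generalised.\<close>

lemma conv_assoc:
  assumes "\<And>w. f w \<in> carrier R" "\<And>w. g w \<in> carrier R" "\<And>w. h w \<in> carrier R"
  shows "conv R (conv R f g) h w = conv R f (conv R g h) w"
  using assms
proof (induction w arbitrary: f g)
  case Nil
  then show ?case by (simp add: conv_Nil m_assoc)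
next
  case (Cons x w)
  have "conv R (conv R f g) h (x # w)
      = conv R f g [] \<otimes> h (x # w) \<oplus> conv R (\<lambda>w. conv R f g (x # w)) h w"
    using Cons.prems by (simp add: conv_Cons)
  also have "conv R (\<lambda>w. conv R f g (x # w)) h w
      = conv R (\<lambda>w. f [] \<otimes> g (x # w)) h w \<oplus> conv R (conv R (\<lambda>w. f (x # w)) g) h w"
    using Cons.prems by (subst conv_add_left[symmetric]) (simp_all add: conv_Cons)
  also have "\<dots> = f [] \<otimes> conv R (\<lambda>w. g (x # w)) h w \<oplus> conv R (\<lambda>w. f (x # w)) (conv R g h) w"
    using Cons by (simp add: conv_smult_left)
  also have "conv R f g [] \<otimes> h (x # w) \<oplus> \<dots>
      = f [] \<otimes> (g [] \<otimes> h (x # w) \<oplus> conv R (\<lambda>w. g (x # w)) h w)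
        \<oplus> conv R (\<lambda>w. f (x # w)) (conv R g h) w"
    using Cons.prems by (simp add: conv_Nil m_assoc r_distr a_assoc)
  also have "\<dots> = conv R f (conv R g h) (x # w)"
    using Cons.prems by (simp add: conv_Cons)
  finally show ?case .
qed

lemma word_closed [simp]: "word R u w \<in> carrier R"
  by (simp add: word_def)

lemma conv_one_left:
  assumes "\<And>w. f w \<in> carrier R"
  shows "conv R (word R []) f w = f w"
proof (cases w)
  case Nil
  then show ?thesis using assms by (simp add: conv_Nil word_def)
next
  case (Cons x v)
  have "(\<lambda>w. word R [] (x # w)) = (\<lambda>_. \<zero>)" by (simp add: word_def fun_eq_iff)
  then show ?thesis using assms Cons
    by (simp add: conv_Cons conv_zero_left) (simp add: word_def)
qed

lemma conv_one_right:
  "(\<And>w. f w \<in> carrier R) \<Longrightarrow> conv R f (word R []) w = f w"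
proof (induction w arbitrary: f)
  case Nil
  then show ?case by (simp add: conv_Nil word_def)
next
  case (Cons x w)
  then show ?case by (simp add: conv_Cons) (simp add: word_def)
qed

lemma conv_word: "conv R (word R u) (word R v) w = word R (u @ v) w"
proof (induction u arbitrary: w)
  case Nil
  then show ?case by (simp add: conv_one_left)
next
  case (Cons x u)
  show ?case
  proof (cases w)
    case Nil
    then show ?thesis by (simp add: conv_Nil) (simp add: word_def)
  next
    case (Cons y w')
    have "(\<lambda>w. word R (x # u) (y # w)) = (if y = x then word R u else (\<lambda>_. \<zero>))"
      by (auto simp: word_def fun_eq_iff)
    moreover have "word R (x # u) [] = \<zero>" by (simp add: word_def)
    ultimately show ?thesis using Cons Cons.IH[of w']
      by (simp add: conv_Cons conv_zero_left) (simp add: word_def)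
  qed
qed

end

lemma free_alg_sel [simp]:
  "carrier (free_alg R P) = {f. (\<forall>w. f w \<in> carrier R) \<and> (\<forall>w. w \<notin> lists P \<longrightarrow> f w = \<zero>\<^bsub>R\<^esub>)
      \<and> finite {w. f w \<noteq> \<zero>\<^bsub>R\<^esub>}}"
  "mult (free_alg R P) = conv R"
  "one (free_alg R P) = word R []"
  "zero (free_alg R P) = (\<lambda>w. \<zero>\<^bsub>R\<^esub>)"
  "add (free_alg R P) = (\<lambda>f g w. f w \<oplus>\<^bsub>R\<^esub> g w)"
  "smult (free_alg R P) = (\<lambda>r f w. r \<otimes>\<^bsub>R\<^esub> f w)"
  by (auto simp: free_alg_def conv_def word_def fun_eq_iff)

context cring
begin

lemma free_alg_memD:
  assumes "f \<in> carrier (free_alg R P)"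
  shows "\<And>w. f w \<in> carrier R" "\<And>w. w \<notin> lists P \<Longrightarrow> f w = \<zero>" "finite {w. f w \<noteq> \<zero>}"
  using assms by auto

lemma word_mem: "u \<in> lists P \<Longrightarrow> word R u \<in> carrier (free_alg R P)"
  by (auto simp: word_def intro: finite_subset[of _ "{u}"])

lemma free_alg_ralgebra: "ralgebra R (free_alg R P)"
proof -
  let ?F = "free_alg R P"
  have add: "(\<lambda>w. f w \<oplus> g w) \<in> carrier ?F" if "f \<in> carrier ?F" "g \<in> carrier ?F" for f g
  proof -
    have "{w. f w \<oplus> g w \<noteq> \<zero>} \<subseteq> {w. f w \<noteq> \<zero>} \<union> {w. g w \<noteq> \<zero>}" by auto
    from finite_subset[OF this] show ?thesis using that by auto
  qed
  have smult: "(\<lambda>w. r \<otimes> f w) \<in> carrier ?F" if "r \<in> carrier R" "f \<in> carrier ?F" for r f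
  proof -
    have "{w. r \<otimes> f w \<noteq> \<zero>} \<subseteq> {w. f w \<noteq> \<zero>}" using that by auto
    from finite_subset[OF this] show ?thesis using that by auto
  qed
  have mult: "conv R f g \<in> carrier ?F" if f: "f \<in> carrier ?F" and g: "g \<in> carrier ?F" for f g
  proof -
    \<comment> \<open>A nonzero value of the product comes from some splitting with both factors
      nonzero. Hence the support consists of concatenations of words from the two supports, which
      gives its finiteness and its inclusion in \<open>lists P\<close>.\<close>
    have nz: "\<exists>k. f (take k w) \<noteq> \<zero> \<and> g (drop k w) \<noteq> \<zero>" if w: "conv R f g w \<noteq> \<zero>" for w
    proof (rule ccontr)
      assume "\<not> ?thesis"
      then have "f (take k w) \<otimes> g (drop k w) = \<zero>" for k
        using free_alg_memD(1)[OF f] free_alg_memD(1)[OF g] by (cases "f (take k w) = \<zero>") auto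
      then have "conv R f g w = \<zero>" by (simp add: conv_def)
      with w show False by simp
    qed
    have "{w. conv R f g w \<noteq> \<zero>} \<subseteq> (\<lambda>(u, v). u @ v) ` ({w. f w \<noteq> \<zero>} \<times> {w. g w \<noteq> \<zero>})"
    proof
      fix w assume "w \<in> {w. conv R f g w \<noteq> \<zero>}"
      then obtain k where "f (take k w) \<noteq> \<zero>" "g (drop k w) \<noteq> \<zero>" using nz by blast
      then show "w \<in> (\<lambda>(u, v). u @ v) ` ({w. f w \<noteq> \<zero>} \<times> {w. g w \<noteq> \<zero>})"
        by (auto intro!: image_eqI[of _ _ "(take k w, drop k w)"])
    qed
    then have "finite {w. conv R f g w \<noteq> \<zero>}"
      using free_alg_memD(3)[OF f] free_alg_memD(3)[OF g] by (auto intro: finite_subset)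
    moreover have "conv R f g w = \<zero>" if "w \<notin> lists P" for w
    proof (rule ccontr)
      assume "conv R f g w \<noteq> \<zero>"
      then obtain k where "f (take k w) \<noteq> \<zero>" "g (drop k w) \<noteq> \<zero>" using nz by blast
      then have "take k w \<in> lists P" "drop k w \<in> lists P"
        using free_alg_memD(2)[OF f] free_alg_memD(2)[OF g] by blast+
      then have "take k w @ drop k w \<in> lists P" by (simp only: append_in_lists_conv)
      with that show False by simp
    qed
    ultimately show ?thesis using f g by simp
  qed
  have neg: "\<exists>g\<in>carrier ?F. (\<lambda>w. g w \<oplus> f w) = (\<lambda>w. \<zero>)" if "f \<in> carrier ?F" for f
  proof
    show "(\<lambda>w. (\<ominus> \<one>) \<otimes> f w) \<in> carrier ?F" using smult[of "\<ominus> \<one>" f] that by simp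
    show "(\<lambda>w. (\<ominus> \<one>) \<otimes> f w \<oplus> f w) = (\<lambda>w. \<zero>)"
      using free_alg_memD(1)[OF that] by (simp add: l_minus l_neg)
  qed
  have ab: "abelian_group ?F"
    by (rule abelian_groupI)
      (use add neg in \<open>auto simp: fun_eq_iff a_ac\<close>)
  have mon: "Group.monoid ?F"
    by (rule monoidI)
      (use mult word_mem[of "[]" P] in \<open>auto simp: fun_eq_iff conv_assoc conv_one_left conv_one_right\<close>)
  have "ring ?F"
    by (rule ringI[OF ab mon]) (auto simp: fun_eq_iff conv_add_left conv_add_right)
  moreover have "module R ?F"
    by (rule moduleI[OF is_cring ab])
      (use smult in \<open>auto simp: fun_eq_iff l_distr r_distr m_assoc\<close>)
  ultimately show ?thesis
    by (intro ralgebra.intro ralgebra_axioms.intro)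
      (auto simp: fun_eq_iff conv_smult_left conv_smult_right)
qed

text \<open>An element is a finite combination of words. The induction runs over a finite set that
  contains the support and sets the value at one word to zero at each step.\<close>

lemma free_alg_induct [consumes 1, case_names zero add word]:
  assumes f: "f \<in> carrier (free_alg R P)"
    and zero: "Q (\<lambda>_. \<zero>)"
    and add: "\<And>f g. \<lbrakk>f \<in> carrier (free_alg R P); g \<in> carrier (free_alg R P); Q f; Q g\<rbrakk>
      \<Longrightarrow> Q (\<lambda>w. f w \<oplus> g w)"
    and word: "\<And>r u. \<lbrakk>r \<in> carrier R; u \<in> lists P\<rbrakk> \<Longrightarrow> Q (\<lambda>w. r \<otimes> word R u w)"
  shows "Q f"
proof -
  interpret F: ralgebra R "free_alg R P" by (rule free_alg_ralgebra)
  have "Q f" if "finite U" "f \<in> carrier (free_alg R P)" "{w. f w \<noteq> \<zero>} \<subseteq> U" for U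
    using that
  proof (induction U arbitrary: f rule: finite_induct)
    case empty
    then have "f = (\<lambda>_. \<zero>)" by auto
    then show ?case using zero by simp
  next
    case (insert u U)
    show ?case
    proof (cases "f u = \<zero>")
      case True
      then have "{w. f w \<noteq> \<zero>} \<subseteq> U" using insert.prems by auto
      then show ?thesis using insert.IH insert.prems by blast
    next
      case False
      have fw: "\<And>w. f w \<in> carrier R" using free_alg_memD(1)[OF insert.prems(1)] .
      have u: "u \<in> lists P" using False free_alg_memD(2)[OF insert.prems(1)] by blast
      have gF: "f(u := \<zero>) \<in> carrier (free_alg R P)"
        using insert.prems fw by (auto intro: finite_subset[of _ "{w. f w \<noteq> \<zero>}"])
      have Qg: "Q (f(u := \<zero>))"
        by (rule insert.IH[OF gF]) (use insert.prems in auto)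
      have "(\<lambda>w. f u \<otimes> word R u w) \<in> carrier (free_alg R P)"
        using F.smult_closed[OF fw word_mem[OF u]] by simp
      then have "Q (\<lambda>w. f u \<otimes> word R u w \<oplus> (f(u := \<zero>)) w)"
        using gF word[OF fw[of u] u] Qg by (rule add)
      also have "(\<lambda>w. f u \<otimes> word R u w \<oplus> (f(u := \<zero>)) w) = f"
        using fw by (auto simp: word_def fun_eq_iff)
      finally show ?thesis .
    qed
  qed
  from this[OF free_alg_memD(3)[OF f] f] show ?thesis by blast
qed

text \<open>The target is a ring with a central homomorphism \<open>c\<close> from \<open>R\<close>
  instead of an algebra record, because the targets used later (polynomials, triangular matrices,
  trivial extensions) carry no scalar multiplication by \<open>R\<close>.\<close>

lemma free_alg_lift:
  assumes "ring B" and c: "c \<in> ring_hom R B"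
    and central: "\<And>r b. \<lbrakk>r \<in> carrier R; b \<in> carrier B\<rbrakk> \<Longrightarrow> c r \<otimes>\<^bsub>B\<^esub> b = b \<otimes>\<^bsub>B\<^esub> c r"
    and h: "h \<in> P \<rightarrow> carrier B"
  obtains E where "E \<in> ring_hom (free_alg R P) B"
    and "\<And>r f. \<lbrakk>r \<in> carrier R; f \<in> carrier (free_alg R P)\<rbrakk>
      \<Longrightarrow> E (r \<odot>\<^bsub>free_alg R P\<^esub> f) = c r \<otimes>\<^bsub>B\<^esub> E f"
    and "\<And>u. u \<in> lists P \<Longrightarrow> E (word R u) = wprod B h u"
proof -
  let ?F = "free_alg R P"
  interpret F: ralgebra R ?F by (rule free_alg_ralgebra)
  interpret B: ring B by fact
  interpret c: ring_hom_ring R B c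
    by (rule ring_hom_ringI2) (use c ring_axioms B.ring_axioms in auto)
  define E where "E f = finsum B (\<lambda>w. c (f w) \<otimes>\<^bsub>B\<^esub> wprod B h w) {w. f w \<noteq> \<zero>}" for f
  have wp [simp]: "wprod B h w \<in> carrier B" if "w \<in> lists P" for w
    using B.wprod_closed[OF h that] .
  have trm: "c (f w) \<otimes>\<^bsub>B\<^esub> wprod B h w \<in> carrier B" if "f \<in> carrier ?F" "w \<in> lists P" for f w
    using that by simp
  \<comment> \<open>\<open>U\<close> may be any finite set between the support and
    \<open>lists P\<close>, so that two elements can be evaluated over a common index set. Outside
    \<open>lists P\<close> the products \<open>wprod B h w\<close> may leave the carrier.\<close>
  have E_eq: "E f = finsum B (\<lambda>w. c (f w) \<otimes>\<^bsub>B\<^esub> wprod B h w) U"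
    if f: "f \<in> carrier ?F" and U: "finite U" "{w. f w \<noteq> \<zero>} \<subseteq> U" "U \<subseteq> lists P" for f U
    unfolding E_def
  proof (rule B.add.finprod_mono_neutral_cong_left[OF U(1,2)])
    fix w assume "w \<in> U - {w. f w \<noteq> \<zero>}"
    then have "w \<in> lists P" "f w = \<zero>" using U(3) by blast+
    then show "c (f w) \<otimes>\<^bsub>B\<^esub> wprod B h w = \<zero>\<^bsub>B\<^esub>" using B.l_null[OF wp[of w]] by simp
  qed (use trm[OF f] U(3) in auto)
  have supp: "finite {w. f w \<noteq> \<zero>}" "{w. f w \<noteq> \<zero>} \<subseteq> lists P" if "f \<in> carrier ?F" for f
    using free_alg_memD(2,3)[OF that] by blast+
  have E_closed: "E f \<in> carrier B" if "f \<in> carrier ?F" for f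
    unfolding E_def by (rule B.finsum_closed) (use trm[OF that] supp[OF that] in auto)
  have E_add: "E (f \<oplus>\<^bsub>?F\<^esub> g) = E f \<oplus>\<^bsub>B\<^esub> E g" if f: "f \<in> carrier ?F" and g: "g \<in> carrier ?F" for f g
  proof -
    obtain U where U: "finite U" "U \<subseteq> lists P" "{w. f w \<noteq> \<zero>} \<subseteq> U" "{w. g w \<noteq> \<zero>} \<subseteq> U"
      using supp[OF f] supp[OF g]
      by (intro that[of "{w. f w \<noteq> \<zero>} \<union> {w. g w \<noteq> \<zero>}"]) auto
    have wU: "wprod B h w \<in> carrier B" if "w \<in> U" for w using U(2) that by (intro wp) blast
    have fg: "f \<oplus>\<^bsub>?F\<^esub> g \<in> carrier ?F" using f g by (rule F.M.a_closed)
    note fw = free_alg_memD(1)[OF f] and gw = free_alg_memD(1)[OF g]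
    have "E (f \<oplus>\<^bsub>?F\<^esub> g) = finsum B (\<lambda>w. c ((f \<oplus>\<^bsub>?F\<^esub> g) w) \<otimes>\<^bsub>B\<^esub> wprod B h w) U"
    proof (rule E_eq[OF fg U(1) _ U(2)], rule subsetI)
      fix w assume "w \<in> {w. (f \<oplus>\<^bsub>?F\<^esub> g) w \<noteq> \<zero>}"
      then have "f w \<noteq> \<zero> \<or> g w \<noteq> \<zero>" by auto
      then show "w \<in> U" using U(3,4) by blast
    qed
    also have "\<dots> = finsum B (\<lambda>w. c (f w) \<otimes>\<^bsub>B\<^esub> wprod B h w \<oplus>\<^bsub>B\<^esub> c (g w) \<otimes>\<^bsub>B\<^esub> wprod B h w) U"
      using fw gw wU by (intro B.finsum_cong') (auto simp: B.l_distr)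
    also have "\<dots> = finsum B (\<lambda>w. c (f w) \<otimes>\<^bsub>B\<^esub> wprod B h w) U
        \<oplus>\<^bsub>B\<^esub> finsum B (\<lambda>w. c (g w) \<otimes>\<^bsub>B\<^esub> wprod B h w) U"
      by (rule B.finsum_addf) (use wU fw gw in auto)
    also have "\<dots> = E f \<oplus>\<^bsub>B\<^esub> E g"
      using E_eq[OF f U(1,3,2)] E_eq[OF g U(1,4,2)] by simp
    finally show ?thesis .
  qed
  have E_smult: "E (r \<odot>\<^bsub>?F\<^esub> f) = c r \<otimes>\<^bsub>B\<^esub> E f" if r: "r \<in> carrier R" and f: "f \<in> carrier ?F" for r f
  proof -
    obtain U where U: "finite U" "U \<subseteq> lists P" "{w. f w \<noteq> \<zero>} \<subseteq> U"
      using supp[OF f] by blast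
    have wU: "wprod B h w \<in> carrier B" if "w \<in> U" for w using U(2) that by (intro wp) blast
    note fw = free_alg_memD(1)[OF f]
    have "r \<odot>\<^bsub>?F\<^esub> f \<in> carrier ?F" using r f by (rule F.smult_closed)
    then have "E (r \<odot>\<^bsub>?F\<^esub> f) = finsum B (\<lambda>w. c ((r \<odot>\<^bsub>?F\<^esub> f) w) \<otimes>\<^bsub>B\<^esub> wprod B h w) U"
    proof (rule E_eq[OF _ U(1) _ U(2)], intro subsetI)
      fix w assume "w \<in> {w. (r \<odot>\<^bsub>?F\<^esub> f) w \<noteq> \<zero>}"
      then have "f w \<noteq> \<zero>" using r by auto
      then show "w \<in> U" using U(3) by blast
    qed
    also have "\<dots> = finsum B (\<lambda>w. c r \<otimes>\<^bsub>B\<^esub> (c (f w) \<otimes>\<^bsub>B\<^esub> wprod B h w)) U"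
      using fw wU r by (intro B.finsum_cong') (auto simp: B.m_assoc)
    also have "\<dots> = c r \<otimes>\<^bsub>B\<^esub> E f"
      unfolding E_eq[OF f U(1,3,2)]
      by (rule B.finsum_rdistr[symmetric]) (use U wU fw r in auto)
    finally show ?thesis .
  qed
  have E_word: "E (word R u) = wprod B h u" if "u \<in> lists P" for u
  proof -
    have "E (word R u) = finsum B (\<lambda>w. c (word R u w) \<otimes>\<^bsub>B\<^esub> wprod B h w) {u}"
      by (rule E_eq) (use word_mem[OF that] that in \<open>auto simp: word_def\<close>)
    then show ?thesis using that by (simp add: word_def)
  qed
  have E_zero: "E (\<lambda>_. \<zero>) = \<zero>\<^bsub>B\<^esub>" by (simp add: E_def)
  \<comment> \<open>The cases of the induction rule speak of lambda terms. These equations turn them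
    back into operations of the record, and \<open>free_alg_sel\<close> is kept out of the
    simplifier so that they stay folded.\<close>
  have zF: "(\<lambda>_. \<zero>) = \<zero>\<^bsub>?F\<^esub>" by simp
  have aF: "(\<lambda>w. f w \<oplus> g w) = f \<oplus>\<^bsub>?F\<^esub> g" and sF: "(\<lambda>w. r \<otimes> f w) = r \<odot>\<^bsub>?F\<^esub> f" for f g r
    by simp_all
  \<comment> \<open>Multiplicativity is bilinear in the two factors and is extended from words one
    factor at a time. Centrality of \<open>c\<close> moves the scalar of the right factor past the
    value of the left one.\<close>
  have E_word_mult: "E (word R u \<otimes>\<^bsub>?F\<^esub> g) = E (word R u) \<otimes>\<^bsub>B\<^esub> E g"
    if u: "u \<in> lists P" and g: "g \<in> carrier ?F" for u g
    using g
  proof (induction g rule: free_alg_induct)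
    case zero
    have "E (word R u \<otimes>\<^bsub>?F\<^esub> \<zero>\<^bsub>?F\<^esub>) = \<zero>\<^bsub>B\<^esub>" "E \<zero>\<^bsub>?F\<^esub> = \<zero>\<^bsub>B\<^esub>"
      using F.X.r_null[OF word_mem[OF u]] E_zero by simp_all
    then show ?case using u E_word[OF u] by (simp del: free_alg_sel add: zF)
  next
    case (add f g)
    have "E (word R u \<otimes>\<^bsub>?F\<^esub> (f \<oplus>\<^bsub>?F\<^esub> g)) = E (word R u) \<otimes>\<^bsub>B\<^esub> E (f \<oplus>\<^bsub>?F\<^esub> g)"
      using add word_mem[OF u] E_closed
      by (simp del: free_alg_sel add: F.X.r_distr E_add B.r_distr)
    then show ?case by (simp only: aF)
  next
    case (word r v)
    have "E (word R u \<otimes>\<^bsub>?F\<^esub> (r \<odot>\<^bsub>?F\<^esub> word R v)) = c r \<otimes>\<^bsub>B\<^esub> E (word R u \<otimes>\<^bsub>?F\<^esub> word R v)"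
      using word word_mem[OF u] word_mem[of v P]
      by (simp del: free_alg_sel add: F.smult_mult_right E_smult)
    also have "word R u \<otimes>\<^bsub>?F\<^esub> word R v = word R (u @ v)"
      by (simp add: conv_word fun_eq_iff)
    also have "c r \<otimes>\<^bsub>B\<^esub> E (word R (u @ v)) = (c r \<otimes>\<^bsub>B\<^esub> wprod B h u) \<otimes>\<^bsub>B\<^esub> wprod B h v"
      using u word by (simp add: E_word B.wprod_append[OF h] B.m_assoc)
    also have "\<dots> = E (word R u) \<otimes>\<^bsub>B\<^esub> E (r \<odot>\<^bsub>?F\<^esub> word R v)"
      using u word word_mem[of v P]
      by (simp del: free_alg_sel add: E_word E_smult central B.m_assoc)
    finally show ?case by (simp only: sF)
  qed
  have E_mult: "E (f \<otimes>\<^bsub>?F\<^esub> g) = E f \<otimes>\<^bsub>B\<^esub> E g" if f: "f \<in> carrier ?F" and g: "g \<in> carrier ?F" for f g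
    using f
  proof (induction f rule: free_alg_induct)
    case zero
    have "E (\<zero>\<^bsub>?F\<^esub> \<otimes>\<^bsub>?F\<^esub> g) = \<zero>\<^bsub>B\<^esub>" "E \<zero>\<^bsub>?F\<^esub> = \<zero>\<^bsub>B\<^esub>"
      using F.X.l_null[OF g] E_zero by simp_all
    then show ?case using E_closed[OF g] by (simp del: free_alg_sel add: zF)
  next
    case (add f f')
    have "E ((f \<oplus>\<^bsub>?F\<^esub> f') \<otimes>\<^bsub>?F\<^esub> g) = E (f \<oplus>\<^bsub>?F\<^esub> f') \<otimes>\<^bsub>B\<^esub> E g"
      using add g E_closed by (simp del: free_alg_sel add: F.X.l_distr E_add B.l_distr)
    then show ?case by (simp only: aF)
  next
    case (word r u)
    have "E ((r \<odot>\<^bsub>?F\<^esub> word R u) \<otimes>\<^bsub>?F\<^esub> g) = E (r \<odot>\<^bsub>?F\<^esub> word R u) \<otimes>\<^bsub>B\<^esub> E g"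
      using word g word_mem[of u P] E_closed
      by (simp del: free_alg_sel add: F.smult_mult_left E_smult E_word_mult B.m_assoc)
    then show ?case by (simp only: sF)
  qed
  have "E \<in> ring_hom ?F B"
  proof (rule ring_hom_memI)
    show "E \<one>\<^bsub>?F\<^esub> = \<one>\<^bsub>B\<^esub>" using E_word[of "[]"] by simp
  qed (use E_closed E_add E_mult in \<open>simp_all del: free_alg_sel\<close>)
  then show ?thesis using that E_smult E_word by blast
qed

end

section \<open>Graded modules and complexes\<close>

text \<open>Only the pieces are required to be submodules. The locale provides the means to prove
  that their sum is direct, for \<open>S\<close> and for quotient complexes, before either is known
  to be a complex.\<close>

locale graded_module = module R X
  for R :: "('r, 'p) ring_scheme" and X :: "('r, 'a, 'm) graded_complex_scheme" +
  assumes homog_submodule: "\<And>i. submodule (homog X i) R X"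
begin

lemma homog_closed: "x \<in> homog X i \<Longrightarrow> x \<in> carrier X"
  using submoduleE(1)[OF homog_submodule] by blast

lemma homog_zero [simp]: "\<zero>\<^bsub>X\<^esub> \<in> homog X i"
  by (rule submodule_zero[OF homog_submodule])

lemma homog_add: "\<lbrakk>x \<in> homog X i; y \<in> homog X i\<rbrakk> \<Longrightarrow> x \<oplus>\<^bsub>X\<^esub> y \<in> homog X i"
  by (rule submoduleE(5)[OF homog_submodule])

lemma homog_smult: "\<lbrakk>r \<in> carrier R; x \<in> homog X i\<rbrakk> \<Longrightarrow> r \<odot>\<^bsub>X\<^esub> x \<in> homog X i"
  by (rule submoduleE(4)[OF homog_submodule])

lemma is_hdecompI:
  assumes "finite I" "\<And>i. i \<in> I \<Longrightarrow> c i \<in> homog X i" "\<And>i. i \<notin> I \<Longrightarrow> c i = \<zero>\<^bsub>X\<^esub>" "x = finsum X c I"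
  shows "is_hdecomp X x c"
proof -
  have sub: "{i. c i \<noteq> \<zero>\<^bsub>X\<^esub>} \<subseteq> I" using assms(3) by blast
  have c: "c i \<in> homog X i" for i using assms(2,3) by (cases "i \<in> I") auto
  have "finsum X c {i. c i \<noteq> \<zero>\<^bsub>X\<^esub>} = finsum X c I"
    by (rule M.add.finprod_mono_neutral_cong_left[OF assms(1) sub]) (use c homog_closed in auto)
  then show ?thesis
    using c finite_subset[OF sub assms(1)] assms(4) by (simp add: is_hdecomp_def)
qed

lemma hdecomp_closed: "is_hdecomp X x c \<Longrightarrow> x \<in> carrier X"
  using homog_closed by (auto simp: is_hdecomp_def intro!: M.finsum_closed)

lemma hdecomp_finsum_superset:
  assumes "is_hdecomp X x c" "finite I" "{i. c i \<noteq> \<zero>\<^bsub>X\<^esub>} \<subseteq> I"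
  shows "finsum X c I = x"
proof -
  have c: "c i \<in> carrier X" for i using assms(1) homog_closed by (auto simp: is_hdecomp_def)
  have "finsum X c {i. c i \<noteq> \<zero>\<^bsub>X\<^esub>} = finsum X c I"
    by (rule M.add.finprod_mono_neutral_cong_left) (use assms c in auto)
  then show ?thesis using assms(1) by (simp add: is_hdecomp_def)
qed

lemma hdecomp_add:
  assumes "is_hdecomp X x c" "is_hdecomp X y d"
  shows "is_hdecomp X (x \<oplus>\<^bsub>X\<^esub> y) (\<lambda>i. c i \<oplus>\<^bsub>X\<^esub> d i)"
proof -
  let ?I = "{i. c i \<noteq> \<zero>\<^bsub>X\<^esub>} \<union> {i. d i \<noteq> \<zero>\<^bsub>X\<^esub>}"
  have h: "c i \<in> homog X i" "d i \<in> homog X i" for i using assms by (auto simp: is_hdecomp_def)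
  have fin: "finite ?I" using assms by (auto simp: is_hdecomp_def)
  show ?thesis
  proof (rule is_hdecompI[OF fin])
    show "x \<oplus>\<^bsub>X\<^esub> y = finsum X (\<lambda>i. c i \<oplus>\<^bsub>X\<^esub> d i) ?I"
      using hdecomp_finsum_superset[OF assms(1) fin] hdecomp_finsum_superset[OF assms(2) fin]
        h homog_closed by (subst M.finsum_addf) auto
  qed (use h homog_add in auto)
qed

lemma hdecomp_smult:
  assumes "is_hdecomp X x c" "r \<in> carrier R"
  shows "is_hdecomp X (r \<odot>\<^bsub>X\<^esub> x) (\<lambda>i. r \<odot>\<^bsub>X\<^esub> c i)"
proof -
  let ?I = "{i. c i \<noteq> \<zero>\<^bsub>X\<^esub>}"
  have h: "c i \<in> homog X i" for i using assms by (auto simp: is_hdecomp_def)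
  have fin: "finite ?I" using assms by (auto simp: is_hdecomp_def)
  show ?thesis
  proof (rule is_hdecompI[OF fin])
    show "r \<odot>\<^bsub>X\<^esub> x = finsum X (\<lambda>i. r \<odot>\<^bsub>X\<^esub> c i) ?I"
      using assms h homog_closed fin by (subst finsum_smult_ldistr[symmetric]) (auto simp: is_hdecomp_def)
  qed (use assms h homog_smult in auto)
qed

lemma hdecomp_single:
  assumes "x \<in> homog X i"
  shows "is_hdecomp X x (\<lambda>j. if j = i then x else \<zero>\<^bsub>X\<^esub>)"
  by (rule is_hdecompI[of "{i}"]) (use assms homog_closed in auto)

text \<open>Reduces the existence of decompositions to a spanning set.\<close>

lemma hdecomp_exists_submodule: "submodule {x \<in> carrier X. \<exists>c. is_hdecomp X x c} R X"
proof (rule submoduleI_smult)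
  show "\<zero>\<^bsub>X\<^esub> \<in> {x \<in> carrier X. \<exists>c. is_hdecomp X x c}"
    using hdecomp_single[of "\<zero>\<^bsub>X\<^esub>" 0] by auto
qed (use hdecomp_add hdecomp_smult in blast)+

text \<open>An additive map that kills all pieces except the one of degree \<open>i\<close> sees
  only the component \<open>c i\<close>. If it is faithful on that piece, \<open>c i\<close> is
  determined by \<open>x\<close>; this is the source of uniqueness of decompositions.\<close>

lemma hdecomp_eq_proj:
  assumes "is_hdecomp X x c" "abelian_group Z"
    and p: "\<And>x. x \<in> carrier X \<Longrightarrow> p x \<in> carrier Z"
    and padd: "\<And>x y. \<lbrakk>x \<in> carrier X; y \<in> carrier X\<rbrakk> \<Longrightarrow> p (x \<oplus>\<^bsub>X\<^esub> y) = p x \<oplus>\<^bsub>Z\<^esub> p y"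
    and p0: "\<And>j x. \<lbrakk>j \<noteq> i; x \<in> homog X j\<rbrakk> \<Longrightarrow> p x = \<zero>\<^bsub>Z\<^esub>"
  shows "p x = p (c i)"
proof -
  interpret Z: abelian_group Z by fact
  let ?I = "insert i {i. c i \<noteq> \<zero>\<^bsub>X\<^esub>}"
  have h: "c i \<in> homog X i" for i using assms by (auto simp: is_hdecomp_def)
  have fin: "finite ?I" using assms by (auto simp: is_hdecomp_def)
  have pc: "p (c j) \<in> carrier Z" for j using p[OF homog_closed[OF h]] .
  have "p x = p (finsum X c ?I)" using hdecomp_finsum_superset[OF assms(1) fin] by auto
  also have "\<dots> = finsum Z (\<lambda>j. p (c j)) ?I"
    by (rule additive_map_finsum[OF M.abelian_group_axioms assms(2) p padd])
      (use h homog_closed in auto)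
  also have "\<dots> = finsum Z (\<lambda>j. p (c j)) {i}"
    by (rule Z.add.finprod_mono_neutral_cong_right[OF fin])
      (use p0 h pc in auto)
  also have "\<dots> = p (c i)" using pc by simp
  finally show ?thesis .
qed

end

sublocale rcomplex \<subseteq> graded_module
  by (intro graded_module.intro graded_module_axioms.intro) (rule module_axioms, rule homog_submodule)

lemma (in abelian_monoid) finsum_induct:
  assumes "\<And>i. i \<in> I \<Longrightarrow> g i \<in> carrier G" "\<And>i. i \<in> I \<Longrightarrow> P (g i)" "P \<zero>"
    and "\<And>x y. \<lbrakk>x \<in> carrier G; y \<in> carrier G; P x; P y\<rbrakk> \<Longrightarrow> P (x \<oplus> y)"
  shows "P (finsum G g I)"
proof (cases "finite I")
  case True
  then show ?thesis using assms(1,2)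
  proof (induction I rule: finite_induct)
    case (insert i I)
    have "finsum G g I \<in> carrier G" "g i \<in> carrier G" "g \<in> I \<rightarrow> carrier G"
      using insert.prems by (auto intro: finsum_closed)
    then show ?case using insert assms(4) by simp
  qed (simp add: assms(3))
qed (simp add: assms(3))

context rcomplex
begin

lemma hcomp_decomp: "x \<in> carrier X \<Longrightarrow> is_hdecomp X x (hcomp X x)"
  using theI'[OF homog_direct_sum, of x] by (simp add: hcomp_def)

lemma hcomp_eqI: "is_hdecomp X x c \<Longrightarrow> hcomp X x = c"
  using hcomp_decomp[OF hdecomp_closed] homog_direct_sum[OF hdecomp_closed] by blast

lemma hcomp_homog [intro]: "x \<in> carrier X \<Longrightarrow> hcomp X x i \<in> homog X i"
  using hcomp_decomp by (auto simp: is_hdecomp_def)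

lemma hcomp_closed [simp]: "x \<in> carrier X \<Longrightarrow> hcomp X x i \<in> carrier X"
  using hcomp_homog homog_closed by blast

lemma hcomp_finite: "x \<in> carrier X \<Longrightarrow> finite {i. hcomp X x i \<noteq> \<zero>\<^bsub>X\<^esub>}"
  using hcomp_decomp by (auto simp: is_hdecomp_def)

lemma hcomp_finsum: "x \<in> carrier X \<Longrightarrow> finsum X (hcomp X x) {i. hcomp X x i \<noteq> \<zero>\<^bsub>X\<^esub>} = x"
  using hcomp_decomp[of x] by (simp add: is_hdecomp_def)

lemma hcomp_add:
  "\<lbrakk>x \<in> carrier X; y \<in> carrier X\<rbrakk> \<Longrightarrow> hcomp X (x \<oplus>\<^bsub>X\<^esub> y) i = hcomp X x i \<oplus>\<^bsub>X\<^esub> hcomp X y i"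
  using hcomp_eqI[OF hdecomp_add[OF hcomp_decomp hcomp_decomp]] by simp

lemma hcomp_smult:
  "\<lbrakk>r \<in> carrier R; x \<in> carrier X\<rbrakk> \<Longrightarrow> hcomp X (r \<odot>\<^bsub>X\<^esub> x) i = r \<odot>\<^bsub>X\<^esub> hcomp X x i"
  using hcomp_eqI[OF hdecomp_smult[OF hcomp_decomp]] by simp

lemma hcomp_of_homog: "x \<in> homog X i \<Longrightarrow> hcomp X x j = (if j = i then x else \<zero>\<^bsub>X\<^esub>)"
  using hcomp_eqI[OF hdecomp_single] by simp

lemma hcomp_minus:
  "\<lbrakk>x \<in> carrier X; y \<in> carrier X\<rbrakk> \<Longrightarrow> hcomp X (x \<ominus>\<^bsub>X\<^esub> y) i = hcomp X x i \<ominus>\<^bsub>X\<^esub> hcomp X y i"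
  by (rule additive_map_minus[OF M.abelian_group_axioms M.abelian_group_axioms])
    (simp_all add: hcomp_add)

lemma homog_induct [consumes 1, case_names zero homog add]:
  assumes "x \<in> carrier X" "P \<zero>\<^bsub>X\<^esub>" "\<And>i x. x \<in> homog X i \<Longrightarrow> P x"
    and "\<And>x y. \<lbrakk>x \<in> carrier X; y \<in> carrier X; P x; P y\<rbrakk> \<Longrightarrow> P (x \<oplus>\<^bsub>X\<^esub> y)"
  shows "P x"
proof -
  have "P (finsum X (hcomp X x) {i. hcomp X x i \<noteq> \<zero>\<^bsub>X\<^esub>})"
    by (rule M.finsum_induct) (use assms in auto)
  then show ?thesis using hcomp_finsum[OF assms(1)] by simp
qed

text \<open>The locale gives closure on the homogeneous pieces only; additivity extends it to their
  sum.\<close>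

lemma diff_closed [simp]: "x \<in> carrier X \<Longrightarrow> diff X x \<in> carrier X"
proof (induction x rule: homog_induct)
  case zero
  then show ?case using diff_degree[of "\<zero>\<^bsub>X\<^esub>" 0] homog_closed by auto
qed (use diff_degree homog_closed in \<open>auto simp: diff_add\<close>)

lemma diff_zero [simp]: "diff X \<zero>\<^bsub>X\<^esub> = \<zero>\<^bsub>X\<^esub>"
  by (rule additive_map_zero[OF M.abelian_group_axioms M.abelian_group_axioms]) (simp_all add: diff_add)

lemma diff_minus:
  "\<lbrakk>x \<in> carrier X; y \<in> carrier X\<rbrakk> \<Longrightarrow> diff X (x \<ominus>\<^bsub>X\<^esub> y) = diff X x \<ominus>\<^bsub>X\<^esub> diff X y"
  by (rule additive_map_minus[OF M.abelian_group_axioms M.abelian_group_axioms]) (simp_all add: diff_add)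

lemma pos_part_closed: "a \<in> pos_part X \<Longrightarrow> a \<in> carrier X"
  by (simp add: pos_part_def)

lemma pos_part_submodule: "submodule (pos_part X) R X"
proof (rule submoduleI_smult)
  show "\<zero>\<^bsub>X\<^esub> \<in> pos_part X" using hcomp_of_homog[of "\<zero>\<^bsub>X\<^esub>" 0] by (simp add: pos_part_def)
qed (auto simp: pos_part_def hcomp_add hcomp_smult)

lemma homog_pos_part: "\<lbrakk>a \<in> homog X i; 0 < i\<rbrakk> \<Longrightarrow> a \<in> pos_part X"
  using hcomp_of_homog[of a i] homog_closed by (auto simp: pos_part_def)

lemma pos_part_induct [consumes 1, case_names zero homog add]:
  assumes x: "x \<in> pos_part X" and "P \<zero>\<^bsub>X\<^esub>" "\<And>i x. \<lbrakk>0 < i; x \<in> homog X i\<rbrakk> \<Longrightarrow> P x"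
    and "\<And>x y. \<lbrakk>x \<in> pos_part X; y \<in> pos_part X; P x; P y\<rbrakk> \<Longrightarrow> P (x \<oplus>\<^bsub>X\<^esub> y)"
  shows "P x"
proof -
  have pos: "0 < i" if "hcomp X x i \<noteq> \<zero>\<^bsub>X\<^esub>" for i
    using x that by (cases "i \<le> 0") (auto simp: pos_part_def)
  have xc: "x \<in> carrier X" using x by (rule pos_part_closed)
  \<comment> \<open>Membership in \<open>pos_part X\<close> is carried along, since the rule for
    sums assumes it.\<close>
  let ?Q = "\<lambda>y. y \<in> pos_part X \<and> P y"
  have "?Q (finsum X (hcomp X x) {i. hcomp X x i \<noteq> \<zero>\<^bsub>X\<^esub>})"
  proof (rule M.finsum_induct)
    fix i assume "i \<in> {i. hcomp X x i \<noteq> \<zero>\<^bsub>X\<^esub>}"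
    then show "?Q (hcomp X x i)"
      using pos assms(3) homog_pos_part hcomp_homog[OF xc] by blast
  qed (use xc assms(2,4) submodule_zero[OF pos_part_submodule] submoduleE(5)[OF pos_part_submodule]
      in auto)
  then show ?thesis using hcomp_finsum[OF xc] by simp
qed

end

section \<open>The symmetric algebra\<close>

context rcomplex
begin

abbreviation "freeA \<equiv> free_alg R (pos_part X)"
abbreviation "tensN \<equiv> lin_span R freeA (multilin_rel R X)"
abbreviation "symJ \<equiv> Idl\<^bsub>tensor_alg R X\<^esub> (sym_rel R X)"
abbreviation "gen a \<equiv> symJ +>\<^bsub>tensor_alg R X\<^esub> tensor_gen R X a"

lemma freeA_ralgebra: "ralgebra R freeA"
  by (rule R.free_alg_ralgebra)

lemma word_append: "word R u \<otimes>\<^bsub>free_alg R P\<^esub> word R v = word R (u @ v)"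
  by (simp add: R.conv_word fun_eq_iff)

lemma multilin_rel_carrier: "multilin_rel R X \<subseteq> carrier freeA"
proof -
  interpret F: ralgebra R freeA by (rule freeA_ralgebra)
  note pp = submoduleE(4,5)[OF pos_part_submodule]
  have "word R (u @ a # v) \<in> carrier freeA"
    if "u \<in> lists (pos_part X)" "v \<in> lists (pos_part X)" "a \<in> pos_part X" for u v a
    by (rule R.word_mem) (use that in auto)
  note pp = this pp
  show ?thesis
    unfolding multilin_rel_def Let_def
    by (intro subsetI; elim UnE CollectE exE conjE; hypsubst; intro F.M.minus_closed F.M.a_closed F.smult_closed pp; assumption)
qed

text \<open>Multiplying a multilinearity relation by a word on either side only lengthens the
  surrounding word \<open>u\<close> or \<open>v\<close>, so it yields another relation. Bilinearity
  extends this from relations to their span and from words to all of the free algebra.\<close>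

lemma tensN_ideal: "ideal tensN freeA"
proof -
  interpret F: ralgebra R freeA by (rule freeA_ralgebra)
  note pp = submoduleE(4,5)[OF pos_part_submodule]
  note sub = F.lin_span_submodule[OF multilin_rel_carrier]
  note N_carrier = F.lin_span_carrier[OF multilin_rel_carrier]
  have wm: "word R (u @ a # v) \<in> carrier freeA"
    if "u \<in> lists (pos_part X)" "v \<in> lists (pos_part X)" "a \<in> pos_part X" for u v a
    by (rule R.word_mem) (use that in auto)
  have wl: "word R w \<otimes>\<^bsub>freeA\<^esub> x \<in> tensN" and wr: "x \<otimes>\<^bsub>freeA\<^esub> word R w \<in> tensN"
    if w: "w \<in> lists (pos_part X)" and x: "x \<in> multilin_rel R X" for w x
  proof -
    note wF = R.word_mem[OF w]
    have ap: "w @ u \<in> lists (pos_part X)" "u @ w \<in> lists (pos_part X)" if "u \<in> lists (pos_part X)" for u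
      using that w by auto
    have wapp: "word R w \<otimes>\<^bsub>freeA\<^esub> word R (u @ a # v) = word R ((w @ u) @ a # v)"
      "word R (u @ a # v) \<otimes>\<^bsub>freeA\<^esub> word R w = word R (u @ a # (v @ w))" for u a v
      by (simp_all only: word_append append_assoc append_Cons)
    consider (add) u v a b where "u \<in> lists (pos_part X)" "v \<in> lists (pos_part X)"
        "a \<in> pos_part X" "b \<in> pos_part X"
        "x = word R (u @ (a \<oplus>\<^bsub>X\<^esub> b) # v)
          \<ominus>\<^bsub>freeA\<^esub> (word R (u @ a # v) \<oplus>\<^bsub>freeA\<^esub> word R (u @ b # v))"
      | (smult) u v r a where "u \<in> lists (pos_part X)" "v \<in> lists (pos_part X)"
        "r \<in> carrier R" "a \<in> pos_part X"
        "x = word R (u @ (r \<odot>\<^bsub>X\<^esub> a) # v) \<ominus>\<^bsub>freeA\<^esub> (r \<odot>\<^bsub>freeA\<^esub> word R (u @ a # v))"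
      using x unfolding multilin_rel_def Let_def by blast
    then have "word R w \<otimes>\<^bsub>freeA\<^esub> x \<in> multilin_rel R X \<and> x \<otimes>\<^bsub>freeA\<^esub> word R w \<in> multilin_rel R X"
    proof cases
      case add
      note m = wm[OF add(1,2,3)] wm[OF add(1,2,4)] wm[OF add(1,2) pp(2)[OF add(3,4)]]
      have "word R w \<otimes>\<^bsub>freeA\<^esub> x = word R ((w @ u) @ (a \<oplus>\<^bsub>X\<^esub> b) # v)
          \<ominus>\<^bsub>freeA\<^esub> (word R ((w @ u) @ a # v) \<oplus>\<^bsub>freeA\<^esub> word R ((w @ u) @ b # v))"
        using m wF unfolding add(5) wapp(1)[symmetric]
        by (simp del: free_alg_sel add: a_minus_def F.X.r_distr F.X.r_minus)
      moreover have "x \<otimes>\<^bsub>freeA\<^esub> word R w = word R (u @ (a \<oplus>\<^bsub>X\<^esub> b) # (v @ w))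
          \<ominus>\<^bsub>freeA\<^esub> (word R (u @ a # (v @ w)) \<oplus>\<^bsub>freeA\<^esub> word R (u @ b # (v @ w)))"
        using m wF unfolding add(5) wapp(2)[symmetric]
        by (simp del: free_alg_sel add: a_minus_def F.X.l_distr F.X.l_minus)
      ultimately show ?thesis
        using add(1-4) ap unfolding multilin_rel_def Let_def by blast
    next
      case smult
      note m = wm[OF smult(1,2,4)] wm[OF smult(1,2) pp(1)[OF smult(3,4)]]
      have "word R w \<otimes>\<^bsub>freeA\<^esub> x = word R ((w @ u) @ (r \<odot>\<^bsub>X\<^esub> a) # v)
          \<ominus>\<^bsub>freeA\<^esub> (r \<odot>\<^bsub>freeA\<^esub> word R ((w @ u) @ a # v))"
        using m wF smult(3) unfolding smult(5) wapp(1)[symmetric]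
        by (simp del: free_alg_sel add: a_minus_def F.X.r_distr F.X.r_minus F.smult_mult_right)
      moreover have "x \<otimes>\<^bsub>freeA\<^esub> word R w = word R (u @ (r \<odot>\<^bsub>X\<^esub> a) # (v @ w))
          \<ominus>\<^bsub>freeA\<^esub> (r \<odot>\<^bsub>freeA\<^esub> word R (u @ a # (v @ w)))"
        using m wF smult(3) unfolding smult(5) wapp(2)[symmetric]
        by (simp del: free_alg_sel add: a_minus_def F.X.l_distr F.X.l_minus F.smult_mult_left)
      ultimately show ?thesis
        using smult(1-4) ap unfolding multilin_rel_def Let_def by blast
    qed
    then show "word R w \<otimes>\<^bsub>freeA\<^esub> x \<in> tensN" "x \<otimes>\<^bsub>freeA\<^esub> word R w \<in> tensN"
      using F.lin_span_incl by blast+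
  qed
  have wN: "word R w \<otimes>\<^bsub>freeA\<^esub> x \<in> tensN \<and> x \<otimes>\<^bsub>freeA\<^esub> word R w \<in> tensN"
    if w: "w \<in> lists (pos_part X)" and x: "x \<in> tensN" for w x
    using x multilin_rel_carrier
  proof (induction x rule: F.lin_span_induct)
    case zero
    then show ?case
      using F.X.r_null[OF R.word_mem[OF w]] F.X.l_null[OF R.word_mem[OF w]] F.submodule_zero[OF sub]
      by (simp del: free_alg_sel)
  next
    case (add x y)
    then show ?case using R.word_mem[OF w] submodule.axioms F.submoduleE(5)[OF sub]
      by (simp del: free_alg_sel add: F.X.l_distr F.X.r_distr)
  next
    case (smult r x)
    then show ?case using R.word_mem[OF w] F.submoduleE(4)[OF sub]
      by (simp del: free_alg_sel add: F.smult_mult_left F.smult_mult_right)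
  qed (use wl wr w in blast)
  have fN: "f \<otimes>\<^bsub>freeA\<^esub> x \<in> tensN \<and> x \<otimes>\<^bsub>freeA\<^esub> f \<in> tensN"
    if f: "f \<in> carrier freeA" and x: "x \<in> tensN" for f x
    using f
  proof (induction f rule: R.free_alg_induct)
    case zero
    have "x \<in> carrier freeA" using x N_carrier by blast
    then have "\<zero>\<^bsub>freeA\<^esub> \<otimes>\<^bsub>freeA\<^esub> x \<in> tensN \<and> x \<otimes>\<^bsub>freeA\<^esub> \<zero>\<^bsub>freeA\<^esub> \<in> tensN"
      using F.submodule_zero[OF sub] by (simp del: free_alg_sel)
    then show ?case by simp
  next
    case (add f g)
    have "x \<in> carrier freeA" using x N_carrier by blast
    then have "(f \<oplus>\<^bsub>freeA\<^esub> g) \<otimes>\<^bsub>freeA\<^esub> x \<in> tensN \<and> x \<otimes>\<^bsub>freeA\<^esub> (f \<oplus>\<^bsub>freeA\<^esub> g) \<in> tensN"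
      using add F.submoduleE(5)[OF sub] by (simp del: free_alg_sel add: F.X.l_distr F.X.r_distr)
    then show ?case by simp
  next
    case (word r u)
    have "x \<in> carrier freeA" using x N_carrier by blast
    then have "(r \<odot>\<^bsub>freeA\<^esub> word R u) \<otimes>\<^bsub>freeA\<^esub> x \<in> tensN \<and> x \<otimes>\<^bsub>freeA\<^esub> (r \<odot>\<^bsub>freeA\<^esub> word R u) \<in> tensN"
      using word wN[OF word(2) x] R.word_mem[OF word(2)] F.submoduleE(4)[OF sub]
      by (simp del: free_alg_sel add: F.smult_mult_left F.smult_mult_right)
    then show ?case by simp
  qed
  show ?thesis
    by (rule idealI[OF F.X.ring_axioms])
      (use sub fN in \<open>simp_all add: submodule_def\<close>)
qed

end

lemma ring_hom_ksign:
  assumes "ring X" "ring Y" "f \<in> ring_hom X Y" "x \<in> carrier X"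
  shows "f (ksign X k x) = ksign Y k (f x)"
proof -
  interpret f: ring_hom_ring X Y f by (rule ring_hom_ringI2) (use assms in auto)
  show ?thesis using assms(4) by (simp add: ksign_def)
qed

section \<open>Generators, relations and the universal property of the symmetric algebra\<close>

context rcomplex
begin

abbreviation "tensA \<equiv> tensor_alg R X"
abbreviation "symA \<equiv> sym_alg R X"

lemma tensor_alg_eq: "tensA = quot_mod freeA tensN"
  by (simp add: tensor_alg_def Let_def)

lemma tensor_gen_eq: "tensor_gen R X a = tensN +>\<^bsub>freeA\<^esub> word R [a]"
  by (simp add: tensor_gen_def Let_def)

lemma tensA_ralgebra: "ralgebra R tensA"
  unfolding tensor_alg_eq by (rule ralgebra.quot_mod_ralgebra[OF freeA_ralgebra tensN_ideal])

lemma tens_coset_hom: "(\<lambda>f. tensN +>\<^bsub>freeA\<^esub> f) \<in> ring_hom freeA tensA"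
  unfolding tensor_alg_eq by (rule ralgebra.coset_ring_hom[OF freeA_ralgebra tensN_ideal])

lemma tens_quot: "module_quot R freeA tensN"
  by (rule ralgebra.ideal_module_quot[OF freeA_ralgebra tensN_ideal])

lemma tensor_gen_closed: "a \<in> pos_part X \<Longrightarrow> tensor_gen R X a \<in> carrier tensA"
  unfolding tensor_gen_eq by (rule ring_hom_closed[OF tens_coset_hom R.word_mem]) simp

lemma sym_rel_carrier: "sym_rel R X \<subseteq> carrier tensA"
proof -
  interpret T: ralgebra R tensA by (rule tensA_ralgebra)
  have g: "tensor_gen R X a \<in> carrier tensA" if "0 < i" "a \<in> homog X i" for i a
    using that homog_pos_part tensor_gen_closed by blast
  have k: "ksign tensA n x \<in> carrier tensA" if "x \<in> carrier tensA" for n x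
    using that by (simp add: ksign_def)
  show ?thesis
    unfolding sym_rel_def Let_def using g k by auto
qed

lemma symJ_ideal: "ideal symJ tensA"
  by (rule ring.genideal_ideal[OF ralgebra.axioms(2)[OF tensA_ralgebra] sym_rel_carrier])

lemma sym_alg_eq: "symA = quot_mod tensA symJ"
  by (simp add: sym_alg_def)

lemma symA_ralgebra: "ralgebra R symA"
  unfolding sym_alg_eq by (rule ralgebra.quot_mod_ralgebra[OF tensA_ralgebra symJ_ideal])

lemma sym_coset_hom: "(\<lambda>t. symJ +>\<^bsub>tensA\<^esub> t) \<in> ring_hom tensA symA"
  unfolding sym_alg_eq by (rule ralgebra.coset_ring_hom[OF tensA_ralgebra symJ_ideal])

lemma sym_quot: "module_quot R tensA symJ"
  by (rule ralgebra.ideal_module_quot[OF tensA_ralgebra symJ_ideal])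

abbreviation "sym_class f \<equiv> symJ +>\<^bsub>tensA\<^esub> (tensN +>\<^bsub>freeA\<^esub> f)"

lemma sym_class_hom: "(\<lambda>f. sym_class f) \<in> ring_hom freeA symA"
  using ring_hom_trans[OF tens_coset_hom sym_coset_hom] by (simp add: comp_def)

lemma sym_class_smult:
  assumes "r \<in> carrier R" "f \<in> carrier freeA"
  shows "sym_class (r \<odot>\<^bsub>freeA\<^esub> f) = r \<odot>\<^bsub>symA\<^esub> sym_class f"
proof -
  have f: "tensN +>\<^bsub>freeA\<^esub> f \<in> carrier tensA" by (rule ring_hom_closed[OF tens_coset_hom assms(2)])
  have "tensN +>\<^bsub>freeA\<^esub> (r \<odot>\<^bsub>freeA\<^esub> f) = r \<odot>\<^bsub>tensA\<^esub> (tensN +>\<^bsub>freeA\<^esub> f)"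
    unfolding tensor_alg_eq using module_quot.quot_smult[OF tens_quot assms] by simp
  then show ?thesis
    using module_quot.quot_smult[OF sym_quot assms(1) f] by (simp add: sym_alg_eq)
qed

lemma sym_class_surj: "carrier symA = (\<lambda>f. sym_class f) ` carrier freeA"
  unfolding sym_alg_eq module_quot.quot_mod_sel(1)[OF sym_quot]
  unfolding tensor_alg_eq module_quot.quot_mod_sel(1)[OF tens_quot] by (rule image_image)

lemma gen_eq: "gen a = sym_class (word R [a])"
  by (simp add: tensor_gen_eq)

lemma gen_closed [simp]: "a \<in> pos_part X \<Longrightarrow> gen a \<in> carrier symA"
  unfolding gen_eq by (rule ring_hom_closed[OF sym_class_hom R.word_mem]) simp

lemma sym_class_word: "u \<in> lists (pos_part X) \<Longrightarrow> sym_class (word R u) = wprod symA (\<lambda>a. gen a) u"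
proof (induction u)
  case Nil
  then show ?case using ring_hom_one[OF sym_class_hom] by simp
next
  case (Cons a u)
  have a: "[a] \<in> lists (pos_part X)" using Cons.prems by simp
  have u: "u \<in> lists (pos_part X)" using Cons.prems by simp
  have "sym_class (word R (a # u)) = sym_class (word R [a] \<otimes>\<^bsub>freeA\<^esub> word R u)"
    by (simp only: word_append append_Cons append_Nil)
  also have "\<dots> = gen a \<otimes>\<^bsub>symA\<^esub> sym_class (word R u)"
    using ring_hom_mult[OF sym_class_hom R.word_mem[OF a] R.word_mem[OF u]] by (simp only: gen_eq)
  finally show ?case using Cons.IH[OF u] by simp
qed

lemma multilin_zero:
  assumes "x \<in> multilin_rel R X"
  shows "sym_class x = \<zero>\<^bsub>symA\<^esub>"
proof -
  interpret F: ralgebra R freeA by (rule freeA_ralgebra)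
  have "x \<in> tensN" using assms F.lin_span_incl by blast
  then have "tensN +>\<^bsub>freeA\<^esub> x = \<zero>\<^bsub>tensA\<^esub>"
    unfolding tensor_alg_eq
    using module_quot.coset_eq_zero_iff[OF tens_quot] multilin_rel_carrier assms
    by (auto simp del: free_alg_sel simp: module_quot.quot_mod_sel(2)[OF tens_quot])
  moreover have "symJ +>\<^bsub>tensA\<^esub> \<zero>\<^bsub>tensA\<^esub> = \<zero>\<^bsub>symA\<^esub>"
    by (rule ring_hom_zero[OF sym_coset_hom])
      (use tensA_ralgebra symA_ralgebra in \<open>auto dest: ralgebra.axioms\<close>)
  ultimately show ?thesis by simp
qed

lemma gen_add:
  assumes "a \<in> pos_part X" "b \<in> pos_part X"
  shows "gen (a \<oplus>\<^bsub>X\<^esub> b) = gen a \<oplus>\<^bsub>symA\<^esub> gen b"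
proof -
  interpret F: ralgebra R freeA by (rule freeA_ralgebra)
  interpret S: ralgebra R symA by (rule symA_ralgebra)
  interpret g: ring_hom_ring freeA symA "\<lambda>f. sym_class f"
    by (rule ring_hom_ringI2) (use F.X.ring_axioms S.X.ring_axioms sym_class_hom in auto)
  have w: "word R [c] \<in> carrier freeA" if "c \<in> pos_part X" for c
    by (rule R.word_mem) (use that in simp)
  have ab: "a \<oplus>\<^bsub>X\<^esub> b \<in> pos_part X" using assms by (rule submoduleE(5)[OF pos_part_submodule])
  \<comment> \<open>The relation with both surrounding words empty; they are written out to match
    the shape in \<open>multilin_rel\<close>.\<close>
  have "word R ([] @ (a \<oplus>\<^bsub>X\<^esub> b) # [])
      \<ominus>\<^bsub>freeA\<^esub> (word R ([] @ a # []) \<oplus>\<^bsub>freeA\<^esub> word R ([] @ b # [])) \<in> multilin_rel R X"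
    unfolding multilin_rel_def Let_def using assms by blast
  from multilin_zero[OF this]
  have "gen (a \<oplus>\<^bsub>X\<^esub> b) \<ominus>\<^bsub>symA\<^esub> (gen a \<oplus>\<^bsub>symA\<^esub> gen b) = \<zero>\<^bsub>symA\<^esub>"
    using w[OF assms(1)] w[OF assms(2)] w[OF ab]
    by (simp del: free_alg_sel add: a_minus_def gen_eq)
  then show ?thesis using assms ab by (simp add: S.M.minus_eq_zero_iff)
qed

lemma gen_smult:
  assumes "r \<in> carrier R" "a \<in> pos_part X"
  shows "gen (r \<odot>\<^bsub>X\<^esub> a) = r \<odot>\<^bsub>symA\<^esub> gen a"
proof -
  interpret F: ralgebra R freeA by (rule freeA_ralgebra)
  interpret S: ralgebra R symA by (rule symA_ralgebra)
  interpret g: ring_hom_ring freeA symA "\<lambda>f. sym_class f"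
    by (rule ring_hom_ringI2) (use F.X.ring_axioms S.X.ring_axioms sym_class_hom in auto)
  have w: "word R [c] \<in> carrier freeA" if "c \<in> pos_part X" for c
    by (rule R.word_mem) (use that in simp)
  have ra: "r \<odot>\<^bsub>X\<^esub> a \<in> pos_part X" using assms by (rule submoduleE(4)[OF pos_part_submodule])
  have "word R ([] @ (r \<odot>\<^bsub>X\<^esub> a) # []) \<ominus>\<^bsub>freeA\<^esub> (r \<odot>\<^bsub>freeA\<^esub> word R ([] @ a # [])) \<in> multilin_rel R X"
    unfolding multilin_rel_def Let_def using assms by blast
  from multilin_zero[OF this]
  have "gen (r \<odot>\<^bsub>X\<^esub> a) \<ominus>\<^bsub>symA\<^esub> (r \<odot>\<^bsub>symA\<^esub> gen a) = \<zero>\<^bsub>symA\<^esub>"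
    using w[OF assms(2)] w[OF ra] assms(1) F.smult_closed[OF assms(1) w[OF assms(2)]]
    by (simp del: free_alg_sel add: a_minus_def gen_eq sym_class_smult)
  then show ?thesis using assms ra by (simp add: S.M.minus_eq_zero_iff)
qed

lemma sym_rel_zero:
  assumes "x \<in> sym_rel R X"
  shows "symJ +>\<^bsub>tensA\<^esub> x = \<zero>\<^bsub>symA\<^esub>"
proof -
  have "x \<in> symJ"
    using ring.genideal_self[OF ralgebra.axioms(2)[OF tensA_ralgebra] sym_rel_carrier] assms by blast
  then show ?thesis
    using module_quot.coset_eq_zero_iff[OF sym_quot] sym_rel_carrier assms
    by (auto simp: sym_alg_eq module_quot.quot_mod_sel(2)[OF sym_quot])
qed

lemma gen_comm:
  assumes "0 < i" "0 < j" "a \<in> homog X i" "b \<in> homog X j"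
  shows "gen a \<otimes>\<^bsub>symA\<^esub> gen b = ksign symA (i * j) (gen b \<otimes>\<^bsub>symA\<^esub> gen a)"
proof -
  interpret T: ralgebra R tensA by (rule tensA_ralgebra)
  interpret S: ralgebra R symA by (rule symA_ralgebra)
  interpret g: ring_hom_ring tensA symA "\<lambda>t. symJ +>\<^bsub>tensA\<^esub> t"
    by (rule ring_hom_ringI2) (use T.X.ring_axioms S.X.ring_axioms sym_coset_hom in auto)
  let ?g = "tensor_gen R X"
  have p: "a \<in> pos_part X" "b \<in> pos_part X" using assms homog_pos_part by auto
  note g = tensor_gen_closed[OF p(1)] tensor_gen_closed[OF p(2)]
  have k: "ksign tensA n x \<in> carrier tensA" if "x \<in> carrier tensA" for n x
    using that by (simp add: ksign_def)
  have k': "ksign symA n x \<in> carrier symA" if "x \<in> carrier symA" for n x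
    using that by (simp add: ksign_def)
  have "ksign tensA (i * j) (?g b \<otimes>\<^bsub>tensA\<^esub> ?g a) \<ominus>\<^bsub>tensA\<^esub> ?g a \<otimes>\<^bsub>tensA\<^esub> ?g b \<in> sym_rel R X"
    unfolding sym_rel_def Let_def using assms by blast
  from sym_rel_zero[OF this]
  have "ksign symA (i * j) (gen b \<otimes>\<^bsub>symA\<^esub> gen a) \<ominus>\<^bsub>symA\<^esub> gen a \<otimes>\<^bsub>symA\<^esub> gen b = \<zero>\<^bsub>symA\<^esub>"
    using g k by (simp add: a_minus_def ring_hom_ksign[OF T.X.ring_axioms S.X.ring_axioms sym_coset_hom])
  then show ?thesis using p k' by (simp add: S.M.minus_eq_zero_iff)
qed

lemma gen_odd_square:
  assumes "0 < i" "odd i" "a \<in> homog X i"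
  shows "gen a \<otimes>\<^bsub>symA\<^esub> gen a = \<zero>\<^bsub>symA\<^esub>"
proof -
  have a: "a \<in> pos_part X" using assms homog_pos_part by auto
  have "tensor_gen R X a \<otimes>\<^bsub>tensA\<^esub> tensor_gen R X a \<in> sym_rel R X"
    unfolding sym_rel_def Let_def using assms by blast
  from sym_rel_zero[OF this] show ?thesis
    using ring_hom_mult[OF sym_coset_hom tensor_gen_closed[OF a] tensor_gen_closed[OF a]] by simp
qed

text \<open>Products of generators span \<open>S\<close>, and an element of
  \<open>pos_part X\<close> is a sum of homogeneous ones. Multiplying by one homogeneous generator
  on the left therefore reaches everything; the rule carries almost all later arguments about
  \<open>S\<close>.\<close>

lemma sym_alg_induct [consumes 1, case_names one add smult gen]:
  assumes x: "x \<in> carrier symA"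
    and one: "P \<one>\<^bsub>symA\<^esub>"
    and add: "\<And>x y. \<lbrakk>x \<in> carrier symA; y \<in> carrier symA; P x; P y\<rbrakk> \<Longrightarrow> P (x \<oplus>\<^bsub>symA\<^esub> y)"
    and smult: "\<And>r x. \<lbrakk>r \<in> carrier R; x \<in> carrier symA; P x\<rbrakk> \<Longrightarrow> P (r \<odot>\<^bsub>symA\<^esub> x)"
    and gen: "\<And>i a x. \<lbrakk>0 < i; a \<in> homog X i; x \<in> carrier symA; P x\<rbrakk> \<Longrightarrow> P (gen a \<otimes>\<^bsub>symA\<^esub> x)"
  shows "P x"
proof -
  interpret S: ralgebra R symA by (rule symA_ralgebra)
  have zero: "P \<zero>\<^bsub>symA\<^esub>" using smult[of "\<zero>\<^bsub>R\<^esub>" "\<one>\<^bsub>symA\<^esub>"] one by simp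
  have gP: "P (gen a \<otimes>\<^bsub>symA\<^esub> x)" if "a \<in> pos_part X" "x \<in> carrier symA" "P x" for a x
    using that(1)
  proof (induction a rule: pos_part_induct)
    case zero
    have z: "\<zero>\<^bsub>X\<^esub> \<in> pos_part X" by (rule submodule_zero[OF pos_part_submodule])
    have "gen \<zero>\<^bsub>X\<^esub> = \<zero>\<^bsub>R\<^esub> \<odot>\<^bsub>symA\<^esub> gen \<zero>\<^bsub>X\<^esub>"
      using gen_smult[of "\<zero>\<^bsub>R\<^esub>" "\<zero>\<^bsub>X\<^esub>"] z by simp
    then have "gen \<zero>\<^bsub>X\<^esub> = \<zero>\<^bsub>symA\<^esub>" using z by simp
    then show ?case using that \<open>P \<zero>\<^bsub>symA\<^esub>\<close> by simp
  next
    case (add a b)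
    then show ?case using that assms(3) by (simp add: gen_add S.X.l_distr)
  qed (use gen that in blast)
  have wP: "wprod symA (\<lambda>a. gen a) u \<in> carrier symA \<and> P (wprod symA (\<lambda>a. gen a) u)"
    if "u \<in> lists (pos_part X)" for u
    using that by (induction u) (auto simp: one gP)
  from x obtain f where f: "f \<in> carrier freeA" "x = sym_class f" using sym_class_surj by auto
  from f(1) have "P (sym_class f)"
  proof (induction f rule: R.free_alg_induct)
    case zero
    have "sym_class \<zero>\<^bsub>freeA\<^esub> = \<zero>\<^bsub>symA\<^esub>"
      by (rule ring_hom_zero[OF sym_class_hom])
        (use freeA_ralgebra symA_ralgebra in \<open>auto dest: ralgebra.axioms\<close>)
    then show ?case using \<open>P \<zero>\<^bsub>symA\<^esub>\<close> by simp
  next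
    case (add f g)
    have "P (sym_class (f \<oplus>\<^bsub>freeA\<^esub> g))"
      unfolding ring_hom_add[OF sym_class_hom add(1,2)]
      by (rule assms(3)) (use add ring_hom_closed[OF sym_class_hom] in blast)+
    then show ?case by simp
  next
    case (word r u)
    have "P (sym_class (r \<odot>\<^bsub>freeA\<^esub> word R u))"
      unfolding sym_class_smult[OF word(1) R.word_mem[OF word(2)]] sym_class_word[OF word(2)]
      using wP[OF word(2)] word(1) smult by blast
    then show ?case by simp
  qed
  then show ?thesis using f by simp
qed

text \<open>Each hypothesis on \<open>h\<close> kills one family of relations: \<open>h_add\<close>
  and \<open>h_smult\<close> the multilinearity relations among words, \<open>h_comm\<close> and
  \<open>h_square\<close> the relations of the symmetric algebra. The map on words thus descends
  through both quotients.\<close>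

theorem sym_alg_lift:
  assumes "ring B" and c: "c \<in> ring_hom R B"
    and central: "\<And>r b. \<lbrakk>r \<in> carrier R; b \<in> carrier B\<rbrakk> \<Longrightarrow> c r \<otimes>\<^bsub>B\<^esub> b = b \<otimes>\<^bsub>B\<^esub> c r"
    and h: "\<And>a. a \<in> pos_part X \<Longrightarrow> h a \<in> carrier B"
    and h_add: "\<And>a b. \<lbrakk>a \<in> pos_part X; b \<in> pos_part X\<rbrakk> \<Longrightarrow> h (a \<oplus>\<^bsub>X\<^esub> b) = h a \<oplus>\<^bsub>B\<^esub> h b"
    and h_smult: "\<And>r a. \<lbrakk>r \<in> carrier R; a \<in> pos_part X\<rbrakk> \<Longrightarrow> h (r \<odot>\<^bsub>X\<^esub> a) = c r \<otimes>\<^bsub>B\<^esub> h a"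
    and h_comm: "\<And>i j a b. \<lbrakk>0 < i; 0 < j; a \<in> homog X i; b \<in> homog X j\<rbrakk>
      \<Longrightarrow> h a \<otimes>\<^bsub>B\<^esub> h b = ksign B (i * j) (h b \<otimes>\<^bsub>B\<^esub> h a)"
    and h_square: "\<And>i a. \<lbrakk>0 < i; odd i; a \<in> homog X i\<rbrakk> \<Longrightarrow> h a \<otimes>\<^bsub>B\<^esub> h a = \<zero>\<^bsub>B\<^esub>"
  obtains \<Phi> where "\<Phi> \<in> ring_hom symA B"
    and "\<And>r x. \<lbrakk>r \<in> carrier R; x \<in> carrier symA\<rbrakk> \<Longrightarrow> \<Phi> (r \<odot>\<^bsub>symA\<^esub> x) = c r \<otimes>\<^bsub>B\<^esub> \<Phi> x"
    and "\<And>a. a \<in> pos_part X \<Longrightarrow> \<Phi> (gen a) = h a"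
proof -
  interpret F: ralgebra R freeA by (rule freeA_ralgebra)
  interpret T: ralgebra R tensA by (rule tensA_ralgebra)
  interpret S: ralgebra R symA by (rule symA_ralgebra)
  interpret B: ring B by fact
  have hP: "h \<in> pos_part X \<rightarrow> carrier B" using h by auto
  obtain E where E: "E \<in> ring_hom freeA B"
    and E_smult: "\<And>r f. \<lbrakk>r \<in> carrier R; f \<in> carrier freeA\<rbrakk> \<Longrightarrow> E (r \<odot>\<^bsub>freeA\<^esub> f) = c r \<otimes>\<^bsub>B\<^esub> E f"
    and E_word: "\<And>u. u \<in> lists (pos_part X) \<Longrightarrow> E (word R u) = wprod B h u"
    by (rule R.free_alg_lift[OF assms(1) c central hP]) auto
  interpret E: ring_hom_ring freeA B E
    by (rule ring_hom_ringI2) (use F.X.ring_axioms B.ring_axioms E in auto)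
  have c_closed: "c r \<in> carrier B" if "r \<in> carrier R" for r using ring_hom_closed[OF c that] .
  note pp = submoduleE(4,5)[OF pos_part_submodule]
  have wm: "word R (u @ a # v) \<in> carrier freeA" and Ew: "E (word R (u @ a # v)) = wprod B h u \<otimes>\<^bsub>B\<^esub> (h a \<otimes>\<^bsub>B\<^esub> wprod B h v)"
    if "u \<in> lists (pos_part X)" "v \<in> lists (pos_part X)" "a \<in> pos_part X" for u v a
  proof -
    have av: "a # v \<in> lists (pos_part X)" "u @ a # v \<in> lists (pos_part X)" using that by auto
    show "word R (u @ a # v) \<in> carrier freeA" by (rule R.word_mem[OF av(2)])
    show "E (word R (u @ a # v)) = wprod B h u \<otimes>\<^bsub>B\<^esub> (h a \<otimes>\<^bsub>B\<^esub> wprod B h v)"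
      using E_word[OF av(2)] B.wprod_append[OF hP that(1) av(1)] by simp
  qed
  have rel0: "E x = \<zero>\<^bsub>B\<^esub>" if x: "x \<in> multilin_rel R X" for x
  proof -
    consider (add) u v a b where "u \<in> lists (pos_part X)" "v \<in> lists (pos_part X)"
        "a \<in> pos_part X" "b \<in> pos_part X"
        "x = word R (u @ (a \<oplus>\<^bsub>X\<^esub> b) # v)
          \<ominus>\<^bsub>freeA\<^esub> (word R (u @ a # v) \<oplus>\<^bsub>freeA\<^esub> word R (u @ b # v))"
      | (smult) u v r a where "u \<in> lists (pos_part X)" "v \<in> lists (pos_part X)"
        "r \<in> carrier R" "a \<in> pos_part X"
        "x = word R (u @ (r \<odot>\<^bsub>X\<^esub> a) # v) \<ominus>\<^bsub>freeA\<^esub> (r \<odot>\<^bsub>freeA\<^esub> word R (u @ a # v))"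
      using x unfolding multilin_rel_def Let_def by blast
    then show ?thesis
    proof cases
      case add
      have wp: "wprod B h u \<in> carrier B" "wprod B h v \<in> carrier B"
        using B.wprod_closed[OF hP add(1)] B.wprod_closed[OF hP add(2)] .
      note m = wm[OF add(1,2,3)] wm[OF add(1,2,4)] wm[OF add(1,2) pp(2)[OF add(3,4)]]
      have "E x = E (word R (u @ (a \<oplus>\<^bsub>X\<^esub> b) # v))
          \<ominus>\<^bsub>B\<^esub> (E (word R (u @ a # v)) \<oplus>\<^bsub>B\<^esub> E (word R (u @ b # v)))"
        unfolding add(5) using m by (simp del: free_alg_sel add: a_minus_def)
      also have "\<dots> = \<zero>\<^bsub>B\<^esub>"
        using add(3,4) wp h[OF add(3)] h[OF add(4)] h[OF pp(2)[OF add(3,4)]]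
        unfolding Ew[OF add(1,2,3)] Ew[OF add(1,2,4)] Ew[OF add(1,2) pp(2)[OF add(3,4)]]
        by (simp add: h_add B.l_distr B.r_distr B.minus_eq_zero_iff)
      finally show ?thesis .
    next
      case smult
      have wp: "wprod B h u \<in> carrier B" "wprod B h v \<in> carrier B"
        using B.wprod_closed[OF hP smult(1)] B.wprod_closed[OF hP smult(2)] .
      note m = wm[OF smult(1,2,4)] wm[OF smult(1,2) pp(1)[OF smult(3,4)]]
      have "E x = E (word R (u @ (r \<odot>\<^bsub>X\<^esub> a) # v)) \<ominus>\<^bsub>B\<^esub> (c r \<otimes>\<^bsub>B\<^esub> E (word R (u @ a # v)))"
        unfolding smult(5) using m smult(3) F.smult_closed[OF smult(3) m(1)]
        by (simp del: free_alg_sel add: a_minus_def E_smult)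
      also have "wprod B h u \<otimes>\<^bsub>B\<^esub> (c r \<otimes>\<^bsub>B\<^esub> (h a \<otimes>\<^bsub>B\<^esub> wprod B h v))
          = c r \<otimes>\<^bsub>B\<^esub> (wprod B h u \<otimes>\<^bsub>B\<^esub> (h a \<otimes>\<^bsub>B\<^esub> wprod B h v))"
        using wp h[OF smult(4)] c_closed[OF smult(3)] central[OF smult(3) wp(1)]
        by (simp flip: B.m_assoc)
      then have "E (word R (u @ (r \<odot>\<^bsub>X\<^esub> a) # v)) \<ominus>\<^bsub>B\<^esub> (c r \<otimes>\<^bsub>B\<^esub> E (word R (u @ a # v))) = \<zero>\<^bsub>B\<^esub>"
        using smult(3,4) wp h[OF smult(4)] h[OF pp(1)[OF smult(3,4)]] c_closed[OF smult(3)]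
        unfolding Ew[OF smult(1,2,4)] Ew[OF smult(1,2) pp(1)[OF smult(3,4)]]
        by (simp add: h_smult B.minus_eq_zero_iff B.m_assoc)
      finally show ?thesis .
    qed
  qed
  have N0: "E x = \<zero>\<^bsub>B\<^esub>" if "x \<in> tensN" for x
    using that multilin_rel_carrier
  proof (induction x rule: F.lin_span_induct)
    case (smult r x)
    then show ?case using c_closed by (simp del: free_alg_sel add: E_smult)
  qed (simp_all del: free_alg_sel add: rel0)
  obtain E1 where E1: "E1 \<in> ring_hom tensA B"
    and E1E: "\<And>f. f \<in> carrier freeA \<Longrightarrow> E1 (tensN +>\<^bsub>freeA\<^esub> f) = E f"
    unfolding tensor_alg_eq
    by (rule F.quot_mod_lift[OF tensN_ideal assms(1) E N0]) auto
  interpret E1: ring_hom_ring tensA B E1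
    by (rule ring_hom_ringI2) (use T.X.ring_axioms B.ring_axioms E1 in auto)
  have E1g: "E1 (tensor_gen R X a) = h a" if "a \<in> pos_part X" for a
  proof -
    have "[a] \<in> lists (pos_part X)" using that by simp
    then show ?thesis unfolding tensor_gen_eq
      using E1E[OF R.word_mem] E_word h[OF that] by fastforce
  qed
  have "sym_rel R X \<subseteq> a_kernel tensA B E1"
  proof
    fix x assume x: "x \<in> sym_rel R X"
    have k: "ksign tensA n x \<in> carrier tensA" if "x \<in> carrier tensA" for n x
      using that by (simp add: ksign_def)
    have kB: "ksign B n x \<in> carrier B" if "x \<in> carrier B" for n x
      using that by (simp add: ksign_def)
    let ?g = "tensor_gen R X"
    consider (comm) i j a b where "0 < i" "0 < j" "a \<in> homog X i" "b \<in> homog X j"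
        "x = ksign tensA (i * j) (?g b \<otimes>\<^bsub>tensA\<^esub> ?g a) \<ominus>\<^bsub>tensA\<^esub> ?g a \<otimes>\<^bsub>tensA\<^esub> ?g b"
      | (square) i a where "0 < i" "odd i" "a \<in> homog X i" "x = ?g a \<otimes>\<^bsub>tensA\<^esub> ?g a"
      using x unfolding sym_rel_def Let_def by blast
    then have "E1 x = \<zero>\<^bsub>B\<^esub>"
    proof cases
      case comm
      have p: "a \<in> pos_part X" "b \<in> pos_part X" using comm homog_pos_part by auto
      note g = tensor_gen_closed[OF p(1)] tensor_gen_closed[OF p(2)]
      have "E1 x = ksign B (i * j) (h b \<otimes>\<^bsub>B\<^esub> h a) \<ominus>\<^bsub>B\<^esub> h a \<otimes>\<^bsub>B\<^esub> h b"
        unfolding comm(5) using g k E1g[OF p(1)] E1g[OF p(2)]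
        by (simp add: a_minus_def ring_hom_ksign[OF T.X.ring_axioms B.ring_axioms E1])
      then show ?thesis using h_comm[OF comm(1-4)] kB h[OF p(1)] h[OF p(2)]
        by (simp add: B.minus_eq_zero_iff)
    next
      case square
      have p: "a \<in> pos_part X" using square homog_pos_part by auto
      show ?thesis unfolding square(4)
        using tensor_gen_closed[OF p] E1g[OF p] h_square[OF square(1-3)] by simp
    qed
    then show "x \<in> a_kernel tensA B E1" using x sym_rel_carrier unfolding a_kernel_eq by blast
  qed
  then have "symJ \<subseteq> a_kernel tensA B E1"
    by (rule T.X.genideal_minimal[OF E1.kernel_is_ideal])
  then have J0: "E1 x = \<zero>\<^bsub>B\<^esub>" if "x \<in> symJ" for x using that unfolding a_kernel_eq by blast
  obtain \<Phi> where \<Phi>: "\<Phi> \<in> ring_hom symA B"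
    and \<Phi>E: "\<And>t. t \<in> carrier tensA \<Longrightarrow> \<Phi> (symJ +>\<^bsub>tensA\<^esub> t) = E1 t"
    unfolding sym_alg_eq
    by (rule T.quot_mod_lift[OF symJ_ideal assms(1) E1 J0]) auto
  have \<Phi>g: "\<Phi> (gen a) = h a" if "a \<in> pos_part X" for a
    using \<Phi>E[OF tensor_gen_closed[OF that]] E1g[OF that] by simp
  have "\<Phi> (r \<odot>\<^bsub>symA\<^esub> x) = c r \<otimes>\<^bsub>B\<^esub> \<Phi> x" if r: "r \<in> carrier R" and x: "x \<in> carrier symA" for r x
  proof -
    from x obtain f where f: "f \<in> carrier freeA" "x = sym_class f" using sym_class_surj by auto
    have t: "tensN +>\<^bsub>freeA\<^esub> f' \<in> carrier tensA" if "f' \<in> carrier freeA" for f'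
      by (rule ring_hom_closed[OF tens_coset_hom that])
    have rf: "r \<odot>\<^bsub>freeA\<^esub> f \<in> carrier freeA" using r f(1) by (rule F.smult_closed)
    show ?thesis
      unfolding f(2) sym_class_smult[OF r f(1), symmetric] \<Phi>E[OF t[OF rf]] \<Phi>E[OF t[OF f(1)]]
        E1E[OF rf] E1E[OF f(1)] by (rule E_smult[OF r f(1)])
  qed
  then show ?thesis using that \<Phi> \<Phi>g by blast
qed

end

text \<open>Oriented so that rewriting moves results about \<open>sym_alg\<close> to
  \<open>sym_dg\<close>, the record that also holds the grading and the differential.\<close>

lemma sym_dg_sel:
  "carrier (sym_alg R A) = carrier (sym_dg R A)"
  "mult (sym_alg R A) = mult (sym_dg R A)"
  "one (sym_alg R A) = one (sym_dg R A)"
  "zero (sym_alg R A) = zero (sym_dg R A)"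
  "add (sym_alg R A) = add (sym_dg R A)"
  "smult (sym_alg R A) = smult (sym_dg R A)"
  by (simp_all add: sym_dg_def module.defs graded_complex.defs)

lemma homog_sym_dg: "homog (sym_dg R A) = sym_homog R A"
  and diff_sym_dg: "diff (sym_dg R A) = (THE d. is_sym_diff R A d)"
  by (simp_all add: sym_dg_def module.defs graded_complex.defs)

lemma sym_dg_derived:
  "a_inv (sym_alg R A) = a_inv (sym_dg R A)"
  "a_minus (sym_alg R A) = a_minus (sym_dg R A)"
  "ksign (sym_alg R A) = ksign (sym_dg R A)"
  "finsum (sym_alg R A) = finsum (sym_dg R A)"
  "lin_span R (sym_alg R A) = lin_span R (sym_dg R A)"
  "ring_hom (sym_alg R A) B = ring_hom (sym_dg R A) B"
proof -
  show inv: "a_inv (sym_alg R A) = a_inv (sym_dg R A)"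
    by (rule a_inv_cong) (simp_all add: sym_dg_sel)
  show "a_minus (sym_alg R A) = a_minus (sym_dg R A)"
    by (intro ext) (simp add: a_minus_def inv sym_dg_sel)
  show "ksign (sym_alg R A) = ksign (sym_dg R A)"
    by (intro ext) (simp add: ksign_def inv)
  show "finsum (sym_alg R A) = finsum (sym_dg R A)"
    by (rule finsum_record_cong) (simp_all add: sym_dg_sel)
  show "lin_span R (sym_alg R A) = lin_span R (sym_dg R A)"
    by (rule ext, rule lin_span_cong) (simp_all add: sym_dg_sel)
  show "ring_hom (sym_alg R A) B = ring_hom (sym_dg R A) B"
    by (simp add: ring_hom_def sym_dg_sel)
qed

lemmas sym_dg_simps = sym_dg_sel sym_dg_derived

section \<open>Trivial extensions and upper triangular matrices\<close>

definition trivial_ext :: "('r, 'p) ring_scheme \<Rightarrow> ('r, 'a, 'm) module_scheme \<Rightarrow> ('r \<times> 'a) ring" where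
  "trivial_ext R M =
     \<lparr>carrier = carrier R \<times> carrier M,
      mult = \<lambda>(r, a) (s, b). (r \<otimes>\<^bsub>R\<^esub> s, r \<odot>\<^bsub>M\<^esub> b \<oplus>\<^bsub>M\<^esub> s \<odot>\<^bsub>M\<^esub> a),
      one = (\<one>\<^bsub>R\<^esub>, \<zero>\<^bsub>M\<^esub>),
      zero = (\<zero>\<^bsub>R\<^esub>, \<zero>\<^bsub>M\<^esub>),
      add = \<lambda>(r, a) (s, b). (r \<oplus>\<^bsub>R\<^esub> s, a \<oplus>\<^bsub>M\<^esub> b)\<rparr>"

lemma (in module) trivial_ext_ring: "ring (trivial_ext R M)"
proof (rule ringI)
  show "abelian_group (trivial_ext R M)"
  proof (rule abelian_groupI)
    fix x assume "x \<in> carrier (trivial_ext R M)"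
    then show "\<exists>y\<in>carrier (trivial_ext R M). y \<oplus>\<^bsub>trivial_ext R M\<^esub> x = \<zero>\<^bsub>trivial_ext R M\<^esub>"
      by (intro bexI[of _ "(\<ominus>\<^bsub>R\<^esub> fst x, \<ominus>\<^bsub>M\<^esub> snd x)"])
        (auto simp: trivial_ext_def R.l_neg M.l_neg)
  qed (auto simp: trivial_ext_def R.a_ac M.a_ac)
  show "Group.monoid (trivial_ext R M)"
    by (rule monoidI)
      (auto simp: trivial_ext_def R.m_ac smult_r_distr M.a_ac simp flip: smult_assoc1)
qed (auto simp: trivial_ext_def R.l_distr R.r_distr smult_r_distr smult_l_distr M.a_ac)

text \<open>The triple (u, v, w) stands for the matrix with rows (u, v) and (0, w).\<close>

definition upper_triangular :: "('a, 'm) ring_scheme \<Rightarrow> ('a \<times> 'a \<times> 'a) ring" where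
  "upper_triangular S =
     \<lparr>carrier = carrier S \<times> carrier S \<times> carrier S,
      mult = \<lambda>(u, v, w) (u', v', w').
        (u \<otimes>\<^bsub>S\<^esub> u', u \<otimes>\<^bsub>S\<^esub> v' \<oplus>\<^bsub>S\<^esub> v \<otimes>\<^bsub>S\<^esub> w', w \<otimes>\<^bsub>S\<^esub> w'),
      one = (\<one>\<^bsub>S\<^esub>, \<zero>\<^bsub>S\<^esub>, \<one>\<^bsub>S\<^esub>),
      zero = (\<zero>\<^bsub>S\<^esub>, \<zero>\<^bsub>S\<^esub>, \<zero>\<^bsub>S\<^esub>),
      add = \<lambda>(u, v, w) (u', v', w'). (u \<oplus>\<^bsub>S\<^esub> u', v \<oplus>\<^bsub>S\<^esub> v', w \<oplus>\<^bsub>S\<^esub> w')\<rparr>"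

lemma (in ring) upper_triangular_ring: "ring (upper_triangular R)"
proof (rule ringI)
  show "abelian_group (upper_triangular R)"
  proof (rule abelian_groupI)
    fix x assume "x \<in> carrier (upper_triangular R)"
    then show "\<exists>y\<in>carrier (upper_triangular R).
        y \<oplus>\<^bsub>upper_triangular R\<^esub> x = \<zero>\<^bsub>upper_triangular R\<^esub>"
      by (intro bexI[of _ "(\<ominus> fst x, \<ominus> fst (snd x), \<ominus> snd (snd x))"])
        (auto simp: upper_triangular_def l_neg)
  qed (auto simp: upper_triangular_def a_ac)
  show "Group.monoid (upper_triangular R)"
    by (rule monoidI) (auto simp: upper_triangular_def m_assoc l_distr r_distr a_ac)
qed (auto simp: upper_triangular_def l_distr r_distr a_ac)

lemma upper_triangular_neg:
  assumes "ring S" "u \<in> carrier S" "v \<in> carrier S" "w \<in> carrier S"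
  shows "\<ominus>\<^bsub>upper_triangular S\<^esub> (u, v, w) = (\<ominus>\<^bsub>S\<^esub> u, \<ominus>\<^bsub>S\<^esub> v, \<ominus>\<^bsub>S\<^esub> w)"
proof -
  interpret S: ring S by fact
  interpret U: ring "upper_triangular S" by (rule S.upper_triangular_ring)
  show ?thesis
    by (rule U.minus_equality) (use assms in \<open>auto simp: upper_triangular_def S.l_neg\<close>)
qed

lemma upper_triangular_ksign:
  assumes "ring S" "u \<in> carrier S" "v \<in> carrier S" "w \<in> carrier S"
  shows "ksign (upper_triangular S) k (u, v, w) = (ksign S k u, ksign S k v, ksign S k w)"
  using upper_triangular_neg[OF assms] by (simp add: ksign_def)

section \<open>Calculus of signs\<close>

context abelian_group
begin

lemma ksign_closed [simp]: "x \<in> carrier G \<Longrightarrow> ksign G i x \<in> carrier G"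
  by (simp add: ksign_def)

lemma ksign_ksign: "x \<in> carrier G \<Longrightarrow> ksign G i (ksign G j x) = ksign G (i + j) x"
  by (simp add: ksign_def minus_minus)

lemma ksign_add: "\<lbrakk>x \<in> carrier G; y \<in> carrier G\<rbrakk> \<Longrightarrow> ksign G i (x \<oplus> y) = ksign G i x \<oplus> ksign G i y"
  by (simp add: ksign_def minus_add)

lemma ksign_zero [simp]: "ksign G i \<zero> = \<zero>"
  by (simp add: ksign_def)

lemma ksign_parity: "even (i - j) \<Longrightarrow> ksign G i x = ksign G j x"
  by (auto simp: ksign_def)

end

context ring
begin

lemma ksign_mult_left: "\<lbrakk>x \<in> carrier R; y \<in> carrier R\<rbrakk> \<Longrightarrow> ksign R i x \<otimes> y = ksign R i (x \<otimes> y)"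
  by (simp add: ksign_def l_minus)

lemma ksign_mult_right: "\<lbrakk>x \<in> carrier R; y \<in> carrier R\<rbrakk> \<Longrightarrow> x \<otimes> ksign R i y = ksign R i (x \<otimes> y)"
  by (simp add: ksign_def r_minus)

end

section \<open>The sign automorphism of a graded module\<close>

text \<open>The sign (-1)^|x| extended additively to inhomogeneous elements. It becomes a diagonal
  entry of the matrix attached to an element of \<open>A\<close>; that matrix has to depend
  additively on the element, whereas \<open>ksign\<close> takes a fixed degree.\<close>

definition gsign :: "('r, 'a, 'm) graded_complex_scheme \<Rightarrow> 'a \<Rightarrow> 'a" where
  "gsign X x = finsum X (\<lambda>i. ksign X i (hcomp X x i)) {i. hcomp X x i \<noteq> \<zero>\<^bsub>X\<^esub>}"

context rcomplex
begin

lemma gsign_superset: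
  assumes "x \<in> carrier X" "finite I" "{i. hcomp X x i \<noteq> \<zero>\<^bsub>X\<^esub>} \<subseteq> I"
  shows "gsign X x = finsum X (\<lambda>i. ksign X i (hcomp X x i)) I"
  unfolding gsign_def
  by (rule M.add.finprod_mono_neutral_cong_left) (use assms in auto)

lemma gsign_closed [simp]: "x \<in> carrier X \<Longrightarrow> gsign X x \<in> carrier X"
  unfolding gsign_def by (rule M.finsum_closed) auto

lemma gsign_add:
  assumes "x \<in> carrier X" "y \<in> carrier X"
  shows "gsign X (x \<oplus>\<^bsub>X\<^esub> y) = gsign X x \<oplus>\<^bsub>X\<^esub> gsign X y"
proof -
  let ?I = "{i. hcomp X x i \<noteq> \<zero>\<^bsub>X\<^esub>} \<union> {i. hcomp X y i \<noteq> \<zero>\<^bsub>X\<^esub>}"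
  have fin: "finite ?I" using assms hcomp_finite by auto
  have "gsign X (x \<oplus>\<^bsub>X\<^esub> y) = finsum X (\<lambda>i. ksign X i (hcomp X (x \<oplus>\<^bsub>X\<^esub> y) i)) ?I"
    by (rule gsign_superset[OF _ fin]) (use assms in \<open>auto simp: hcomp_add\<close>)
  also have "\<dots> = finsum X (\<lambda>i. ksign X i (hcomp X x i) \<oplus>\<^bsub>X\<^esub> ksign X i (hcomp X y i)) ?I"
    by (rule M.finsum_cong') (use assms in \<open>auto simp: hcomp_add M.ksign_add\<close>)
  also have "\<dots> = gsign X x \<oplus>\<^bsub>X\<^esub> gsign X y"
    using assms gsign_superset[OF assms(1) fin] gsign_superset[OF assms(2) fin]
    by (subst M.finsum_addf) auto
  finally show ?thesis .
qed

lemma gsign_smult: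
  assumes "r \<in> carrier R" "x \<in> carrier X"
  shows "gsign X (r \<odot>\<^bsub>X\<^esub> x) = r \<odot>\<^bsub>X\<^esub> gsign X x"
proof -
  let ?I = "{i. hcomp X x i \<noteq> \<zero>\<^bsub>X\<^esub>}"
  have fin: "finite ?I" using assms hcomp_finite by auto
  have "gsign X (r \<odot>\<^bsub>X\<^esub> x) = finsum X (\<lambda>i. ksign X i (hcomp X (r \<odot>\<^bsub>X\<^esub> x) i)) ?I"
    by (rule gsign_superset[OF _ fin]) (use assms in \<open>auto simp: hcomp_smult\<close>)
  also have "\<dots> = finsum X (\<lambda>i. r \<odot>\<^bsub>X\<^esub> ksign X i (hcomp X x i)) ?I"
    by (rule M.finsum_cong') (use assms in \<open>auto simp: hcomp_smult ksign_def smult_r_minus\<close>)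
  also have "\<dots> = r \<odot>\<^bsub>X\<^esub> gsign X x"
    unfolding gsign_def using assms fin by (subst finsum_smult_ldistr) auto
  finally show ?thesis .
qed

lemma gsign_homog:
  assumes "x \<in> homog X i"
  shows "gsign X x = ksign X i x"
proof -
  have "{j. hcomp X x j \<noteq> \<zero>\<^bsub>X\<^esub>} \<subseteq> {i}" using assms by (auto simp: hcomp_of_homog)
  then show ?thesis
    using gsign_superset[of x "{i}"] homog_closed[OF assms] assms by (simp add: hcomp_of_homog)
qed

end

section \<open>The inclusion of a centered complex into its symmetric algebra\<close>

text \<open>The construction of \<open>S\<close> depends on the complex and its unit alone; the
  product of \<open>A\<close> enters with \<open>centered_mdg\<close>.\<close>

locale centered_complex = rcomplex R A
  for R :: "('r, 'p) ring_scheme" and A :: "('r, 'a, 'm) graded_complex_scheme" +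
  assumes one_homog: "\<one>\<^bsub>A\<^esub> \<in> homog A 0" and centered: "centered_at_base R A"
begin

abbreviation "S \<equiv> sym_dg R A"
abbreviation "\<iota> \<equiv> sym_incl R A"

sublocale S: ralgebra R S
  by (rule ralgebra_cong[OF symA_ralgebra]) (simp_all add: sym_dg_sel)

lemmas gen_closed' [simp] = gen_closed[unfolded sym_dg_simps]
lemmas gen_add' = gen_add[unfolded sym_dg_simps]
lemmas gen_smult' = gen_smult[unfolded sym_dg_simps]

lemma one_closed [simp]: "\<one>\<^bsub>A\<^esub> \<in> carrier A"
  using one_homog homog_closed by blast

lemma homog_neg_degree: "i < 0 \<Longrightarrow> homog A i = {\<zero>\<^bsub>A\<^esub>}"
  using centered by (simp add: centered_at_base_def)

text \<open>The projection of \<open>A\<close> onto its part of degree zero, read as an element of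
  \<open>R\<close>; it names the coefficient inside \<open>sym_incl\<close>.\<close>

definition base_coeff :: "'a \<Rightarrow> 'r" where
  "base_coeff a = (THE r. r \<in> carrier R \<and> r \<odot>\<^bsub>A\<^esub> \<one>\<^bsub>A\<^esub> = hcomp A a 0)"

lemma base_coeff_eqI:
  assumes "r \<in> carrier R" "r \<odot>\<^bsub>A\<^esub> \<one>\<^bsub>A\<^esub> = hcomp A a 0"
  shows "base_coeff a = r"
  unfolding base_coeff_def
proof (rule the_equality)
  fix s assume "s \<in> carrier R \<and> s \<odot>\<^bsub>A\<^esub> \<one>\<^bsub>A\<^esub> = hcomp A a 0"
  then show "s = r" using assms centered
    unfolding centered_at_base_def bij_betw_def inj_on_def by simp
qed (use assms in simp)

lemma base_coeff:
  assumes "a \<in> carrier A"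
  shows base_coeff_closed: "base_coeff a \<in> carrier R"
    and base_coeff_smult: "base_coeff a \<odot>\<^bsub>A\<^esub> \<one>\<^bsub>A\<^esub> = hcomp A a 0"
proof -
  have "hcomp A a 0 \<in> (\<lambda>r. r \<odot>\<^bsub>A\<^esub> \<one>\<^bsub>A\<^esub>) ` carrier R"
    using centered hcomp_homog[OF assms] by (simp add: centered_at_base_def bij_betw_def)
  then obtain r where "r \<in> carrier R" "r \<odot>\<^bsub>A\<^esub> \<one>\<^bsub>A\<^esub> = hcomp A a 0" by auto
  then show "base_coeff a \<in> carrier R" "base_coeff a \<odot>\<^bsub>A\<^esub> \<one>\<^bsub>A\<^esub> = hcomp A a 0"
    using base_coeff_eqI by auto
qed

lemma base_coeff_add:
  "\<lbrakk>a \<in> carrier A; b \<in> carrier A\<rbrakk> \<Longrightarrow> base_coeff (a \<oplus>\<^bsub>A\<^esub> b) = base_coeff a \<oplus>\<^bsub>R\<^esub> base_coeff b"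
  by (rule base_coeff_eqI) (simp_all add: base_coeff smult_l_distr hcomp_add)

lemma base_coeff_smult':
  "\<lbrakk>r \<in> carrier R; a \<in> carrier A\<rbrakk> \<Longrightarrow> base_coeff (r \<odot>\<^bsub>A\<^esub> a) = r \<otimes>\<^bsub>R\<^esub> base_coeff a"
  by (rule base_coeff_eqI) (simp_all add: base_coeff smult_assoc1 hcomp_smult)

lemma base_coeff_pos: "a \<in> pos_part A \<Longrightarrow> base_coeff a = \<zero>\<^bsub>R\<^esub>"
  by (rule base_coeff_eqI) (simp_all add: pos_part_def)

lemma base_coeff_one: "base_coeff \<one>\<^bsub>A\<^esub> = \<one>\<^bsub>R\<^esub>"
  by (rule base_coeff_eqI) (simp_all add: hcomp_of_homog[OF one_homog])

definition pos_comp :: "'a \<Rightarrow> 'a" where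
  "pos_comp a = a \<ominus>\<^bsub>A\<^esub> hcomp A a 0"

text \<open>There is nothing in negative degrees, so removing the component of degree zero leaves
  only positive ones.\<close>

lemma pos_comp_closed [simp]: "a \<in> carrier A \<Longrightarrow> pos_comp a \<in> pos_part A"
proof -
  assume a: "a \<in> carrier A"
  have "hcomp A (pos_comp a) i = \<zero>\<^bsub>A\<^esub>" if "i \<le> 0" for i
  proof (cases "i = 0")
    case True
    then show ?thesis using a hcomp_homog[OF a, of 0]
      by (simp add: pos_comp_def hcomp_minus hcomp_of_homog M.minus_eq_zero_iff)
  next
    case False
    then have "i < 0" using that by simp
    then show ?thesis
      using a hcomp_homog[of "pos_comp a" i] homog_neg_degree by (simp add: pos_comp_def)
  qed
  then show ?thesis using a by (simp add: pos_part_def pos_comp_def)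
qed

lemma pos_comp_carrier [simp]: "a \<in> carrier A \<Longrightarrow> pos_comp a \<in> carrier A"
  by (simp add: pos_comp_def)

lemma pos_comp_add:
  "\<lbrakk>a \<in> carrier A; b \<in> carrier A\<rbrakk> \<Longrightarrow> pos_comp (a \<oplus>\<^bsub>A\<^esub> b) = pos_comp a \<oplus>\<^bsub>A\<^esub> pos_comp b"
  by (simp add: pos_comp_def hcomp_add a_minus_def M.minus_add M.a_ac)

lemma pos_comp_smult:
  "\<lbrakk>r \<in> carrier R; a \<in> carrier A\<rbrakk> \<Longrightarrow> pos_comp (r \<odot>\<^bsub>A\<^esub> a) = r \<odot>\<^bsub>A\<^esub> pos_comp a"
  by (simp add: pos_comp_def hcomp_smult a_minus_def smult_r_distr smult_r_minus)

lemma pos_comp_pos: "a \<in> pos_part A \<Longrightarrow> pos_comp a = a"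
  by (simp add: pos_comp_def pos_part_def a_minus_def)

lemma pos_comp_base: "r \<in> carrier R \<Longrightarrow> pos_comp (r \<odot>\<^bsub>A\<^esub> \<one>\<^bsub>A\<^esub>) = \<zero>\<^bsub>A\<^esub>"
  by (simp add: pos_comp_def hcomp_smult hcomp_of_homog[OF one_homog] M.minus_eq_zero_iff)

lemma decompose: "a \<in> carrier A \<Longrightarrow> a = base_coeff a \<odot>\<^bsub>A\<^esub> \<one>\<^bsub>A\<^esub> \<oplus>\<^bsub>A\<^esub> pos_comp a"
  by (simp add: base_coeff pos_comp_def a_minus_def M.a_ac M.r_neg1 M.r_neg)

lemma sym_incl_eq: "\<iota> a = base_coeff a \<odot>\<^bsub>S\<^esub> \<one>\<^bsub>S\<^esub> \<oplus>\<^bsub>S\<^esub> gen (pos_comp a)"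
  unfolding sym_incl_def base_coeff_def pos_comp_def sym_dg_sel ..

lemma sym_incl_closed [simp]: "a \<in> carrier A \<Longrightarrow> \<iota> a \<in> carrier S"
  unfolding sym_incl_eq by (simp add: base_coeff_closed)

lemma sym_incl_add: "\<lbrakk>a \<in> carrier A; b \<in> carrier A\<rbrakk> \<Longrightarrow> \<iota> (a \<oplus>\<^bsub>A\<^esub> b) = \<iota> a \<oplus>\<^bsub>S\<^esub> \<iota> b"
  unfolding sym_incl_eq
  by (simp add: base_coeff_closed base_coeff_add pos_comp_add gen_add' S.smult_l_distr S.M.a_ac)

lemma sym_incl_smult: "\<lbrakk>r \<in> carrier R; a \<in> carrier A\<rbrakk> \<Longrightarrow> \<iota> (r \<odot>\<^bsub>A\<^esub> a) = r \<odot>\<^bsub>S\<^esub> \<iota> a"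
  unfolding sym_incl_eq
  by (simp add: base_coeff_closed base_coeff_smult' pos_comp_smult gen_smult' S.smult_r_distr S.smult_assoc1)

lemmas sym_incl_zero [simp] =
    additive_map_zero[OF M.abelian_group_axioms S.M.abelian_group_axioms sym_incl_closed sym_incl_add, simplified]
  and sym_incl_neg =
    additive_map_neg[OF M.abelian_group_axioms S.M.abelian_group_axioms sym_incl_closed sym_incl_add, simplified]
  and sym_incl_minus =
    additive_map_minus[OF M.abelian_group_axioms S.M.abelian_group_axioms sym_incl_closed sym_incl_add, simplified]

lemma sym_incl_ksign: "a \<in> carrier A \<Longrightarrow> \<iota> (ksign A i a) = ksign S i (\<iota> a)"
  by (simp add: ksign_def sym_incl_neg)

lemma sym_incl_pos: "a \<in> pos_part A \<Longrightarrow> \<iota> a = gen a"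
  unfolding sym_incl_eq by (simp add: base_coeff_pos pos_comp_pos)

lemma sym_incl_one: "\<iota> \<one>\<^bsub>A\<^esub> = \<one>\<^bsub>S\<^esub>"
proof -
  have "pos_comp \<one>\<^bsub>A\<^esub> = \<zero>\<^bsub>A\<^esub>" using pos_comp_base[of "\<one>\<^bsub>R\<^esub>"] by simp
  moreover have "gen \<zero>\<^bsub>A\<^esub> = \<zero>\<^bsub>S\<^esub>"
    using sym_incl_pos[of "\<zero>\<^bsub>A\<^esub>"] submodule_zero[OF pos_part_submodule] by simp
  ultimately show ?thesis unfolding sym_incl_eq by (simp add: base_coeff_one)
qed

lemma sym_incl_base: "r \<in> carrier R \<Longrightarrow> \<iota> (r \<odot>\<^bsub>A\<^esub> \<one>\<^bsub>A\<^esub>) = r \<odot>\<^bsub>S\<^esub> \<one>\<^bsub>S\<^esub>"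
  by (simp add: sym_incl_smult sym_incl_one)

lemma homog_zero_base:
  assumes "a \<in> homog A 0"
  obtains r where "r \<in> carrier R" "a = r \<odot>\<^bsub>A\<^esub> \<one>\<^bsub>A\<^esub>"
proof -
  have "a \<in> (\<lambda>r. r \<odot>\<^bsub>A\<^esub> \<one>\<^bsub>A\<^esub>) ` carrier R"
    using centered assms by (simp add: centered_at_base_def bij_betw_def)
  then show ?thesis using that by blast
qed

text \<open>The defining relations speak of positive degrees. In degree zero the elements are
  scalars, which are central and carry an even sign; in negative degrees everything is zero.\<close>

lemma sym_incl_comm:
  assumes a: "a \<in> homog A i" and b: "b \<in> homog A j"
  shows "\<iota> a \<otimes>\<^bsub>S\<^esub> \<iota> b = ksign S (i * j) (\<iota> b \<otimes>\<^bsub>S\<^esub> \<iota> a)"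
proof -
  have ab: "a \<in> carrier A" "b \<in> carrier A" using assms homog_closed by auto
  have base: "\<iota> (r \<odot>\<^bsub>A\<^esub> \<one>\<^bsub>A\<^esub>) \<otimes>\<^bsub>S\<^esub> x = x \<otimes>\<^bsub>S\<^esub> \<iota> (r \<odot>\<^bsub>A\<^esub> \<one>\<^bsub>A\<^esub>)"
    if "r \<in> carrier R" "x \<in> carrier S" for r x
    using that by (simp add: sym_incl_base S.smult_mult_left S.smult_mult_right)
  consider "i < 0 \<or> j < 0" | "i = 0" | "j = 0" | "0 < i" "0 < j" by linarith
  then show ?thesis
  proof cases
    case 1
    then have "a = \<zero>\<^bsub>A\<^esub> \<or> b = \<zero>\<^bsub>A\<^esub>" using assms homog_neg_degree by blast
    then show ?thesis using ab by auto
  next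
    case 2
    then obtain r where "r \<in> carrier R" "a = r \<odot>\<^bsub>A\<^esub> \<one>\<^bsub>A\<^esub>" using a homog_zero_base by blast
    then show ?thesis using 2 ab base by (simp add: ksign_def)
  next
    case 3
    then obtain r where "r \<in> carrier R" "b = r \<odot>\<^bsub>A\<^esub> \<one>\<^bsub>A\<^esub>" using b homog_zero_base by blast
    then show ?thesis using 3 ab base by (simp add: ksign_def)
  next
    case 4
    then show ?thesis
      using gen_comm[OF 4 assms, unfolded sym_dg_simps] assms by (simp add: sym_incl_pos homog_pos_part)
  qed
qed

lemma sym_incl_odd_square:
  assumes "odd i" "a \<in> homog A i"
  shows "\<iota> a \<otimes>\<^bsub>S\<^esub> \<iota> a = \<zero>\<^bsub>S\<^esub>"
proof (cases "0 < i")
  case True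
  then show ?thesis using gen_odd_square[OF True assms, unfolded sym_dg_simps] assms
    by (simp add: sym_incl_pos homog_pos_part)
next
  case False
  moreover have "i \<noteq> 0" using assms by auto
  ultimately have "a = \<zero>\<^bsub>A\<^esub>" using assms homog_neg_degree[of i] by auto
  then show ?thesis by simp
qed

lemma sym_dg_induct [consumes 1, case_names one add smult incl]:
  assumes "x \<in> carrier S" "P \<one>\<^bsub>S\<^esub>"
    and "\<And>x y. \<lbrakk>x \<in> carrier S; y \<in> carrier S; P x; P y\<rbrakk> \<Longrightarrow> P (x \<oplus>\<^bsub>S\<^esub> y)"
    and "\<And>r x. \<lbrakk>r \<in> carrier R; x \<in> carrier S; P x\<rbrakk> \<Longrightarrow> P (r \<odot>\<^bsub>S\<^esub> x)"
    and "\<And>i a x. \<lbrakk>0 < i; a \<in> homog A i; x \<in> carrier S; P x\<rbrakk> \<Longrightarrow> P (\<iota> a \<otimes>\<^bsub>S\<^esub> x)"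
  shows "P x"
proof (rule sym_alg_induct[unfolded sym_dg_simps, of x P])
  fix i a x assume ax: "0 < i" "a \<in> homog A i" "x \<in> carrier S" "P x"
  show "P (gen a \<otimes>\<^bsub>S\<^esub> x)"
    using assms(5)[OF ax] sym_incl_pos[OF homog_pos_part[OF ax(2,1)]] by simp
qed (fact assms)+

text \<open>The condition on the unit and linearity fix the image of the part of degree zero, so the
  universal property can be stated for maps on all of \<open>A\<close>.\<close>

lemma sym_dg_lift:
  assumes "ring B" and c: "c \<in> ring_hom R B"
    and central: "\<And>r b. \<lbrakk>r \<in> carrier R; b \<in> carrier B\<rbrakk> \<Longrightarrow> c r \<otimes>\<^bsub>B\<^esub> b = b \<otimes>\<^bsub>B\<^esub> c r"
    and h: "\<And>a. a \<in> carrier A \<Longrightarrow> h a \<in> carrier B"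
    and h_add: "\<And>a b. \<lbrakk>a \<in> carrier A; b \<in> carrier A\<rbrakk> \<Longrightarrow> h (a \<oplus>\<^bsub>A\<^esub> b) = h a \<oplus>\<^bsub>B\<^esub> h b"
    and h_smult: "\<And>r a. \<lbrakk>r \<in> carrier R; a \<in> carrier A\<rbrakk> \<Longrightarrow> h (r \<odot>\<^bsub>A\<^esub> a) = c r \<otimes>\<^bsub>B\<^esub> h a"
    and h_one: "h \<one>\<^bsub>A\<^esub> = \<one>\<^bsub>B\<^esub>"
    and h_comm: "\<And>i j a b. \<lbrakk>0 < i; 0 < j; a \<in> homog A i; b \<in> homog A j\<rbrakk>
      \<Longrightarrow> h a \<otimes>\<^bsub>B\<^esub> h b = ksign B (i * j) (h b \<otimes>\<^bsub>B\<^esub> h a)"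
    and h_square: "\<And>i a. \<lbrakk>0 < i; odd i; a \<in> homog A i\<rbrakk> \<Longrightarrow> h a \<otimes>\<^bsub>B\<^esub> h a = \<zero>\<^bsub>B\<^esub>"
  obtains \<Phi> where "\<Phi> \<in> ring_hom S B"
    and "\<And>r x. \<lbrakk>r \<in> carrier R; x \<in> carrier S\<rbrakk> \<Longrightarrow> \<Phi> (r \<odot>\<^bsub>S\<^esub> x) = c r \<otimes>\<^bsub>B\<^esub> \<Phi> x"
    and "\<And>a. a \<in> carrier A \<Longrightarrow> \<Phi> (\<iota> a) = h a"
proof -
  interpret B: ring B by fact
  obtain \<Phi> where \<Phi>: "\<Phi> \<in> ring_hom S B"
    and \<Phi>_smult: "\<And>r x. \<lbrakk>r \<in> carrier R; x \<in> carrier S\<rbrakk> \<Longrightarrow> \<Phi> (r \<odot>\<^bsub>S\<^esub> x) = c r \<otimes>\<^bsub>B\<^esub> \<Phi> x"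
    and \<Phi>_gen: "\<And>a. a \<in> pos_part A \<Longrightarrow> \<Phi> (gen a) = h a"
    by (rule sym_alg_lift[unfolded sym_dg_simps, OF assms(1) c central h[OF pos_part_closed]
          h_add[OF pos_part_closed pos_part_closed] h_smult[OF _ pos_part_closed] h_comm h_square])
      blast+
  have "\<Phi> (\<iota> a) = h a" if a: "a \<in> carrier A" for a
  proof -
    have c: "c (base_coeff a) \<in> carrier B" using ring_hom_closed[OF c base_coeff_closed[OF a]] .
    have "\<Phi> (\<iota> a) = c (base_coeff a) \<otimes>\<^bsub>B\<^esub> \<one>\<^bsub>B\<^esub> \<oplus>\<^bsub>B\<^esub> h (pos_comp a)"
      using a unfolding sym_incl_eq
      by (simp add: ring_hom_add[OF \<Phi>] base_coeff_closed \<Phi>_smult \<Phi>_gen ring_hom_one[OF \<Phi>])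
    also have "\<dots> = h (base_coeff a \<odot>\<^bsub>A\<^esub> \<one>\<^bsub>A\<^esub> \<oplus>\<^bsub>A\<^esub> pos_comp a)"
      using a by (simp add: h_add h_smult base_coeff_closed h_one)
    also have "\<dots> = h a" using decompose[OF a] by simp
    finally show ?thesis .
  qed
  then show ?thesis using that \<Phi> \<Phi>_smult by blast
qed

end

section \<open>The grading and the differential of the symmetric algebra\<close>

context centered_complex
begin

lemma sym_prod_simps [simp]:
  "sym_prod R A [] = \<one>\<^bsub>S\<^esub>"
  "sym_prod R A (a # as) = \<iota> a \<otimes>\<^bsub>S\<^esub> sym_prod R A as"
  by (simp_all add: sym_prod_def sym_dg_sel)

lemma sym_prod_closed [simp]: "set as \<subseteq> carrier A \<Longrightarrow> sym_prod R A as \<in> carrier S"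
  by (induction as) auto

lemma homog_list_closed: "homog_list A as ns \<Longrightarrow> set as \<subseteq> carrier A"
  unfolding homog_list_def by (induction rule: list_all2_induct) (auto dest: homog_closed)

lemma sym_homog_eq:
  "sym_homog R A i = lin_span R S {sym_prod R A as | as ns. homog_list A as ns \<and> sum_list ns = i}"
  by (simp add: sym_homog_def sym_dg_simps)

lemma homog_prods_carrier:
  "{sym_prod R A as | as ns. homog_list A as ns \<and> sum_list ns = i} \<subseteq> carrier S"
  using homog_list_closed by auto

lemma sym_homog_submodule: "submodule (sym_homog R A i) R S"
  unfolding sym_homog_eq by (rule S.lin_span_submodule[OF homog_prods_carrier])

lemma sym_homog_closed: "x \<in> sym_homog R A i \<Longrightarrow> x \<in> carrier S"
  using S.submoduleE(1)[OF sym_homog_submodule] by blast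

lemma sym_homog_zero [simp]: "\<zero>\<^bsub>S\<^esub> \<in> sym_homog R A i"
  by (rule S.submodule_zero[OF sym_homog_submodule])

lemmas sym_homog_smult = S.submoduleE(4)[OF sym_homog_submodule]
  and sym_homog_add = S.submoduleE(5)[OF sym_homog_submodule]
  and sym_homog_neg = S.submoduleE(3)[OF sym_homog_submodule]

lemma sym_homog_ksign: "x \<in> sym_homog R A i \<Longrightarrow> ksign S k x \<in> sym_homog R A i"
  by (simp add: ksign_def sym_homog_neg)

lemma sym_prod_homog: "homog_list A as ns \<Longrightarrow> sym_prod R A as \<in> sym_homog R A (sum_list ns)"
  unfolding sym_homog_eq by (rule S.lin_span_incl) blast

lemma homog_list_Cons:
  "\<lbrakk>homog_list A as ns; 0 < n; a \<in> homog A n\<rbrakk> \<Longrightarrow> homog_list A (a # as) (n # ns)"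
  by (simp add: homog_list_def)

lemma sym_one_homog: "\<one>\<^bsub>S\<^esub> \<in> sym_homog R A 0"
  using sym_prod_homog[of "[]" "[]"] by (simp add: homog_list_def)

lemma sym_incl_mult_homog:
  assumes n: "0 < n" "a \<in> homog A n" and x: "x \<in> sym_homog R A i"
  shows "\<iota> a \<otimes>\<^bsub>S\<^esub> x \<in> sym_homog R A (n + i)"
proof -
  have a: "\<iota> a \<in> carrier S" using n homog_closed by auto
  show ?thesis
    using x[unfolded sym_homog_eq] homog_prods_carrier
  proof (induction x rule: S.lin_span_induct)
    case (base b)
    then obtain as ns where b: "b = sym_prod R A as" "homog_list A as ns" "sum_list ns = i" by blast
    then show ?case using sym_prod_homog[OF homog_list_Cons[OF b(2) n]] by simp
  qed (use a in \<open>auto simp: S.X.r_distr S.smult_mult_right intro: sym_homog_add sym_homog_smult\<close>)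
qed

lemma sym_homog_induct [consumes 1, case_names zero add smult one incl]:
  assumes x: "x \<in> sym_homog R A i"
    and zero: "\<And>i. P i \<zero>\<^bsub>S\<^esub>"
    and add: "\<And>i x y. \<lbrakk>x \<in> sym_homog R A i; y \<in> sym_homog R A i; P i x; P i y\<rbrakk>
      \<Longrightarrow> P i (x \<oplus>\<^bsub>S\<^esub> y)"
    and smult: "\<And>i r x. \<lbrakk>r \<in> carrier R; x \<in> sym_homog R A i; P i x\<rbrakk> \<Longrightarrow> P i (r \<odot>\<^bsub>S\<^esub> x)"
    and one: "P 0 \<one>\<^bsub>S\<^esub>"
    and incl: "\<And>n a i x. \<lbrakk>0 < n; a \<in> homog A n; x \<in> sym_homog R A i; P i x\<rbrakk>
      \<Longrightarrow> P (n + i) (\<iota> a \<otimes>\<^bsub>S\<^esub> x)"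
  shows "P i x"
proof -
  have prod: "P (sum_list ns) (sym_prod R A as)" if "homog_list A as ns" for as ns
    using that unfolding homog_list_def
  proof (induction rule: list_all2_induct)
    case Nil
    then show ?case using one by simp
  next
    case (Cons a as n ns)
    then show ?case using incl[of n a "sym_prod R A as" "sum_list ns"] sym_prod_homog[of as ns]
      by (simp add: homog_list_def)
  qed
  \<comment> \<open>The span induction offers membership in \<open>carrier S\<close> only;
    membership in the graded piece is added to the predicate because the rules \<open>add\<close>
    and \<open>smult\<close> assume it.\<close>
  have "x \<in> sym_homog R A i \<and> P i x"
    using x[unfolded sym_homog_eq] homog_prods_carrier
  proof (induction x rule: S.lin_span_induct)
    case zero
    then show ?case using assms(2) by simp
  next
    case (base b)
    then show ?case using prod sym_prod_homog by blast
  next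
    case (add x y)
    then show ?case using assms(3) sym_homog_add by blast
  next
    case (smult r x)
    then show ?case using assms(4) sym_homog_smult by blast
  qed
  then show ?thesis by blast
qed

lemma sym_dg_span: "carrier S = lin_span R S {sym_prod R A as | as ns. homog_list A as ns}"
proof -
  let ?B = "{sym_prod R A as | as ns. homog_list A as ns}"
  have B: "?B \<subseteq> carrier S" using homog_list_closed by auto
  note sub = S.lin_span_submodule[OF B]
  have "x \<in> lin_span R S ?B" if "x \<in> carrier S" for x
    using that
  proof (induction x rule: sym_dg_induct)
    case one
    have "homog_list A [] []" by (simp add: homog_list_def)
    then have "sym_prod R A [] \<in> ?B" by blast
    then show ?case using S.lin_span_incl[of "\<one>\<^bsub>S\<^esub>" ?B] by simp
  next
    case (incl n a x)
    have a: "\<iota> a \<in> carrier S" using incl homog_closed by auto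
    show ?case
      using incl.IH B
    proof (induction x rule: S.lin_span_induct)
      case zero
      then show ?case using a S.submodule_zero[OF sub] by simp
    next
      case (base b)
      then obtain as ns where b: "b = sym_prod R A as" "homog_list A as ns" by blast
      have "sym_prod R A (a # as) \<in> ?B" using homog_list_Cons[OF b(2) incl(1,2)] by blast
      then show ?case using S.lin_span_incl b by simp
    next
      case (add x y)
      then show ?case using a S.submoduleE(5)[OF sub] by (simp add: S.X.r_distr)
    next
      case (smult r x)
      then show ?case using a S.submoduleE(4)[OF sub] by (simp add: S.smult_mult_right)
    qed
  qed (use S.submoduleE(4,5)[OF sub] in auto)
  then show ?thesis using S.lin_span_carrier[OF B] by blast
qed

text \<open>The homogeneous components are the coefficients of the ring homomorphism \<open>S \<rightarrow> S[t]\<close>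
  that sends a homogeneous \<open>a\<close> to \<open>a t\<^bsup>|a|\<^esup>\<close>.\<close>

lemma sym_grading_proj:
  obtains p where "\<And>n x. x \<in> carrier S \<Longrightarrow> p n x \<in> carrier S"
    and "\<And>n x y. \<lbrakk>x \<in> carrier S; y \<in> carrier S\<rbrakk> \<Longrightarrow> p n (x \<oplus>\<^bsub>S\<^esub> y) = p n x \<oplus>\<^bsub>S\<^esub> p n y"
    and "\<And>n i x. x \<in> sym_homog R A i \<Longrightarrow> p n x = (if int n = i then x else \<zero>\<^bsub>S\<^esub>)"
proof -
  interpret P: UP_ring S "UP S" by unfold_locales
  let ?P = "UP S"
  \<comment> \<open>\<open>h a\<close> is the polynomial whose coefficient at n is the component of
    degree n. Exponents are natural numbers, so negative degrees are dropped; the components there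
    vanish.\<close>
  define h where "h a = (\<lambda>n. \<iota> (hcomp A a (int n)))" for a
  define c where "c r = monom ?P (r \<odot>\<^bsub>S\<^esub> \<one>\<^bsub>S\<^esub>) 0" for r
  have h_closed: "h a \<in> carrier ?P" if a: "a \<in> carrier A" for a
  proof -
    have "finite {n. hcomp A a (int n) \<noteq> \<zero>\<^bsub>A\<^esub>}"
      using finite_vimageI[OF hcomp_finite[OF a], of int] by (simp add: vimage_def)
    then obtain m where "\<And>n. hcomp A a (int n) \<noteq> \<zero>\<^bsub>A\<^esub> \<Longrightarrow> n \<le> m"
      using finite_nat_set_iff_bounded_le by auto
    then have "bound \<zero>\<^bsub>S\<^esub> m (h a)" unfolding h_def by (metis bound.intro not_less sym_incl_zero)
    then have "h a \<in> up S" using a by (intro mem_upI exI[of _ m]) (simp_all add: h_def)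
    then show ?thesis by (simp add: UP_def)
  qed
  have h_coeff: "coeff ?P (h a) n = \<iota> (hcomp A a (int n))" if "a \<in> carrier A" for a n
    using h_closed[OF that] by (simp add: UP_def h_def)
  have h_homog: "h a = monom ?P (\<iota> a) (nat i)" if "0 \<le> i" "a \<in> homog A i" for a i
  proof (rule P.up_eqI)
    fix n
    show "coeff ?P (h a) n = coeff ?P (monom ?P (\<iota> a) (nat i)) n"
      using that homog_closed[OF that(2)] by (auto simp: h_coeff hcomp_of_homog)
  qed (use that homog_closed h_closed in auto)
  have c_closed: "c r \<in> carrier ?P" if "r \<in> carrier R" for r using that by (simp add: c_def)
  \<comment> \<open>The ring \<open>S\<close> is not commutative, hence neither is its polynomial
    ring. That the constants coming from \<open>R\<close> are central is verified on
    coefficients.\<close>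
  have c_left: "coeff ?P (c r \<otimes>\<^bsub>?P\<^esub> f) n = r \<odot>\<^bsub>S\<^esub> coeff ?P f n"
    if "r \<in> carrier R" "f \<in> carrier ?P" for r f n
    unfolding c_def using that P.coeff_closed[OF that(2)]
    by (subst P.monom_mult_is_smult) (simp_all add: S.smult_mult_left)
  have c_right: "coeff ?P (f \<otimes>\<^bsub>?P\<^esub> c r) n = r \<odot>\<^bsub>S\<^esub> coeff ?P f n"
    if r: "r \<in> carrier R" and f: "f \<in> carrier ?P" for r f n
  proof -
    have "coeff ?P (f \<otimes>\<^bsub>?P\<^esub> c r) n
        = finsum S (\<lambda>i. coeff ?P f i \<otimes>\<^bsub>S\<^esub> coeff ?P (c r) (n - i)) {..n}"
      using c_closed[OF r] f by simp
    also have "\<dots> = finsum S (\<lambda>i. if n = i then r \<odot>\<^bsub>S\<^esub> coeff ?P f i else \<zero>\<^bsub>S\<^esub>) {..n}"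
      by (rule S.M.finsum_cong')
        (use r P.coeff_closed[OF f] in \<open>auto simp: c_def S.smult_mult_right\<close>)
    also have "\<dots> = r \<odot>\<^bsub>S\<^esub> coeff ?P f n"
      using S.M.finsum_singleton[of n "{..n}" "\<lambda>i. r \<odot>\<^bsub>S\<^esub> coeff ?P f i"] r P.coeff_closed[OF f] by simp
    finally show ?thesis .
  qed
  have c_hom: "c \<in> ring_hom R ?P"
  proof (rule ring_hom_memI)
    fix r s assume rs: "r \<in> carrier R" "s \<in> carrier R"
    show "c (r \<otimes>\<^bsub>R\<^esub> s) = c r \<otimes>\<^bsub>?P\<^esub> c s"
      unfolding c_def using rs
      by (simp add: S.smult_mult_left S.smult_assoc1 flip: P.monom_mult)
    show "c (r \<oplus>\<^bsub>R\<^esub> s) = c r \<oplus>\<^bsub>?P\<^esub> c s"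
      unfolding c_def using rs by (simp add: S.smult_l_distr flip: P.monom_add)
  qed (simp_all add: c_def)
  obtain \<Phi> where \<Phi>: "\<Phi> \<in> ring_hom S ?P"
    and \<Phi>_smult: "\<And>r x. \<lbrakk>r \<in> carrier R; x \<in> carrier S\<rbrakk> \<Longrightarrow> \<Phi> (r \<odot>\<^bsub>S\<^esub> x) = c r \<otimes>\<^bsub>?P\<^esub> \<Phi> x"
    and \<Phi>_incl: "\<And>a. a \<in> carrier A \<Longrightarrow> \<Phi> (\<iota> a) = h a"
  proof (rule sym_dg_lift[OF P.UP_ring c_hom _ h_closed])
    fix r f assume "r \<in> carrier R" "f \<in> carrier ?P"
    then show "c r \<otimes>\<^bsub>?P\<^esub> f = f \<otimes>\<^bsub>?P\<^esub> c r"
      by (intro P.up_eqI) (simp_all only: c_left c_right, use c_closed in auto)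
  next
    fix a b assume "a \<in> carrier A" "b \<in> carrier A"
    then show "h (a \<oplus>\<^bsub>A\<^esub> b) = h a \<oplus>\<^bsub>?P\<^esub> h b"
      by (intro P.up_eqI) (simp_all add: h_closed h_coeff hcomp_add sym_incl_add)
  next
    fix r a assume "r \<in> carrier R" "a \<in> carrier A"
    then show "h (r \<odot>\<^bsub>A\<^esub> a) = c r \<otimes>\<^bsub>?P\<^esub> h a"
      by (intro P.up_eqI)
        (simp_all only: c_left h_closed h_coeff hcomp_smult sym_incl_smult hcomp_closed smult_closed,
          use h_closed c_closed in auto)
  next
    show "h \<one>\<^bsub>A\<^esub> = \<one>\<^bsub>?P\<^esub>" using h_homog[OF _ one_homog] by (simp add: sym_incl_one)
  next
    fix i j a b assume ab: "0 < i" "0 < j" "a \<in> homog A i" "b \<in> homog A j"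
    note cl = homog_closed[OF ab(3)] homog_closed[OF ab(4)]
    have "h a \<otimes>\<^bsub>?P\<^esub> h b = monom ?P (\<iota> a \<otimes>\<^bsub>S\<^esub> \<iota> b) (nat i + nat j)"
      "h b \<otimes>\<^bsub>?P\<^esub> h a = monom ?P (\<iota> b \<otimes>\<^bsub>S\<^esub> \<iota> a) (nat i + nat j)"
      using ab cl h_homog[of i a] h_homog[of j b] P.monom_mult[of "\<iota> b" "\<iota> a" "nat j" "nat i"]
      by (simp_all add: add.commute)
    then show "h a \<otimes>\<^bsub>?P\<^esub> h b = ksign ?P (i * j) (h b \<otimes>\<^bsub>?P\<^esub> h a)"
      using sym_incl_comm[OF ab(3,4)] cl by (simp add: ksign_def)
  next
    fix i a assume ia: "0 < i" "odd i" "a \<in> homog A i"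
    then show "h a \<otimes>\<^bsub>?P\<^esub> h a = \<zero>\<^bsub>?P\<^esub>"
      using homog_closed[OF ia(3)] h_homog[of i a] sym_incl_odd_square[OF ia(2,3)]
      by (simp flip: P.monom_mult)
  next
    fix \<Phi> assume "\<Phi> \<in> ring_hom S ?P"
      "\<And>r x. \<lbrakk>r \<in> carrier R; x \<in> carrier S\<rbrakk> \<Longrightarrow> \<Phi> (r \<odot>\<^bsub>S\<^esub> x) = c r \<otimes>\<^bsub>?P\<^esub> \<Phi> x"
      "\<And>a. a \<in> carrier A \<Longrightarrow> \<Phi> (\<iota> a) = h a"
    then show thesis by (rule that)
  qed
  \<comment> \<open>Since \<open>nat\<close> sends every negative degree to exponent zero, the
    induction also records that elements of negative degree vanish.\<close>
  have \<Phi>_homog: "\<Phi> x = monom ?P x (nat i) \<and> (i < 0 \<longrightarrow> x = \<zero>\<^bsub>S\<^esub>)" if "x \<in> sym_homog R A i" for x i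
    using that
  proof (induction rule: sym_homog_induct)
    case zero
    then show ?case using ring_hom_zero[OF \<Phi> S.X.ring_axioms P.UP_ring] by simp
  next
    case (add i x y)
    then show ?case using sym_homog_closed by (auto simp: ring_hom_add[OF \<Phi>])
  next
    case (smult i r x)
    then have x: "x \<in> carrier S" using sym_homog_closed by blast
    have "\<Phi> (r \<odot>\<^bsub>S\<^esub> x) = monom ?P ((r \<odot>\<^bsub>S\<^esub> \<one>\<^bsub>S\<^esub>) \<otimes>\<^bsub>S\<^esub> x) (0 + nat i)"
      using smult x \<Phi>_smult[OF smult(1) x] by (subst P.monom_mult) (simp_all add: c_def)
    then show ?case using smult x by (auto simp: S.smult_mult_left)
  next
    case one
    then show ?case by (simp add: ring_hom_one[OF \<Phi>])
  next
    case (incl n a i x)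
    then have x: "x \<in> carrier S" and a: "a \<in> carrier A" using sym_homog_closed homog_closed by auto
    have "\<Phi> (\<iota> a \<otimes>\<^bsub>S\<^esub> x) = monom ?P (\<iota> a \<otimes>\<^bsub>S\<^esub> x) (nat n + nat i)"
      using incl x a h_homog[of n a] by (simp add: ring_hom_mult[OF \<Phi>] \<Phi>_incl)
    then show ?case using incl a by (cases "i < 0") (auto simp: nat_add_distrib)
  qed
  show ?thesis
  proof (rule that[of "\<lambda>n x. coeff ?P (\<Phi> x) n"])
    fix n i x assume "x \<in> sym_homog R A i"
    then show "coeff ?P (\<Phi> x) n = (if int n = i then x else \<zero>\<^bsub>S\<^esub>)"
      using \<Phi>_homog sym_homog_closed[of x i] by (cases "i < 0") auto
  qed (use ring_hom_closed[OF \<Phi>] in \<open>auto simp: ring_hom_add[OF \<Phi>]\<close>)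
qed

section \<open>Directness of the grading and graded commutativity\<close>

lemma sym_graded: "graded_module R S"
  by (intro graded_module.intro graded_module_axioms.intro S.module_axioms)
    (simp add: homog_sym_dg sym_homog_submodule)

lemma sym_homog_direct_sum:
  assumes "x \<in> carrier S"
  shows "\<exists>!c. is_hdecomp S x c"
proof -
  interpret G: graded_module R S by (rule sym_graded)
  obtain p where p: "\<And>n x. x \<in> carrier S \<Longrightarrow> p n x \<in> carrier S"
    "\<And>n x y. \<lbrakk>x \<in> carrier S; y \<in> carrier S\<rbrakk> \<Longrightarrow> p n (x \<oplus>\<^bsub>S\<^esub> y) = p n x \<oplus>\<^bsub>S\<^esub> p n y"
    "\<And>n i x. x \<in> sym_homog R A i \<Longrightarrow> p n x = (if int n = i then x else \<zero>\<^bsub>S\<^esub>)"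
    using sym_grading_proj by blast
  \<comment> \<open>Degrees start at zero with the unit and grow by positive amounts, so a product
    of generators never has negative degree.\<close>
  have neg: "x = \<zero>\<^bsub>S\<^esub>" if "x \<in> sym_homog R A i" "i < 0" for x i
  proof -
    have "i < 0 \<longrightarrow> x = \<zero>\<^bsub>S\<^esub>" using that(1)
    proof (induction rule: sym_homog_induct)
      case (incl n a i x)
      then show ?case using homog_closed by auto
    qed auto
    with that show ?thesis by simp
  qed
  have uniq: "c i = (if i < 0 then \<zero>\<^bsub>S\<^esub> else p (nat i) x)" if c: "is_hdecomp S x c" for c i
  proof -
    have ci: "c i \<in> sym_homog R A i" using c by (simp add: is_hdecomp_def homog_sym_dg)
    have "p (nat i) x = p (nat i) (c i)" if "0 \<le> i"
      by (rule G.hdecomp_eq_proj[OF c S.M.abelian_group_axioms p(1,2)])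
        (use that p(3) in \<open>auto simp: homog_sym_dg\<close>)
    then show ?thesis using neg[OF ci] p(3)[OF ci, of "nat i"] by auto
  qed
  have "carrier S \<subseteq> {x \<in> carrier S. \<exists>c. is_hdecomp S x c}"
    unfolding sym_dg_span
  proof (rule S.lin_span_least, fold sym_dg_span)
    show "submodule {x \<in> carrier S. \<exists>c. is_hdecomp S x c} R S" by (rule G.hdecomp_exists_submodule)
    show "{sym_prod R A as |as ns. homog_list A as ns} \<subseteq> {x \<in> carrier S. \<exists>c. is_hdecomp S x c}"
      using G.hdecomp_single[unfolded homog_sym_dg, OF sym_prod_homog] homog_list_closed by auto
  qed
  then obtain c where "is_hdecomp S x c" using assms by blast
  moreover have "c = c'" if "is_hdecomp S x c" "is_hdecomp S x c'" for c c'
    using uniq[OF that(1)] uniq[OF that(2)] by auto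
  ultimately show ?thesis by blast
qed

lemma sym_incl_homog: "a \<in> homog A i \<Longrightarrow> \<iota> a \<in> sym_homog R A i"
proof -
  assume a: "a \<in> homog A i"
  consider "i < 0" | "i = 0" | "0 < i" by linarith
  then show ?thesis
  proof cases
    case 1
    then show ?thesis using a homog_neg_degree by simp
  next
    case 2
    then obtain r where "r \<in> carrier R" "a = r \<odot>\<^bsub>A\<^esub> \<one>\<^bsub>A\<^esub>" using a homog_zero_base by blast
    then show ?thesis using 2 sym_homog_smult[OF _ sym_one_homog] by (simp add: sym_incl_base)
  next
    case 3
    then show ?thesis
      using sym_incl_mult_homog[OF 3 a sym_one_homog] homog_closed[OF a] by simp
  qed
qed

lemma sym_homog_mult:
  assumes "x \<in> sym_homog R A i" "y \<in> sym_homog R A j"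
  shows "x \<otimes>\<^bsub>S\<^esub> y \<in> sym_homog R A (i + j)"
  using assms(1)
proof (induction rule: sym_homog_induct)
  case (add i x x')
  then show ?case
    using sym_homog_closed assms(2) by (auto simp: S.X.l_distr intro: sym_homog_add)
next
  case (smult i r x)
  then show ?case
    using sym_homog_closed assms(2) by (auto simp: S.smult_mult_left intro: sym_homog_smult)
next
  case (incl n a i x)
  then show ?case
    using sym_homog_closed assms(2) homog_closed sym_incl_mult_homog[of n a "x \<otimes>\<^bsub>S\<^esub> y" "i + j"]
    by (simp add: S.X.m_assoc add.assoc)
qed (use assms(2) sym_homog_closed in auto)

lemma sym_dg_comm:
  assumes "x \<in> sym_homog R A i" "y \<in> sym_homog R A j"
  shows "x \<otimes>\<^bsub>S\<^esub> y = ksign S (i * j) (y \<otimes>\<^bsub>S\<^esub> x)"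
proof -
  \<comment> \<open>One generator is first moved past an arbitrary homogeneous \<open>y\<close>, by
    induction on \<open>y\<close>; the general case is then an induction on \<open>x\<close> that
    moves its generators one by one.\<close>
  have gen: "\<iota> a \<otimes>\<^bsub>S\<^esub> y = ksign S (n * j) (y \<otimes>\<^bsub>S\<^esub> \<iota> a)"
    if a: "a \<in> homog A n" and y: "y \<in> sym_homog R A j" for a n y j
    using y
  proof (induction rule: sym_homog_induct)
    case (incl m b j y)
    have cl: "\<iota> a \<in> carrier S" "\<iota> b \<in> carrier S" "y \<in> carrier S"
      using a incl homog_closed sym_homog_closed by auto
    have "\<iota> a \<otimes>\<^bsub>S\<^esub> (\<iota> b \<otimes>\<^bsub>S\<^esub> y) = ksign S (n * m) (\<iota> b \<otimes>\<^bsub>S\<^esub> \<iota> a) \<otimes>\<^bsub>S\<^esub> y"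
      using cl sym_incl_comm[OF a incl(2)] by (simp flip: S.X.m_assoc)
    also have "\<dots> = ksign S (n * m) (\<iota> b \<otimes>\<^bsub>S\<^esub> (\<iota> a \<otimes>\<^bsub>S\<^esub> y))"
      using cl by (simp add: S.X.ksign_mult_left S.X.m_assoc)
    also have "\<dots> = ksign S (n * (m + j)) ((\<iota> b \<otimes>\<^bsub>S\<^esub> y) \<otimes>\<^bsub>S\<^esub> \<iota> a)"
      using cl incl.IH
      by (simp add: S.X.ksign_mult_right S.X.m_assoc S.M.ksign_ksign algebra_simps)
    finally show ?case .
  qed (use a homog_closed sym_homog_closed in
      \<open>auto simp: S.X.l_distr S.X.r_distr S.M.ksign_add S.smult_mult_left S.smult_mult_right
        ksign_def S.smult_r_minus S.M.minus_add\<close>)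
  show ?thesis
    using assms(1)
  proof (induction rule: sym_homog_induct)
    case (incl n a i x)
    have cl: "\<iota> a \<in> carrier S" "x \<in> carrier S" "y \<in> carrier S"
      using assms(2) incl homog_closed sym_homog_closed by auto
    have "(\<iota> a \<otimes>\<^bsub>S\<^esub> x) \<otimes>\<^bsub>S\<^esub> y = ksign S (i * j) ((\<iota> a \<otimes>\<^bsub>S\<^esub> y) \<otimes>\<^bsub>S\<^esub> x)"
      using cl incl.IH by (simp add: S.X.ksign_mult_right S.X.m_assoc)
    also have "\<dots> = ksign S ((n + i) * j) (y \<otimes>\<^bsub>S\<^esub> (\<iota> a \<otimes>\<^bsub>S\<^esub> x))"
      using cl unfolding gen[OF incl(2) assms(2)]
      by (simp add: S.X.ksign_mult_left S.X.m_assoc S.M.ksign_ksign algebra_simps)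
    finally show ?case .
  qed (use assms(2) sym_homog_closed in
      \<open>auto simp: S.X.l_distr S.X.r_distr S.M.ksign_add S.smult_mult_left S.smult_mult_right
        ksign_def S.smult_r_minus S.M.minus_add\<close>)
qed

text \<open>For a sum, the mixed terms cancel by graded commutativity. For a product of a generator
  and \<open>x\<close>, regrouping gives up to sign the product of the two squares; one of the two
  degrees is odd, so one square vanishes.\<close>

lemma sym_dg_odd_square:
  assumes "odd i" "x \<in> sym_homog R A i"
  shows "x \<otimes>\<^bsub>S\<^esub> x = \<zero>\<^bsub>S\<^esub>"
proof -
  have "odd i \<longrightarrow> x \<otimes>\<^bsub>S\<^esub> x = \<zero>\<^bsub>S\<^esub>"
    using assms(2)
  proof (induction rule: sym_homog_induct)
    case (add i x y)
    then have cl: "x \<in> carrier S" "y \<in> carrier S" using sym_homog_closed by auto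
    have "x \<otimes>\<^bsub>S\<^esub> y = \<ominus>\<^bsub>S\<^esub> (y \<otimes>\<^bsub>S\<^esub> x)" if "odd i"
      using sym_dg_comm[OF add(1,2)] that by (simp add: ksign_def)
    then show ?case using add cl
      by (auto simp: S.X.l_distr S.X.r_distr S.M.l_neg S.M.r_neg)
  next
    case (smult i r x)
    then show ?case using sym_homog_closed by (auto simp: S.smult_mult_left S.smult_mult_right)
  next
    case (incl n a i x)
    have cl: "\<iota> a \<in> carrier S" "x \<in> carrier S" using incl homog_closed sym_homog_closed by auto
    have "(\<iota> a \<otimes>\<^bsub>S\<^esub> x) \<otimes>\<^bsub>S\<^esub> (\<iota> a \<otimes>\<^bsub>S\<^esub> x) = \<iota> a \<otimes>\<^bsub>S\<^esub> ((x \<otimes>\<^bsub>S\<^esub> \<iota> a) \<otimes>\<^bsub>S\<^esub> x)"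
      using cl by (simp add: S.X.m_assoc)
    also have "\<dots> = ksign S (i * n) ((\<iota> a \<otimes>\<^bsub>S\<^esub> \<iota> a) \<otimes>\<^bsub>S\<^esub> (x \<otimes>\<^bsub>S\<^esub> x))"
      using cl unfolding sym_dg_comm[OF incl(3) sym_incl_homog[OF incl(2)]]
      by (simp add: S.X.ksign_mult_left S.X.ksign_mult_right S.X.m_assoc)
    finally show ?case
      using incl.IH cl sym_incl_odd_square[OF _ incl(2)] by (cases "odd n") auto
  qed auto
  with assms(1) show ?thesis by simp
qed

text \<open>The target is a bare ring, so compatibility with scalars enters as a hypothesis on the
  pair \<open>f\<close>, \<open>g\<close>.\<close>

lemma sym_hom_eqI:
  assumes B: "ring B" and f: "f \<in> ring_hom S B" and g: "g \<in> ring_hom S B"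
    and r: "\<And>r x. \<lbrakk>r \<in> carrier R; x \<in> carrier S; f x = g x\<rbrakk> \<Longrightarrow> f (r \<odot>\<^bsub>S\<^esub> x) = g (r \<odot>\<^bsub>S\<^esub> x)"
    and a: "\<And>i a. \<lbrakk>0 < i; a \<in> homog A i\<rbrakk> \<Longrightarrow> f (\<iota> a) = g (\<iota> a)"
    and x: "x \<in> carrier S"
  shows "f x = g x"
  using x
proof (induction x rule: sym_dg_induct)
  case one
  then show ?case using ring_hom_one[OF f] ring_hom_one[OF g] by simp
next
  case (add x y)
  then show ?case using ring_hom_add[OF f] ring_hom_add[OF g] by simp
next
  case (incl i b x)
  have "\<iota> b \<in> carrier S" using incl homog_closed by auto
  then show ?case using incl ring_hom_mult[OF f] ring_hom_mult[OF g] a by simp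
qed (use r in blast)

text \<open>A skew derivation \<open>d\<close> with twist \<open>s\<close> is the same as a ring homomorphism
  \<open>x \<mapsto> ((s x, d x), (0, x))\<close> into upper triangular matrices.\<close>

lemma sym_derivation:
  obtains s d where "\<And>x. x \<in> carrier S \<Longrightarrow> s x \<in> carrier S" "\<And>x. x \<in> carrier S \<Longrightarrow> d x \<in> carrier S"
    and "\<And>x y. \<lbrakk>x \<in> carrier S; y \<in> carrier S\<rbrakk> \<Longrightarrow> s (x \<oplus>\<^bsub>S\<^esub> y) = s x \<oplus>\<^bsub>S\<^esub> s y"
    and "\<And>x y. \<lbrakk>x \<in> carrier S; y \<in> carrier S\<rbrakk> \<Longrightarrow> d (x \<oplus>\<^bsub>S\<^esub> y) = d x \<oplus>\<^bsub>S\<^esub> d y"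
    and "\<And>r x. \<lbrakk>r \<in> carrier R; x \<in> carrier S\<rbrakk> \<Longrightarrow> s (r \<odot>\<^bsub>S\<^esub> x) = r \<odot>\<^bsub>S\<^esub> s x"
    and "\<And>r x. \<lbrakk>r \<in> carrier R; x \<in> carrier S\<rbrakk> \<Longrightarrow> d (r \<odot>\<^bsub>S\<^esub> x) = r \<odot>\<^bsub>S\<^esub> d x"
    and "s \<one>\<^bsub>S\<^esub> = \<one>\<^bsub>S\<^esub>" "d \<one>\<^bsub>S\<^esub> = \<zero>\<^bsub>S\<^esub>"
    and "\<And>x y. \<lbrakk>x \<in> carrier S; y \<in> carrier S\<rbrakk> \<Longrightarrow> s (x \<otimes>\<^bsub>S\<^esub> y) = s x \<otimes>\<^bsub>S\<^esub> s y"
    and "\<And>x y. \<lbrakk>x \<in> carrier S; y \<in> carrier S\<rbrakk> \<Longrightarrow> d (x \<otimes>\<^bsub>S\<^esub> y) = s x \<otimes>\<^bsub>S\<^esub> d y \<oplus>\<^bsub>S\<^esub> d x \<otimes>\<^bsub>S\<^esub> y"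
    and "\<And>i a. a \<in> homog A i \<Longrightarrow> s (\<iota> a) = ksign S i (\<iota> a)"
    and "\<And>a. a \<in> carrier A \<Longrightarrow> d (\<iota> a) = \<iota> (diff A a)"
proof -
  let ?U = "upper_triangular S"
  have U: "ring ?U" by (rule S.X.upper_triangular_ring)
  define c where "c r = (r \<odot>\<^bsub>S\<^esub> \<one>\<^bsub>S\<^esub>, \<zero>\<^bsub>S\<^esub>, r \<odot>\<^bsub>S\<^esub> \<one>\<^bsub>S\<^esub>)" for r
  define h where "h a = (\<iota> (gsign A a), \<iota> (diff A a), \<iota> a)" for a
  have h_homog: "h a = (ksign S i (\<iota> a), \<iota> (diff A a), \<iota> a)" if "a \<in> homog A i" for a i
    using that homog_closed[OF that] by (simp add: h_def gsign_homog sym_incl_ksign)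
  have c_hom: "c \<in> ring_hom R ?U"
    by (rule ring_hom_memI)
      (auto simp: c_def upper_triangular_def S.smult_l_distr S.smult_mult_left S.smult_assoc1)
  have diff_one: "diff A \<one>\<^bsub>A\<^esub> = \<zero>\<^bsub>A\<^esub>"
    using diff_degree[OF one_homog] homog_neg_degree[of "-1"] by simp
  obtain \<Phi> where \<Phi>: "\<Phi> \<in> ring_hom S ?U"
    and \<Phi>_smult: "\<And>r x. \<lbrakk>r \<in> carrier R; x \<in> carrier S\<rbrakk> \<Longrightarrow> \<Phi> (r \<odot>\<^bsub>S\<^esub> x) = c r \<otimes>\<^bsub>?U\<^esub> \<Phi> x"
    and \<Phi>_incl: "\<And>a. a \<in> carrier A \<Longrightarrow> \<Phi> (\<iota> a) = h a"
  proof (rule sym_dg_lift[OF U c_hom])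
    \<comment> \<open>The corner entries to be compared are (-1)^i a d(b) + d(a) b and its mirror
      image. As d(a) and d(b) have degrees i - 1 and j - 1, exchanging factors gives exponents (i -
      1) j and i (j - 1), which agree modulo two with the exponents required.\<close>
    fix i j a b assume ab: "0 < i" "0 < j" "a \<in> homog A i" "b \<in> homog A j"
    have cl: "a \<in> carrier A" "b \<in> carrier A" using ab homog_closed by auto
    note d = diff_degree[OF ab(3)] diff_degree[OF ab(4)]
    have "\<iota> (diff A a) \<otimes>\<^bsub>S\<^esub> \<iota> b = ksign S (i * j + j) (\<iota> b \<otimes>\<^bsub>S\<^esub> \<iota> (diff A a))"
      unfolding sym_incl_comm[OF d(1) ab(4)] by (rule S.M.ksign_parity) (simp add: algebra_simps)
    moreover have "ksign S i (\<iota> a \<otimes>\<^bsub>S\<^esub> \<iota> (diff A b)) = ksign S (i * j) (\<iota> (diff A b) \<otimes>\<^bsub>S\<^esub> \<iota> a)"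
      unfolding sym_incl_comm[OF ab(3) d(2)] using cl
      by (simp add: S.M.ksign_ksign) (rule S.M.ksign_parity, simp add: algebra_simps)
    moreover have "ksign S i (ksign S j (\<iota> a \<otimes>\<^bsub>S\<^esub> \<iota> b))
        = ksign S (i * j) (ksign S i (ksign S j (\<iota> b \<otimes>\<^bsub>S\<^esub> \<iota> a)))"
      unfolding sym_incl_comm[OF ab(3,4)] using cl by (simp add: S.M.ksign_ksign algebra_simps)
    ultimately show "h a \<otimes>\<^bsub>?U\<^esub> h b = ksign ?U (i * j) (h b \<otimes>\<^bsub>?U\<^esub> h a)"
      using cl sym_incl_comm[OF ab(3,4)]
      by (simp add: h_homog[OF ab(3)] h_homog[OF ab(4)] upper_triangular_def[THEN arg_cong[of _ _ mult]]
          upper_triangular_ksign[OF S.X.ring_axioms] S.X.ksign_mult_left S.X.ksign_mult_right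
          S.M.ksign_add S.M.ksign_ksign S.M.a_comm ac_simps)
  next
    fix i a assume ia: "0 < i" "odd i" "a \<in> homog A i"
    have cl: "a \<in> carrier A" using ia homog_closed by auto
    \<comment> \<open>The differential of an element of odd degree has even degree and commutes with
      it, so the two terms in the corner cancel.\<close>
    have "\<iota> a \<otimes>\<^bsub>S\<^esub> \<iota> (diff A a) = \<iota> (diff A a) \<otimes>\<^bsub>S\<^esub> \<iota> a"
      using sym_incl_comm[OF ia(3) diff_degree[OF ia(3)]] ia(2) by (simp add: ksign_def)
    then show "h a \<otimes>\<^bsub>?U\<^esub> h a = \<zero>\<^bsub>?U\<^esub>"
      using cl sym_incl_odd_square[OF ia(2,3)] ia(2)
      by (simp add: h_homog[OF ia(3)] upper_triangular_def S.X.ksign_mult_left S.X.ksign_mult_right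
          S.M.l_neg) (simp add: ksign_def S.M.l_neg)
  next
    fix \<Phi> assume "\<Phi> \<in> ring_hom S ?U"
      "\<And>r x. \<lbrakk>r \<in> carrier R; x \<in> carrier S\<rbrakk> \<Longrightarrow> \<Phi> (r \<odot>\<^bsub>S\<^esub> x) = c r \<otimes>\<^bsub>?U\<^esub> \<Phi> x"
      "\<And>a. a \<in> carrier A \<Longrightarrow> \<Phi> (\<iota> a) = h a"
    then show thesis by (rule that)
  qed (auto simp: c_def h_def upper_triangular_def S.smult_mult_left S.smult_mult_right
      gsign_add gsign_smult diff_add diff_smult sym_incl_add sym_incl_smult gsign_homog[OF one_homog]
      ksign_def sym_incl_one diff_one)
  have \<Phi>_in: "\<Phi> x \<in> carrier S \<times> carrier S \<times> carrier S" if "x \<in> carrier S" for x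
    using ring_hom_closed[OF \<Phi> that] by (simp add: upper_triangular_def)
  \<comment> \<open>The lower right entry is itself a ring endomorphism that fixes the generators,
    hence the identity. This makes the corner entry of a product the twisted Leibniz rule.\<close>
  have id: "snd (snd (\<Phi> x)) = x" if "x \<in> carrier S" for x
  proof (rule sym_hom_eqI[OF S.X.ring_axioms _ _ _ _ that])
    show "(\<lambda>x. snd (snd (\<Phi> x))) \<in> ring_hom S S"
      using \<Phi>_in
      by (intro ring_hom_memI)
        (fastforce simp: ring_hom_add[OF \<Phi>] ring_hom_mult[OF \<Phi>] ring_hom_one[OF \<Phi>]
          upper_triangular_def split: prod.splits)+
    show "(\<lambda>x. x) \<in> ring_hom S S" by (auto intro: ring_hom_memI)
  qed (use \<Phi>_in homog_closed in \<open>fastforce simp: \<Phi>_smult \<Phi>_incl h_def c_def upper_triangular_def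
        S.smult_mult_left split: prod.splits\<close>)+
  have \<Phi>_eq: "\<Phi> x = (fst (\<Phi> x), fst (snd (\<Phi> x)), x)" if "x \<in> carrier S" for x
    using id[OF that] by (simp add: prod_eq_iff)
  have in1: "fst (\<Phi> x) \<in> carrier S" "fst (snd (\<Phi> x)) \<in> carrier S" if "x \<in> carrier S" for x
    using \<Phi>_in[OF that] by auto
  show ?thesis
  proof (rule that[of "\<lambda>x. fst (\<Phi> x)" "\<lambda>x. fst (snd (\<Phi> x))"])
    fix x y assume xy: "x \<in> carrier S" "y \<in> carrier S"
    have "\<Phi> (x \<otimes>\<^bsub>S\<^esub> y) = \<Phi> x \<otimes>\<^bsub>?U\<^esub> \<Phi> y" using xy by (rule ring_hom_mult[OF \<Phi>])
    also have "\<dots> = (fst (\<Phi> x), fst (snd (\<Phi> x)), x) \<otimes>\<^bsub>?U\<^esub> (fst (\<Phi> y), fst (snd (\<Phi> y)), y)"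
      using \<Phi>_eq[OF xy(1)] \<Phi>_eq[OF xy(2)] by simp
    finally show "fst (\<Phi> (x \<otimes>\<^bsub>S\<^esub> y)) = fst (\<Phi> x) \<otimes>\<^bsub>S\<^esub> fst (\<Phi> y)"
      "fst (snd (\<Phi> (x \<otimes>\<^bsub>S\<^esub> y)))
        = fst (\<Phi> x) \<otimes>\<^bsub>S\<^esub> fst (snd (\<Phi> y)) \<oplus>\<^bsub>S\<^esub> fst (snd (\<Phi> x)) \<otimes>\<^bsub>S\<^esub> y"
      by (simp_all add: upper_triangular_def)
    have "\<Phi> (x \<oplus>\<^bsub>S\<^esub> y) = \<Phi> x \<oplus>\<^bsub>?U\<^esub> \<Phi> y" using xy by (rule ring_hom_add[OF \<Phi>])
    also have "\<dots> = (fst (\<Phi> x), fst (snd (\<Phi> x)), x) \<oplus>\<^bsub>?U\<^esub> (fst (\<Phi> y), fst (snd (\<Phi> y)), y)"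
      using \<Phi>_eq[OF xy(1)] \<Phi>_eq[OF xy(2)] by simp
    finally show "fst (\<Phi> (x \<oplus>\<^bsub>S\<^esub> y)) = fst (\<Phi> x) \<oplus>\<^bsub>S\<^esub> fst (\<Phi> y)"
      "fst (snd (\<Phi> (x \<oplus>\<^bsub>S\<^esub> y))) = fst (snd (\<Phi> x)) \<oplus>\<^bsub>S\<^esub> fst (snd (\<Phi> y))"
      by (simp_all add: upper_triangular_def)
  next
    fix r x assume rx: "r \<in> carrier R" "x \<in> carrier S"
    have "\<Phi> (r \<odot>\<^bsub>S\<^esub> x) = c r \<otimes>\<^bsub>?U\<^esub> (fst (\<Phi> x), fst (snd (\<Phi> x)), x)"
      using \<Phi>_smult[OF rx] \<Phi>_eq[OF rx(2)] by simp
    then show "fst (\<Phi> (r \<odot>\<^bsub>S\<^esub> x)) = r \<odot>\<^bsub>S\<^esub> fst (\<Phi> x)"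
      "fst (snd (\<Phi> (r \<odot>\<^bsub>S\<^esub> x))) = r \<odot>\<^bsub>S\<^esub> fst (snd (\<Phi> x))"
      using rx in1 by (simp_all add: c_def upper_triangular_def S.smult_mult_left)
  next
    fix i a assume a: "a \<in> homog A i"
    then show "fst (\<Phi> (\<iota> a)) = ksign S i (\<iota> a)"
      using homog_closed[OF a] by (simp add: \<Phi>_incl h_homog[OF a])
  qed (use in1 in \<open>simp_all add: ring_hom_one[OF \<Phi>] \<Phi>_incl h_def upper_triangular_def\<close>)
qed

section \<open>The differential: uniqueness, the product formula and the Leibniz rule\<close>

lemma is_sym_diff_eq: "is_sym_diff R A d \<longleftrightarrow>
     d \<in> carrier S \<rightarrow>\<^sub>E carrier S \<and>
     (\<forall>x\<in>carrier S. \<forall>y\<in>carrier S. d (x \<oplus>\<^bsub>S\<^esub> y) = d x \<oplus>\<^bsub>S\<^esub> d y) \<and>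
     (\<forall>r\<in>carrier R. \<forall>x\<in>carrier S. d (r \<odot>\<^bsub>S\<^esub> x) = r \<odot>\<^bsub>S\<^esub> d x) \<and>
     (\<forall>a\<in>carrier A. d (\<iota> a) = \<iota> (diff A a)) \<and>
     (\<forall>as ns. homog_list A as ns \<longrightarrow>
        d (sym_prod R A as) =
          finsum S (\<lambda>j. ksign S (sum_list (take j ns)) (sym_prod R A (as[j := diff A (as ! j)])))
            {..<length as})"
  by (simp add: is_sym_diff_def Let_def sym_dg_simps)

text \<open>The product formula fixes the values on products of homogeneous elements, which span
  \<open>S\<close>; extensionality fixes them elsewhere.\<close>

lemma is_sym_diff_unique:
  assumes "is_sym_diff R A d" "is_sym_diff R A d'"
  shows "d = d'"
proof (rule extensionalityI)
  show "d \<in> extensional (carrier S)" "d' \<in> extensional (carrier S)"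
    using assms unfolding is_sym_diff_eq by (auto simp: PiE_def)
  have B: "{sym_prod R A as | as ns. homog_list A as ns} \<subseteq> carrier S"
    using homog_list_closed by auto
  note d = assms(1)[unfolded is_sym_diff_eq] and d' = assms(2)[unfolded is_sym_diff_eq]
  have dc: "d x \<in> carrier S" "d' x \<in> carrier S" if "x \<in> carrier S" for x
    using d d' that by (auto simp: PiE_def)
  fix x assume "x \<in> carrier S"
  then have "x \<in> lin_span R S {sym_prod R A as | as ns. homog_list A as ns}"
    using sym_dg_span by simp
  then show "d x = d' x" using B
  proof (induction x rule: S.lin_span_induct)
    case zero
    show ?case
      using additive_map_zero[OF S.M.abelian_group_axioms S.M.abelian_group_axioms, of d]
        additive_map_zero[OF S.M.abelian_group_axioms S.M.abelian_group_axioms, of d'] dc d d' by simp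
  next
    case (base b)
    then show ?case using d d' by auto
  qed (use d d' in auto)
qed

lemma derivation_sym_prod:
  assumes hl: "homog_list A as ns"
    and dc: "\<And>x. x \<in> carrier S \<Longrightarrow> d x \<in> carrier S"
    and d_one: "d \<one>\<^bsub>S\<^esub> = \<zero>\<^bsub>S\<^esub>"
    and d_incl: "\<And>a. a \<in> carrier A \<Longrightarrow> d (\<iota> a) = \<iota> (diff A a)"
    and d_mult: "\<And>i a x. \<lbrakk>a \<in> homog A i; x \<in> carrier S\<rbrakk>
      \<Longrightarrow> d (\<iota> a \<otimes>\<^bsub>S\<^esub> x) = ksign S i (\<iota> a \<otimes>\<^bsub>S\<^esub> d x) \<oplus>\<^bsub>S\<^esub> d (\<iota> a) \<otimes>\<^bsub>S\<^esub> x"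
  shows "d (sym_prod R A as) =
    finsum S (\<lambda>j. ksign S (sum_list (take j ns)) (sym_prod R A (as[j := diff A (as ! j)]))) {..<length as}"
  using hl unfolding homog_list_def
proof (induction rule: list_all2_induct)
  case Nil
  then show ?case using d_one by simp
next
  case (Cons a as n ns)
  have a: "a \<in> homog A n" "a \<in> carrier A" using Cons homog_closed by auto
  have as: "set as \<subseteq> carrier A" using Cons homog_list_closed by (auto simp: homog_list_def)
  let ?t = "\<lambda>j. ksign S (sum_list (take j ns)) (sym_prod R A (as[j := diff A (as ! j)]))"
  let ?u = "\<lambda>j. ksign S (sum_list (take j (n # ns))) (sym_prod R A ((a # as)[j := diff A ((a # as) ! j)]))"
  have upd: "set (as[j := diff A (as ! j)]) \<subseteq> carrier A" if "j < length as" for j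
  proof -
    have "diff A (as ! j) \<in> carrier A" using as nth_mem[OF that] by auto
    then show ?thesis using as set_update_subset_insert[of as j "diff A (as ! j)"] by blast
  qed
  have t: "?t j \<in> carrier S" if "j < length as" for j using sym_prod_closed[OF upd[OF that]] by simp
  \<comment> \<open>In the sum for \<open>a # as\<close> the index is shifted by one: index 0
    differentiates \<open>a\<close>, and the later terms are those of \<open>as\<close>, multiplied
    by \<open>a\<close> and by the sign of its degree.\<close>
  have uS: "?u (Suc j) = ksign S n (\<iota> a \<otimes>\<^bsub>S\<^esub> ?t j)" if "j < length as" for j
    using a sym_prod_closed[OF upd[OF that]] by (simp add: S.X.ksign_mult_right S.M.ksign_ksign)
  have u0: "?u 0 = \<iota> (diff A a) \<otimes>\<^bsub>S\<^esub> sym_prod R A as" by (simp add: ksign_def)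
  have u: "?u j \<in> carrier S" if "j < Suc (length as)" for j
  proof (cases j)
    case (Suc i)
    then show ?thesis using that a t[of i] uS[of i] by (simp del: sym_prod_simps)
  qed (use u0 a as in simp)
  have "d (sym_prod R A (a # as)) = ksign S n (\<iota> a \<otimes>\<^bsub>S\<^esub> finsum S ?t {..<length as})
      \<oplus>\<^bsub>S\<^esub> \<iota> (diff A a) \<otimes>\<^bsub>S\<^esub> sym_prod R A as"
    using a as d_mult[OF a(1)] d_incl[OF a(2)] Cons.IH by simp
  also have "ksign S n (\<iota> a \<otimes>\<^bsub>S\<^esub> finsum S ?t {..<length as})
      = finsum S (\<lambda>j. ksign S n (\<iota> a \<otimes>\<^bsub>S\<^esub> ?t j)) {..<length as}"
    by (rule additive_map_finsum[OF S.M.abelian_group_axioms S.M.abelian_group_axioms])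
      (use a t in \<open>auto simp: S.X.r_distr S.M.ksign_add\<close>)
  also have "\<dots> = finsum S (\<lambda>j. ?u (Suc j)) {..<length as}"
  proof (rule S.M.finsum_cong'[OF refl])
    show "(\<lambda>j. ?u (Suc j)) \<in> {..<length as} \<rightarrow> carrier S" by (intro Pi_I u) simp
    show "ksign S n (\<iota> a \<otimes>\<^bsub>S\<^esub> ?t j) = ?u (Suc j)" if "j \<in> {..<length as}" for j
      by (rule uS[symmetric]) (use that in simp)
  qed
  also have "\<dots> = finsum S ?u (Suc ` {..<length as})"
    by (rule S.M.finsum_reindex[symmetric]) (use u in \<open>auto simp del: sym_prod_simps\<close>)
  also have "\<dots> \<oplus>\<^bsub>S\<^esub> \<iota> (diff A a) \<otimes>\<^bsub>S\<^esub> sym_prod R A as = finsum S ?u (insert 0 (Suc ` {..<length as}))"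
    unfolding u0[symmetric]
  proof -
    have uI: "?u \<in> Suc ` {..<length as} \<rightarrow> carrier S" by (intro Pi_I u) auto
    have u0c: "?u 0 \<in> carrier S" by (rule u) simp
    have "finsum S ?u (insert 0 (Suc ` {..<length as})) = ?u 0 \<oplus>\<^bsub>S\<^esub> finsum S ?u (Suc ` {..<length as})"
      by (rule S.M.finsum_insert[OF _ _ uI u0c]) auto
    also have "\<dots> = finsum S ?u (Suc ` {..<length as}) \<oplus>\<^bsub>S\<^esub> ?u 0"
      by (rule S.M.a_comm[OF u0c S.M.finsum_closed[OF uI]])
    finally show "finsum S ?u (Suc ` {..<length as}) \<oplus>\<^bsub>S\<^esub> ?u 0
      = finsum S ?u (insert 0 (Suc ` {..<length as}))" by (rule sym)
  qed
  also have "insert 0 (Suc ` {..<length as}) = {..<length (a # as)}"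
    by (simp add: lessThan_Suc_eq_insert_0)
  finally show ?case .
qed

lemma sym_dg_diff:
  shows is_sym_diff_diff: "is_sym_diff R A (diff S)"
    and sym_dg_leibniz: "\<And>i x y. \<lbrakk>x \<in> sym_homog R A i; y \<in> carrier S\<rbrakk>
      \<Longrightarrow> diff S (x \<otimes>\<^bsub>S\<^esub> y) = diff S x \<otimes>\<^bsub>S\<^esub> y \<oplus>\<^bsub>S\<^esub> ksign S i (x \<otimes>\<^bsub>S\<^esub> diff S y)"
    and sym_diff_one: "diff S \<one>\<^bsub>S\<^esub> = \<zero>\<^bsub>S\<^esub>"
proof -
  obtain s d where sc: "\<And>x. x \<in> carrier S \<Longrightarrow> s x \<in> carrier S"
    and dc: "\<And>x. x \<in> carrier S \<Longrightarrow> d x \<in> carrier S"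
    and s_add: "\<And>x y. \<lbrakk>x \<in> carrier S; y \<in> carrier S\<rbrakk> \<Longrightarrow> s (x \<oplus>\<^bsub>S\<^esub> y) = s x \<oplus>\<^bsub>S\<^esub> s y"
    and d_add: "\<And>x y. \<lbrakk>x \<in> carrier S; y \<in> carrier S\<rbrakk> \<Longrightarrow> d (x \<oplus>\<^bsub>S\<^esub> y) = d x \<oplus>\<^bsub>S\<^esub> d y"
    and s_smult: "\<And>r x. \<lbrakk>r \<in> carrier R; x \<in> carrier S\<rbrakk> \<Longrightarrow> s (r \<odot>\<^bsub>S\<^esub> x) = r \<odot>\<^bsub>S\<^esub> s x"
    and d_smult: "\<And>r x. \<lbrakk>r \<in> carrier R; x \<in> carrier S\<rbrakk> \<Longrightarrow> d (r \<odot>\<^bsub>S\<^esub> x) = r \<odot>\<^bsub>S\<^esub> d x"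
    and s_one: "s \<one>\<^bsub>S\<^esub> = \<one>\<^bsub>S\<^esub>" and d_one: "d \<one>\<^bsub>S\<^esub> = \<zero>\<^bsub>S\<^esub>"
    and s_mult: "\<And>x y. \<lbrakk>x \<in> carrier S; y \<in> carrier S\<rbrakk> \<Longrightarrow> s (x \<otimes>\<^bsub>S\<^esub> y) = s x \<otimes>\<^bsub>S\<^esub> s y"
    and d_mult: "\<And>x y. \<lbrakk>x \<in> carrier S; y \<in> carrier S\<rbrakk>
      \<Longrightarrow> d (x \<otimes>\<^bsub>S\<^esub> y) = s x \<otimes>\<^bsub>S\<^esub> d y \<oplus>\<^bsub>S\<^esub> d x \<otimes>\<^bsub>S\<^esub> y"
    and s_incl: "\<And>i a. a \<in> homog A i \<Longrightarrow> s (\<iota> a) = ksign S i (\<iota> a)"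
    and d_incl: "\<And>a. a \<in> carrier A \<Longrightarrow> d (\<iota> a) = \<iota> (diff A a)"
    using sym_derivation by blast
  \<comment> \<open>The restriction makes \<open>d\<close> extensional, as
    \<open>is_sym_diff\<close> demands; uniqueness then identifies it with the description that
    defines \<open>diff S\<close>.\<close>
  let ?d = "restrict d (carrier S)"
  have "is_sym_diff R A ?d"
    unfolding is_sym_diff_eq
  proof (intro conjI allI impI)
    fix as ns assume hl: "homog_list A as ns"
    have "d (\<iota> a \<otimes>\<^bsub>S\<^esub> x) = ksign S i (\<iota> a \<otimes>\<^bsub>S\<^esub> d x) \<oplus>\<^bsub>S\<^esub> d (\<iota> a) \<otimes>\<^bsub>S\<^esub> x"
      if "a \<in> homog A i" "x \<in> carrier S" for i a x
      using homog_closed[OF that(1)] that by (simp add: d_mult s_incl dc S.X.ksign_mult_left)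
    from derivation_sym_prod[OF hl dc d_one d_incl this]
    show "?d (sym_prod R A as) =
      finsum S (\<lambda>j. ksign S (sum_list (take j ns)) (sym_prod R A (as[j := diff A (as ! j)])))
        {..<length as}"
      using sym_prod_closed[OF homog_list_closed[OF hl]] by simp
  qed (use dc d_add d_smult d_incl in auto)
  moreover from this have "diff S = ?d"
    unfolding diff_sym_dg using is_sym_diff_unique by blast
  ultimately show "is_sym_diff R A (diff S)" by simp
  have dS: "diff S x = d x" if "x \<in> carrier S" for x using \<open>diff S = ?d\<close> that by simp
  show "diff S \<one>\<^bsub>S\<^esub> = \<zero>\<^bsub>S\<^esub>" using dS d_one by simp
  \<comment> \<open>On homogeneous elements the twist is the sign of the degree, which turns the
    twisted rule into the Leibniz rule with an arbitrary second factor.\<close>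
  have s_homog: "s x = ksign S i x" if "x \<in> sym_homog R A i" for i x
    using that
  proof (induction rule: sym_homog_induct)
    case zero
    show ?case
      using additive_map_zero[OF S.M.abelian_group_axioms S.M.abelian_group_axioms sc s_add] by simp
  next
    case (incl n a i x)
    then show ?case using sym_homog_closed homog_closed[OF incl(2)]
      by (simp add: s_mult s_incl S.X.ksign_mult_left S.X.ksign_mult_right S.M.ksign_ksign add.commute)
  qed (use sym_homog_closed in \<open>auto simp: s_add s_smult s_one ksign_def S.smult_r_minus S.M.minus_add\<close>)
  fix i x y assume xy: "x \<in> sym_homog R A i" "y \<in> carrier S"
  then show "diff S (x \<otimes>\<^bsub>S\<^esub> y) = diff S x \<otimes>\<^bsub>S\<^esub> y \<oplus>\<^bsub>S\<^esub> ksign S i (x \<otimes>\<^bsub>S\<^esub> diff S y)"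
    using sym_homog_closed[OF xy(1)]
    by (simp add: dS dc d_mult s_homog S.X.ksign_mult_left S.M.a_comm)
qed

lemma sym_diff_closed [simp]: "x \<in> carrier S \<Longrightarrow> diff S x \<in> carrier S"
  and sym_diff_add: "\<lbrakk>x \<in> carrier S; y \<in> carrier S\<rbrakk>
    \<Longrightarrow> diff S (x \<oplus>\<^bsub>S\<^esub> y) = diff S x \<oplus>\<^bsub>S\<^esub> diff S y"
  and sym_diff_smult: "\<lbrakk>r \<in> carrier R; x \<in> carrier S\<rbrakk> \<Longrightarrow> diff S (r \<odot>\<^bsub>S\<^esub> x) = r \<odot>\<^bsub>S\<^esub> diff S x"
  and sym_diff_incl: "a \<in> carrier A \<Longrightarrow> diff S (\<iota> a) = \<iota> (diff A a)"
  using is_sym_diff_diff unfolding is_sym_diff_eq by (auto simp: PiE_def)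

lemmas sym_diff_zero =
    additive_map_zero[OF S.M.abelian_group_axioms S.M.abelian_group_axioms sym_diff_closed sym_diff_add, simplified]
  and sym_diff_neg =
    additive_map_neg[OF S.M.abelian_group_axioms S.M.abelian_group_axioms sym_diff_closed sym_diff_add, simplified]

lemma sym_diff_ksign: "x \<in> carrier S \<Longrightarrow> diff S (ksign S i x) = ksign S i (diff S x)"
  by (simp add: ksign_def sym_diff_neg)

lemma sym_diff_degree: "x \<in> sym_homog R A i \<Longrightarrow> diff S x \<in> sym_homog R A (i - 1)"
proof (induction rule: sym_homog_induct)
  case (add i x y)
  then show ?case using sym_homog_closed by (simp add: sym_diff_add sym_homog_add)
next
  case (smult i r x)
  then show ?case using sym_homog_closed by (simp add: sym_diff_smult sym_homog_smult)
next
  case (incl n a i x)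
  have cl: "a \<in> carrier A" "x \<in> carrier S" using incl homog_closed sym_homog_closed by auto
  have "\<iota> (diff A a) \<otimes>\<^bsub>S\<^esub> x \<in> sym_homog R A (n - 1 + i)"
    by (rule sym_homog_mult[OF sym_incl_homog[OF diff_degree[OF incl(2)]] incl(3)])
  moreover have "\<iota> a \<otimes>\<^bsub>S\<^esub> diff S x \<in> sym_homog R A (n + (i - 1))"
    by (rule sym_homog_mult[OF sym_incl_homog[OF incl(2)] incl.IH])
  ultimately show ?case
    using cl sym_dg_leibniz[OF sym_incl_homog[OF incl(2)] cl(2)]
    by (simp add: sym_diff_incl sym_homog_add sym_homog_ksign algebra_simps)
qed (simp_all add: sym_diff_zero sym_diff_one)

text \<open>Applied to a generator times \<open>x\<close>, the Leibniz rule produces the mixed term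
  d(a) d(x) twice, with the opposite signs of the degrees n - 1 and n.\<close>

lemma sym_diff_diff: "x \<in> carrier S \<Longrightarrow> diff S (diff S x) = \<zero>\<^bsub>S\<^esub>"
proof (induction x rule: sym_dg_induct)
  case (incl n a x)
  have a: "a \<in> carrier A" using incl homog_closed by auto
  note ih = sym_incl_homog[OF incl(2)]
  note dih = sym_incl_homog[OF diff_degree[OF incl(2)]]
  have "diff S (diff S (\<iota> a \<otimes>\<^bsub>S\<^esub> x))
      = diff S (\<iota> (diff A a) \<otimes>\<^bsub>S\<^esub> x) \<oplus>\<^bsub>S\<^esub> ksign S n (diff S (\<iota> a \<otimes>\<^bsub>S\<^esub> diff S x))"
    using a incl by (simp add: sym_dg_leibniz[OF ih] sym_diff_incl sym_diff_add sym_diff_ksign)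
  also have "diff S (\<iota> (diff A a) \<otimes>\<^bsub>S\<^esub> x) = ksign S (n - 1) (\<iota> (diff A a) \<otimes>\<^bsub>S\<^esub> diff S x)"
    using a incl by (simp add: sym_dg_leibniz[OF dih] sym_diff_incl diff_diff)
  also have "ksign S n (diff S (\<iota> a \<otimes>\<^bsub>S\<^esub> diff S x)) = ksign S n (\<iota> (diff A a) \<otimes>\<^bsub>S\<^esub> diff S x)"
    using a incl by (simp add: sym_dg_leibniz[OF ih] sym_diff_incl)
  finally show ?case
    using a incl by (auto simp: ksign_def S.M.l_neg S.M.r_neg)
qed (simp_all add: sym_diff_one sym_diff_zero sym_diff_add sym_diff_smult)

theorem sym_dg_algebra: "dg_algebra R S"
proof -
  have "rcomplex R S"
  proof (intro rcomplex.intro rcomplex_axioms.intro S.module_axioms)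
  qed (simp_all add: homog_sym_dg sym_homog_submodule sym_homog_direct_sum sym_diff_add sym_diff_smult
      sym_diff_degree sym_diff_diff)
  then have "chain_pairing R S S S (mult S)"
  proof (intro chain_pairing.intro chain_pairing_axioms.intro)
  qed (simp_all add: homog_sym_dg S.X.l_distr S.X.r_distr S.smult_mult_left S.smult_mult_right
      sym_homog_mult sym_dg_leibniz)
  then show ?thesis
  proof (intro dg_algebra.intro mdg_algebra.intro mdg_algebra_axioms.intro dg_algebra_axioms.intro)
    show "\<And>i j a b. \<lbrakk>a \<in> homog S i; b \<in> homog S j\<rbrakk> \<Longrightarrow> a \<otimes>\<^bsub>S\<^esub> b = ksign S (i * j) (b \<otimes>\<^bsub>S\<^esub> a)"
      unfolding homog_sym_dg by (rule sym_dg_comm)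
  qed (simp_all add: homog_sym_dg sym_one_homog sym_dg_odd_square S.X.m_assoc)
qed

sublocale S: dg_algebra R S
  by (rule sym_dg_algebra)

section \<open>The summands of symmetric degree at most one and at least two\<close>

text \<open>The retraction comes from the homomorphism of \<open>S\<close> into the trivial extension \<open>R \<oplus> A\<close>,
  in which \<open>A\<^sub>+\<close> has square zero.\<close>

lemma sym_incl_retraction:
  obtains \<tau> where "\<And>x. x \<in> carrier S \<Longrightarrow> \<tau> x \<in> carrier A"
    and "\<And>x y. \<lbrakk>x \<in> carrier S; y \<in> carrier S\<rbrakk> \<Longrightarrow> \<tau> (x \<oplus>\<^bsub>S\<^esub> y) = \<tau> x \<oplus>\<^bsub>A\<^esub> \<tau> y"
    and "\<And>r x. \<lbrakk>r \<in> carrier R; x \<in> carrier S\<rbrakk> \<Longrightarrow> \<tau> (r \<odot>\<^bsub>S\<^esub> x) = r \<odot>\<^bsub>A\<^esub> \<tau> x"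
    and "\<And>a. a \<in> carrier A \<Longrightarrow> \<tau> (\<iota> a) = a"
    and "\<And>a b x. \<lbrakk>a \<in> pos_part A; b \<in> pos_part A; x \<in> carrier S\<rbrakk>
      \<Longrightarrow> \<tau> (\<iota> a \<otimes>\<^bsub>S\<^esub> (\<iota> b \<otimes>\<^bsub>S\<^esub> x)) = \<zero>\<^bsub>A\<^esub>"
proof -
  let ?E = "trivial_ext R A"
  define c where "c r = (r, \<zero>\<^bsub>A\<^esub>)" for r :: 'r
  define h where "h a = (base_coeff a, pos_comp a)" for a
  interpret E: ring ?E by (rule trivial_ext_ring)
  have c_hom: "c \<in> ring_hom R ?E"
    by (rule ring_hom_memI) (auto simp: c_def trivial_ext_def)
  have h_pos: "h a \<otimes>\<^bsub>?E\<^esub> h b = \<zero>\<^bsub>?E\<^esub>" if "a \<in> pos_part A" "b \<in> pos_part A" for a b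
    using that pos_part_closed by (simp add: h_def base_coeff_pos trivial_ext_def)
  obtain \<Phi> where \<Phi>: "\<Phi> \<in> ring_hom S ?E"
    and \<Phi>_smult: "\<And>r x. \<lbrakk>r \<in> carrier R; x \<in> carrier S\<rbrakk> \<Longrightarrow> \<Phi> (r \<odot>\<^bsub>S\<^esub> x) = c r \<otimes>\<^bsub>?E\<^esub> \<Phi> x"
    and \<Phi>_incl: "\<And>a. a \<in> carrier A \<Longrightarrow> \<Phi> (\<iota> a) = h a"
  proof (rule sym_dg_lift[OF E.ring_axioms c_hom])
    show "h \<one>\<^bsub>A\<^esub> = \<one>\<^bsub>?E\<^esub>"
      using pos_comp_base[of "\<one>\<^bsub>R\<^esub>"] by (simp add: h_def base_coeff_one trivial_ext_def)
  next
    fix \<Phi> assume "\<Phi> \<in> ring_hom S ?E"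
      "\<And>r x. \<lbrakk>r \<in> carrier R; x \<in> carrier S\<rbrakk> \<Longrightarrow> \<Phi> (r \<odot>\<^bsub>S\<^esub> x) = c r \<otimes>\<^bsub>?E\<^esub> \<Phi> x"
      "\<And>a. a \<in> carrier A \<Longrightarrow> \<Phi> (\<iota> a) = h a"
    then show thesis by (rule that)
  next
    fix i j a b assume "0 < i" "0 < j" "a \<in> homog A i" "b \<in> homog A j"
    then show "h a \<otimes>\<^bsub>?E\<^esub> h b = ksign ?E (i * j) (h b \<otimes>\<^bsub>?E\<^esub> h a)"
      using h_pos homog_pos_part by simp
  next
    fix i a assume "0 < i" "odd i" "a \<in> homog A i"
    then show "h a \<otimes>\<^bsub>?E\<^esub> h a = \<zero>\<^bsub>?E\<^esub>" using h_pos homog_pos_part by simp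
  qed (auto simp: c_def h_def trivial_ext_def base_coeff_closed base_coeff_add base_coeff_smult'
      pos_comp_add pos_comp_smult R.m_comm)
  have \<Phi>_in: "fst (\<Phi> x) \<in> carrier R" "snd (\<Phi> x) \<in> carrier A" if "x \<in> carrier S" for x
    using ring_hom_closed[OF \<Phi> that] by (auto simp: trivial_ext_def)
  show ?thesis
  \<comment> \<open>A pair (r, m) is read in \<open>A\<close> as r \<cdot> 1 + m, which undoes the
    splitting of an element into \<open>base_coeff\<close> and \<open>pos_comp\<close>.\<close>
  proof (rule that[of "\<lambda>x. fst (\<Phi> x) \<odot>\<^bsub>A\<^esub> \<one>\<^bsub>A\<^esub> \<oplus>\<^bsub>A\<^esub> snd (\<Phi> x)"])
    fix x y assume xy: "x \<in> carrier S" "y \<in> carrier S"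
    have "fst (\<Phi> (x \<oplus>\<^bsub>S\<^esub> y)) = fst (\<Phi> x) \<oplus>\<^bsub>R\<^esub> fst (\<Phi> y)"
      "snd (\<Phi> (x \<oplus>\<^bsub>S\<^esub> y)) = snd (\<Phi> x) \<oplus>\<^bsub>A\<^esub> snd (\<Phi> y)"
      using ring_hom_add[OF \<Phi> xy] by (simp_all add: trivial_ext_def split: prod.splits)
    then show "fst (\<Phi> (x \<oplus>\<^bsub>S\<^esub> y)) \<odot>\<^bsub>A\<^esub> \<one>\<^bsub>A\<^esub> \<oplus>\<^bsub>A\<^esub> snd (\<Phi> (x \<oplus>\<^bsub>S\<^esub> y))
        = (fst (\<Phi> x) \<odot>\<^bsub>A\<^esub> \<one>\<^bsub>A\<^esub> \<oplus>\<^bsub>A\<^esub> snd (\<Phi> x)) \<oplus>\<^bsub>A\<^esub> (fst (\<Phi> y) \<odot>\<^bsub>A\<^esub> \<one>\<^bsub>A\<^esub> \<oplus>\<^bsub>A\<^esub> snd (\<Phi> y))"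
      using \<Phi>_in[OF xy(1)] \<Phi>_in[OF xy(2)] by (simp add: smult_l_distr M.a_ac)
  next
    fix r x assume rx: "r \<in> carrier R" "x \<in> carrier S"
    have "fst (\<Phi> (r \<odot>\<^bsub>S\<^esub> x)) = r \<otimes>\<^bsub>R\<^esub> fst (\<Phi> x)" "snd (\<Phi> (r \<odot>\<^bsub>S\<^esub> x)) = r \<odot>\<^bsub>A\<^esub> snd (\<Phi> x)"
      using \<Phi>_smult[OF rx] \<Phi>_in[OF rx(2)] rx
      by (simp_all add: trivial_ext_def c_def split: prod.splits)
    then show "fst (\<Phi> (r \<odot>\<^bsub>S\<^esub> x)) \<odot>\<^bsub>A\<^esub> \<one>\<^bsub>A\<^esub> \<oplus>\<^bsub>A\<^esub> snd (\<Phi> (r \<odot>\<^bsub>S\<^esub> x))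
        = r \<odot>\<^bsub>A\<^esub> (fst (\<Phi> x) \<odot>\<^bsub>A\<^esub> \<one>\<^bsub>A\<^esub> \<oplus>\<^bsub>A\<^esub> snd (\<Phi> x))"
      using \<Phi>_in[OF rx(2)] rx by (simp add: smult_r_distr smult_assoc1)
  next
    fix a assume "a \<in> carrier A"
    then show "fst (\<Phi> (\<iota> a)) \<odot>\<^bsub>A\<^esub> \<one>\<^bsub>A\<^esub> \<oplus>\<^bsub>A\<^esub> snd (\<Phi> (\<iota> a)) = a"
      using decompose by (simp add: \<Phi>_incl h_def)
  next
    fix a b x assume abx: "a \<in> pos_part A" "b \<in> pos_part A" "x \<in> carrier S"
    then have cl: "a \<in> carrier A" "b \<in> carrier A" using pos_part_closed by auto
    have "\<Phi> (\<iota> a \<otimes>\<^bsub>S\<^esub> (\<iota> b \<otimes>\<^bsub>S\<^esub> x)) = \<Phi> ((\<iota> a \<otimes>\<^bsub>S\<^esub> \<iota> b) \<otimes>\<^bsub>S\<^esub> x)"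
      using cl abx by (simp add: S.X.m_assoc)
    also have "\<dots> = (h a \<otimes>\<^bsub>?E\<^esub> h b) \<otimes>\<^bsub>?E\<^esub> \<Phi> x"
      using cl abx by (simp add: ring_hom_mult[OF \<Phi>] \<Phi>_incl)
    also have "\<dots> = \<zero>\<^bsub>?E\<^esub>" using abx h_pos ring_hom_closed[OF \<Phi>] by simp
    finally show "fst (\<Phi> (\<iota> a \<otimes>\<^bsub>S\<^esub> (\<iota> b \<otimes>\<^bsub>S\<^esub> x))) \<odot>\<^bsub>A\<^esub> \<one>\<^bsub>A\<^esub>
        \<oplus>\<^bsub>A\<^esub> snd (\<Phi> (\<iota> a \<otimes>\<^bsub>S\<^esub> (\<iota> b \<otimes>\<^bsub>S\<^esub> x))) = \<zero>\<^bsub>A\<^esub>"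
      by (simp add: trivial_ext_def)
  qed (use \<Phi>_in in simp)
qed

lemma sym_incl_inj: "inj_on \<iota> (carrier A)"
proof -
  obtain \<tau> where "\<And>a. a \<in> carrier A \<Longrightarrow> \<tau> (\<iota> a) = a" using sym_incl_retraction by metis
  then show ?thesis by (rule inj_on_inverseI)
qed

lemma sym_pow_eq:
  "sym_pow R A m = lin_span R S {sym_prod R A as | as. as \<in> lists (pos_part A) \<and> length as = m}"
  by (simp add: sym_pow_def sym_dg_simps)

lemma pos_lists_closed: "as \<in> lists (pos_part A) \<Longrightarrow> set as \<subseteq> carrier A"
  using pos_part_closed by auto

lemma pos_prods_carrier: "{sym_prod R A as | as. as \<in> lists (pos_part A) \<and> length as = m} \<subseteq> carrier S"
  using sym_prod_closed[OF pos_lists_closed] by blast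

lemma sym_pow_carrier: "sym_pow R A m \<subseteq> carrier S"
  unfolding sym_pow_eq by (rule S.lin_span_carrier[OF pos_prods_carrier])

lemma sym_incl_image_submodule: "submodule (\<iota> ` carrier A) R S"
proof (rule S.submoduleI_smult)
  show "\<zero>\<^bsub>S\<^esub> \<in> \<iota> ` carrier A" using sym_incl_zero by (metis M.zero_closed imageI)
qed (auto simp flip: sym_incl_add sym_incl_smult)

lemma sym_le1_eq: "sym_le1 R A = \<iota> ` carrier A"
proof
  have eq: "sym_le1 R A = lin_span R S (\<Union>m\<in>{..1}. sym_pow R A m)"
    by (simp add: sym_le1_def sym_dg_simps)
  have sub: "(\<Union>m\<in>{..1}. sym_pow R A m) \<subseteq> carrier S" using sym_pow_carrier by blast
  have "sym_pow R A m \<subseteq> \<iota> ` carrier A" if "m \<le> 1" for m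
    unfolding sym_pow_eq
  proof (rule S.lin_span_least[OF sym_incl_image_submodule], rule subsetI)
    fix x assume "x \<in> {sym_prod R A as | as. as \<in> lists (pos_part A) \<and> length as = m}"
    then obtain as where as: "x = sym_prod R A as" "as \<in> lists (pos_part A)" "length as = m" by blast
    have "as = [] \<or> (\<exists>a. as = [a])" using as(3) that by (cases as; cases "tl as") auto
    then show "x \<in> \<iota> ` carrier A"
    proof
      assume "as = []"
      then show ?thesis using as sym_incl_one by (auto intro!: image_eqI[of _ _ "\<one>\<^bsub>A\<^esub>"])
    next
      assume "\<exists>a. as = [a]"
      then show ?thesis using as pos_part_closed by auto
    qed
  qed
  then show "sym_le1 R A \<subseteq> \<iota> ` carrier A"
    unfolding eq by (intro S.lin_span_least[OF sym_incl_image_submodule]) blast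
  show "\<iota> ` carrier A \<subseteq> sym_le1 R A"
  proof
    fix x assume "x \<in> \<iota> ` carrier A"
    then obtain a where a: "a \<in> carrier A" "x = \<iota> a" by auto
    have p: "pos_comp a \<in> pos_part A" using a by simp
    have "sym_prod R A [] \<in> sym_pow R A 0"
      unfolding sym_pow_eq by (rule S.lin_span_incl, rule CollectI, rule exI[of _ "[]"]) simp
    moreover have "sym_prod R A [pos_comp a] \<in> sym_pow R A 1"
      unfolding sym_pow_eq
      by (rule S.lin_span_incl, rule CollectI, rule exI[of _ "[pos_comp a]"])
        (use p in \<open>simp del: sym_prod_simps\<close>)
    ultimately have "sym_prod R A [] \<in> sym_le1 R A" "sym_prod R A [pos_comp a] \<in> sym_le1 R A"
      unfolding eq by (auto simp del: sym_prod_simps intro!: S.lin_span_incl)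
    then have "\<one>\<^bsub>S\<^esub> \<in> sym_le1 R A" "\<iota> (pos_comp a) \<in> sym_le1 R A"
      using a by simp_all
    moreover note le = S.lin_span_submodule[OF sub, folded eq]
    ultimately have "base_coeff a \<odot>\<^bsub>S\<^esub> \<one>\<^bsub>S\<^esub> \<oplus>\<^bsub>S\<^esub> \<iota> (pos_comp a) \<in> sym_le1 R A"
      using a S.submoduleE(4,5)[OF le] base_coeff_closed by blast
    moreover have "x = base_coeff a \<odot>\<^bsub>S\<^esub> \<one>\<^bsub>S\<^esub> \<oplus>\<^bsub>S\<^esub> \<iota> (pos_comp a)"
      using a(1) arg_cong[OF decompose[OF a(1)], of \<iota>]
      by (simp add: a(2) base_coeff_closed sym_incl_add sym_incl_smult sym_incl_one)
    ultimately show "x \<in> sym_le1 R A" by simp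
  qed
qed

lemma sym_ge2_eq: "sym_ge2 R A = lin_span R S (\<Union>m\<in>{2..}. sym_pow R A m)"
  by (simp add: sym_ge2_def sym_dg_simps)

lemma sym_pows_carrier: "(\<Union>m\<in>{2..}. sym_pow R A m) \<subseteq> carrier S"
  using sym_pow_carrier by blast

lemma sym_ge2_submodule: "submodule (sym_ge2 R A) R S"
  unfolding sym_ge2_eq by (rule S.lin_span_submodule[OF sym_pows_carrier])

lemma sym_ge2_prod: "\<lbrakk>as \<in> lists (pos_part A); 2 \<le> length as\<rbrakk> \<Longrightarrow> sym_prod R A as \<in> sym_ge2 R A"
  unfolding sym_ge2_eq by (rule S.lin_span_incl) (auto simp: sym_pow_eq intro!: bexI[of _ "length as"] S.lin_span_incl)

lemma sym_ge2_least:
  assumes H: "submodule H R S"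
    and "\<And>as. \<lbrakk>as \<in> lists (pos_part A); 2 \<le> length as\<rbrakk> \<Longrightarrow> sym_prod R A as \<in> H"
  shows "sym_ge2 R A \<subseteq> H"
  unfolding sym_ge2_eq
proof (rule S.lin_span_least[OF H], rule UN_least)
  fix m :: nat assume "m \<in> {2..}"
  then show "sym_pow R A m \<subseteq> H"
    unfolding sym_pow_eq using assms(2) by (intro S.lin_span_least[OF H]) auto
qed

text \<open>The retraction is the identity on \<open>A\<close> and kills every product of at least
  two factors from \<open>pos_part A\<close>.\<close>

lemma sym_le1_ge2_trivial:
  assumes "a \<in> carrier A" "\<iota> a \<in> sym_ge2 R A"
  shows "\<iota> a = \<zero>\<^bsub>S\<^esub>"
proof -
  obtain \<tau> where \<tau>: "\<And>x. x \<in> carrier S \<Longrightarrow> \<tau> x \<in> carrier A"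
    "\<And>x y. \<lbrakk>x \<in> carrier S; y \<in> carrier S\<rbrakk> \<Longrightarrow> \<tau> (x \<oplus>\<^bsub>S\<^esub> y) = \<tau> x \<oplus>\<^bsub>A\<^esub> \<tau> y"
    "\<And>r x. \<lbrakk>r \<in> carrier R; x \<in> carrier S\<rbrakk> \<Longrightarrow> \<tau> (r \<odot>\<^bsub>S\<^esub> x) = r \<odot>\<^bsub>A\<^esub> \<tau> x"
    "\<And>a. a \<in> carrier A \<Longrightarrow> \<tau> (\<iota> a) = a"
    "\<And>a b x. \<lbrakk>a \<in> pos_part A; b \<in> pos_part A; x \<in> carrier S\<rbrakk>
      \<Longrightarrow> \<tau> (\<iota> a \<otimes>\<^bsub>S\<^esub> (\<iota> b \<otimes>\<^bsub>S\<^esub> x)) = \<zero>\<^bsub>A\<^esub>"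
    using sym_incl_retraction by blast
  have "sym_ge2 R A \<subseteq> {x \<in> carrier S. \<tau> x = \<zero>\<^bsub>A\<^esub>}"
  proof (rule sym_ge2_least)
    show "submodule {x \<in> carrier S. \<tau> x = \<zero>\<^bsub>A\<^esub>} R S"
      by (rule S.submoduleI_smult)
        (use \<tau>(2,3) additive_map_zero[OF S.M.abelian_group_axioms M.abelian_group_axioms \<tau>(1,2)] in auto)
    fix as assume as: "as \<in> lists (pos_part A)" "2 \<le> length as"
    then obtain a b bs where eq: "as = a # b # bs" by (cases as; cases "tl as") auto
    then have p: "a \<in> pos_part A" "b \<in> pos_part A" and "bs \<in> lists (pos_part A)" using as by auto
    then have "sym_prod R A bs \<in> carrier S" by (intro sym_prod_closed pos_lists_closed)
    then show "sym_prod R A as \<in> {x \<in> carrier S. \<tau> x = \<zero>\<^bsub>A\<^esub>}"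
      using p \<tau>(5) pos_part_closed by (simp add: eq)
  qed
  then have "a = \<zero>\<^bsub>A\<^esub>" using assms \<tau>(4) by auto
  then show ?thesis by simp
qed

text \<open>Write an element of \<open>A\<close> as r \<cdot> 1 + a with \<open>a\<close> in
  positive degrees. Multiplication by a generator \<open>b\<close> leaves r b in \<open>A\<close>,
  while b a and all products of length at least two land in \<open>sym_ge2\<close>.\<close>

lemma sym_le1_ge2_sum:
  assumes "x \<in> carrier S"
  obtains a y where "a \<in> carrier A" "y \<in> sym_ge2 R A" "x = \<iota> a \<oplus>\<^bsub>S\<^esub> y"
proof -
  note sub = sym_ge2_submodule
  have ge2c: "sym_ge2 R A \<subseteq> carrier S" by (rule S.submoduleE(1)[OF sub])
  have mult_ge2: "\<iota> b \<otimes>\<^bsub>S\<^esub> y \<in> sym_ge2 R A" if b: "b \<in> pos_part A" and y: "y \<in> sym_ge2 R A" for b y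
  proof -
    have b': "\<iota> b \<in> carrier S" using b pos_part_closed by simp
    have "sym_ge2 R A \<subseteq> {y \<in> carrier S. \<iota> b \<otimes>\<^bsub>S\<^esub> y \<in> sym_ge2 R A}"
    proof (rule sym_ge2_least)
      show "submodule {y \<in> carrier S. \<iota> b \<otimes>\<^bsub>S\<^esub> y \<in> sym_ge2 R A} R S"
        by (rule S.submoduleI_smult)
          (use b' S.submoduleE(4,5)[OF sub] S.submodule_zero[OF sub]
            in \<open>auto simp: S.X.r_distr S.smult_mult_right\<close>)
      fix as assume as: "as \<in> lists (pos_part A)" "2 \<le> length as"
      then show "sym_prod R A as \<in> {y \<in> carrier S. \<iota> b \<otimes>\<^bsub>S\<^esub> y \<in> sym_ge2 R A}"
        using sym_ge2_prod[of "b # as"] b sym_prod_closed[OF pos_lists_closed[OF as(1)]] by simp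
    qed
    with y show ?thesis by blast
  qed
  have "\<exists>a\<in>carrier A. \<exists>y\<in>sym_ge2 R A. x = \<iota> a \<oplus>\<^bsub>S\<^esub> y"
    using assms
  proof (induction x rule: sym_dg_induct)
    case one
    have "\<one>\<^bsub>S\<^esub> = \<iota> \<one>\<^bsub>A\<^esub> \<oplus>\<^bsub>S\<^esub> \<zero>\<^bsub>S\<^esub>" by (simp add: sym_incl_one)
    then show ?case using S.submodule_zero[OF sub] one_closed by blast
  next
    case (add x x')
    then obtain a y a' y' where h: "a \<in> carrier A" "y \<in> sym_ge2 R A" "x = \<iota> a \<oplus>\<^bsub>S\<^esub> y"
      "a' \<in> carrier A" "y' \<in> sym_ge2 R A" "x' = \<iota> a' \<oplus>\<^bsub>S\<^esub> y'" by blast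
    have "y \<in> carrier S" "y' \<in> carrier S" using h ge2c by auto
    then have "x \<oplus>\<^bsub>S\<^esub> x' = \<iota> (a \<oplus>\<^bsub>A\<^esub> a') \<oplus>\<^bsub>S\<^esub> (y \<oplus>\<^bsub>S\<^esub> y')"
      using h by (simp add: sym_incl_add S.M.a_ac)
    then show ?case using h S.submoduleE(5)[OF sub] M.a_closed by blast
  next
    case (smult r x)
    then obtain a y where h: "a \<in> carrier A" "y \<in> sym_ge2 R A" "x = \<iota> a \<oplus>\<^bsub>S\<^esub> y" by blast
    have "y \<in> carrier S" using h ge2c by auto
    then have "r \<odot>\<^bsub>S\<^esub> x = \<iota> (r \<odot>\<^bsub>A\<^esub> a) \<oplus>\<^bsub>S\<^esub> r \<odot>\<^bsub>S\<^esub> y"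
      using h smult by (simp add: sym_incl_smult S.smult_r_distr)
    then show ?case using h smult S.submoduleE(4)[OF sub] smult_closed by blast
  next
    case (incl i b x)
    then obtain a y where h: "a \<in> carrier A" "y \<in> sym_ge2 R A" "x = \<iota> a \<oplus>\<^bsub>S\<^esub> y" by blast
    have b: "b \<in> pos_part A" "b \<in> carrier A" using incl homog_pos_part homog_closed by auto
    have y: "y \<in> carrier S" using h ge2c by auto
    have "\<iota> b \<otimes>\<^bsub>S\<^esub> \<iota> (pos_comp a) \<in> sym_ge2 R A"
      using sym_ge2_prod[of "[b, pos_comp a]"] b h by simp
    then have "\<iota> b \<otimes>\<^bsub>S\<^esub> \<iota> (pos_comp a) \<oplus>\<^bsub>S\<^esub> \<iota> b \<otimes>\<^bsub>S\<^esub> y \<in> sym_ge2 R A"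
      using mult_ge2[OF b(1) h(2)] S.submoduleE(5)[OF sub] by blast
    moreover have "\<iota> a = base_coeff a \<odot>\<^bsub>S\<^esub> \<one>\<^bsub>S\<^esub> \<oplus>\<^bsub>S\<^esub> \<iota> (pos_comp a)"
      using h(1) arg_cong[OF decompose[OF h(1)], of \<iota>]
      by (simp add: base_coeff_closed sym_incl_add sym_incl_smult sym_incl_one)
    then have "\<iota> b \<otimes>\<^bsub>S\<^esub> x = \<iota> (base_coeff a \<odot>\<^bsub>A\<^esub> b)
        \<oplus>\<^bsub>S\<^esub> (\<iota> b \<otimes>\<^bsub>S\<^esub> \<iota> (pos_comp a) \<oplus>\<^bsub>S\<^esub> \<iota> b \<otimes>\<^bsub>S\<^esub> y)"
      using h(1,3) b y base_coeff_closed[OF h(1)]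
      by (simp add: S.X.r_distr S.smult_mult_right sym_incl_smult S.M.a_assoc)
    ultimately show ?case using b base_coeff_closed[OF h(1)] smult_closed by blast
  qed
  then show ?thesis using that by blast
qed

end

section \<open>Subcomplexes and quotient complexes\<close>

lemma (in chain_map) map_hom:
  shows map_zero: "f \<zero>\<^bsub>X\<^esub> = \<zero>\<^bsub>Y\<^esub>"
    and map_neg: "x \<in> carrier X \<Longrightarrow> f (\<ominus>\<^bsub>X\<^esub> x) = \<ominus>\<^bsub>Y\<^esub> f x"
    and map_minus: "\<lbrakk>x \<in> carrier X; y \<in> carrier X\<rbrakk> \<Longrightarrow> f (x \<ominus>\<^bsub>X\<^esub> y) = f x \<ominus>\<^bsub>Y\<^esub> f y"
    and map_finsum: "g \<in> I \<rightarrow> carrier X \<Longrightarrow> f (finsum X g I) = finsum Y (\<lambda>i. f (g i)) I"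
  using additive_map[OF X.M.abelian_group_axioms Y.M.abelian_group_axioms, of f] map_closed map_add
  by blast+

lemma (in chain_map) map_ksign: "x \<in> carrier X \<Longrightarrow> f (ksign X i x) = ksign Y i (f x)"
  by (simp add: ksign_def map_neg)

lemma (in chain_map) map_hdecomp:
  assumes "is_hdecomp X x c"
  shows "is_hdecomp Y (f x) (\<lambda>i. f (c i))"
proof -
  have c: "c i \<in> homog X i" and fin: "finite {i. c i \<noteq> \<zero>\<^bsub>X\<^esub>}" for i
    using assms by (auto simp: is_hdecomp_def)
  show ?thesis
  proof (rule Y.is_hdecompI[OF fin])
    show "f x = finsum Y (\<lambda>i. f (c i)) {i. c i \<noteq> \<zero>\<^bsub>X\<^esub>}"
      using assms c X.homog_closed by (subst map_finsum[symmetric]) (auto simp: is_hdecomp_def)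
  qed (use c map_degree map_zero in auto)
qed

lemma (in chain_map) map_hcomp: "x \<in> carrier X \<Longrightarrow> hcomp Y (f x) i = f (hcomp X x i)"
  using Y.hcomp_eqI[OF map_hdecomp[OF X.hcomp_decomp]] by simp

lemma (in chain_map) image_subcomplex:
  assumes "subcomplex R X Z"
  shows "subcomplex R Y (f ` Z)"
proof -
  note Z = assms[unfolded subcomplex_def]
  have Zc: "Z \<subseteq> carrier X" using Z X.submoduleE(1) by blast
  have "submodule (f ` Z) R Y"
  proof (rule Y.submoduleI_smult)
    show "\<zero>\<^bsub>Y\<^esub> \<in> f ` Z" using X.submodule_zero Z map_zero by (metis imageI)
    show "f ` Z \<subseteq> carrier Y" using Zc map_closed by auto
    fix a b assume "a \<in> f ` Z" "b \<in> f ` Z"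
    then show "a \<oplus>\<^bsub>Y\<^esub> b \<in> f ` Z"
      using Zc X.submoduleE(5) Z by (auto simp: subset_iff simp flip: map_add)
  next
    fix r b assume "r \<in> carrier R" "b \<in> f ` Z"
    then show "r \<odot>\<^bsub>Y\<^esub> b \<in> f ` Z"
      using Zc X.submoduleE(4) Z by (auto simp: subset_iff simp flip: map_smult)
  qed
  then show ?thesis
    using Z Zc unfolding subcomplex_def by (auto simp: subset_iff map_hcomp simp flip: map_diff)
qed

text \<open>Chain maps commute with \<open>hcomp\<close>, so closure under components pulls back.
  Applied to \<open>\<iota>\<close> and \<open>\<ss>\<close>, it shows that the part of
  \<open>A\<close> inside \<open>\<ss>\<close> is a subcomplex.\<close>

lemma (in chain_map) vimage_subcomplex:
  assumes "subcomplex R Y Z"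
  shows "subcomplex R X {x \<in> carrier X. f x \<in> Z}"
proof -
  note Z = assms[unfolded subcomplex_def]
  have "submodule {x \<in> carrier X. f x \<in> Z} R X"
    by (rule X.submoduleI_smult)
      (use Z Y.submoduleE(4,5) Y.submodule_zero in \<open>auto simp: map_zero map_add map_smult\<close>)
  then show ?thesis
    using Z unfolding subcomplex_def by (auto simp: map_diff simp flip: map_hcomp)
qed

lemma chain_map_cong:
  assumes "chain_map R X Y f" "\<And>x. x \<in> carrier X \<Longrightarrow> g x = f x"
  shows "chain_map R X Y g"
proof -
  interpret f: chain_map R X Y f by fact
  show ?thesis
  proof (intro chain_map.intro chain_map_axioms.intro)
  qed (use assms(2) f.X.homog_closed f.X.rcomplex_axioms f.Y.rcomplex_axioms f.map_closed
      f.map_add f.map_smult f.map_degree f.map_diff in auto)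
qed

context rcomplex
begin

lemma subcomplex_carrier: "subcomplex R X (carrier X)"
  by (simp add: subcomplex_def carrier_is_submodule)

lemma subcomplex_Int: "\<lbrakk>subcomplex R X Y; subcomplex R X Z\<rbrakk> \<Longrightarrow> subcomplex R X (Y \<inter> Z)"
  by (simp add: subcomplex_def submodule_Int)

end

locale subcomplex_of = rcomplex R X
  for R :: "('r, 'p) ring_scheme" and X :: "('r, 'a, 'm) graded_complex_scheme" +
  fixes Y :: "'a set" assumes Y: "subcomplex R X Y"
begin

lemma Y_submodule: "submodule Y R X" using Y by (simp add: subcomplex_def)

lemma Y_closed: "y \<in> Y \<Longrightarrow> y \<in> carrier X" using submoduleE(1)[OF Y_submodule] by blast

lemma Y_hcomp: "y \<in> Y \<Longrightarrow> hcomp X y i \<in> Y" using Y by (simp add: subcomplex_def)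

lemma Y_diff: "y \<in> Y \<Longrightarrow> diff X y \<in> Y" using Y by (simp add: subcomplex_def)

lemma sub_cplx_sel [simp]:
  "carrier (sub_cplx X Y) = Y" "add (sub_cplx X Y) = add X" "zero (sub_cplx X Y) = zero X"
  "smult (sub_cplx X Y) = smult X" "mult (sub_cplx X Y) = mult X" "diff (sub_cplx X Y) = diff X"
  "homog (sub_cplx X Y) i = homog X i \<inter> Y"
  by (simp_all add: sub_cplx_def)

lemma sub_cplx_module: "module R (sub_cplx X Y)"
  by (rule module_cong[OF submodule.submodule_is_module[OF Y_submodule module_axioms]]) simp_all

lemma sub_cplx_finsum:
  assumes "g \<in> I \<rightarrow> Y"
  shows "finsum (sub_cplx X Y) g I = finsum X g I"
proof -
  interpret Y: module R "sub_cplx X Y" by (rule sub_cplx_module)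
  show ?thesis
    using additive_finsum[OF Y.M.abelian_monoid_axioms M.abelian_monoid_axioms, of "\<lambda>x. x" g I]
      assms Y_closed by simp
qed

lemma sub_cplx_hdecomp:
  assumes "\<And>i. c i \<in> Y"
  shows "is_hdecomp (sub_cplx X Y) x c \<longleftrightarrow> is_hdecomp X x c"
  using assms sub_cplx_finsum[of c "{i. c i \<noteq> \<zero>\<^bsub>X\<^esub>}"] by (auto simp: is_hdecomp_def)

text \<open>Closure under components keeps the decomposition taken in \<open>X\<close> inside
  \<open>Y\<close>, and uniqueness is inherited from \<open>X\<close>.\<close>

lemma sub_cplx_rcomplex: "rcomplex R (sub_cplx X Y)"
proof (intro rcomplex.intro rcomplex_axioms.intro sub_cplx_module)
  fix i
  have sub: "submodule (homog X i \<inter> Y) R X" by (rule submodule_Int[OF homog_submodule Y_submodule])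
  show "submodule (homog (sub_cplx X Y) i) R (sub_cplx X Y)"
    using submodule_zero[OF sub] submoduleE(4,5)[OF sub]
    by (intro module.submoduleI_smult[OF sub_cplx_module]) simp_all
next
  fix x assume "x \<in> carrier (sub_cplx X Y)"
  then have x: "x \<in> Y" by simp
  show "\<exists>!c. is_hdecomp (sub_cplx X Y) x c"
  proof
    show "is_hdecomp (sub_cplx X Y) x (hcomp X x)"
      using hcomp_decomp[OF Y_closed[OF x]] Y_hcomp[OF x] by (simp add: sub_cplx_hdecomp)
    fix c assume c: "is_hdecomp (sub_cplx X Y) x c"
    then have "c i \<in> Y" for i by (simp add: is_hdecomp_def)
    then show "c = hcomp X x" using c hcomp_eqI by (simp add: sub_cplx_hdecomp)
  qed
qed (use Y_closed Y_diff in \<open>auto simp: diff_add diff_smult diff_diff diff_degree\<close>)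

lemma sub_cplx_incl: "chain_map R (sub_cplx X Y) X (\<lambda>x. x)"
  by (intro chain_map.intro chain_map_axioms.intro sub_cplx_rcomplex rcomplex_axioms)
    (use Y_closed in auto)

lemma sub_cplx_incl_sub:
  assumes "subcomplex R X Z" "Y \<subseteq> Z"
  shows "chain_map R (sub_cplx X Y) (sub_cplx X Z) (\<lambda>x. x)"
proof -
  interpret Z: subcomplex_of R X Z by unfold_locales fact
  show ?thesis
    by (intro chain_map.intro chain_map_axioms.intro sub_cplx_rcomplex Z.sub_cplx_rcomplex)
      (use assms in auto)
qed

sublocale Q: module_quot R X Y
  by (intro module_quot.intro module_quot_axioms.intro module_axioms Y_submodule)

lemma quot_cplx_sel [simp]:
  "carrier (quot_cplx X Y) = (\<lambda>x. Y +>\<^bsub>X\<^esub> x) ` carrier X"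
  "zero (quot_cplx X Y) = Y"
  "one (quot_cplx X Y) = Y +>\<^bsub>X\<^esub> \<one>\<^bsub>X\<^esub>"
  "add (quot_cplx X Y) = set_add X"
  "mult (quot_cplx X Y) = rcoset_mult X Y"
  "smult (quot_cplx X Y) = smult (quot_mod X Y)"
  "homog (quot_cplx X Y) i = (\<lambda>x. Y +>\<^bsub>X\<^esub> x) ` homog X i"
  by (simp_all add: quot_cplx_def module.defs graded_complex.defs)

lemma quot_cplx_smult:
  "\<lbrakk>r \<in> carrier R; x \<in> carrier X\<rbrakk> \<Longrightarrow> smult (quot_mod X Y) r (Y +>\<^bsub>X\<^esub> x) = Y +>\<^bsub>X\<^esub> (r \<odot>\<^bsub>X\<^esub> x)"
  by (rule Q.quot_smult)

lemma quot_cplx_diff: "x \<in> carrier X \<Longrightarrow> diff (quot_cplx X Y) (Y +>\<^bsub>X\<^esub> x) = Y +>\<^bsub>X\<^esub> diff X x"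
proof -
  assume x: "x \<in> carrier X"
  have "(\<Union>y\<in>Y +>\<^bsub>X\<^esub> x. Y +>\<^bsub>X\<^esub> diff X y) = Y +>\<^bsub>X\<^esub> diff X x"
  proof (rule Q.UN_coset[OF x])
    fix y assume y: "y \<in> carrier X" "y \<ominus>\<^bsub>X\<^esub> x \<in> Y"
    then show "Y +>\<^bsub>X\<^esub> diff X y = Y +>\<^bsub>X\<^esub> diff X x"
      using x Y_diff[OF y(2)] by (simp add: Q.coset_eq_iff diff_minus)
  qed
  then show ?thesis by (simp add: quot_cplx_def module.defs graded_complex.defs)
qed

lemma quot_cplx_module: "module R (quot_cplx X Y)"
  by (rule module_cong[OF Q.quot_mod_module]) simp_all

text \<open>Because \<open>Y\<close> contains the components of its elements, taking the component
  of degree i is well defined on cosets. The induced map \<open>p\<close> kills all other degrees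
  and is the identity on degree i, which gives uniqueness of decompositions.\<close>

lemma quot_cplx_rcomplex: "rcomplex R (quot_cplx X Y)"
proof -
  let ?cl = "\<lambda>x. Y +>\<^bsub>X\<^esub> x" and ?Q = "quot_cplx X Y"
  interpret QM: module R ?Q by (rule quot_cplx_module)
  have sub: "submodule (homog ?Q i) R ?Q" for i
  proof (rule QM.submoduleI_smult)
    show "\<zero>\<^bsub>?Q\<^esub> \<in> homog ?Q i"
      using Q.coset_eq_zero_iff[of "\<zero>\<^bsub>X\<^esub>"] by (auto intro!: image_eqI[of _ _ "\<zero>\<^bsub>X\<^esub>"])
    show "homog ?Q i \<subseteq> carrier ?Q" using homog_closed by auto
    fix a b assume "a \<in> homog ?Q i" "b \<in> homog ?Q i"
    then show "a \<oplus>\<^bsub>?Q\<^esub> b \<in> homog ?Q i"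
      using homog_closed homog_add by (auto simp: Q.a_rcos_sum)
  next
    fix r a assume "r \<in> carrier R" "a \<in> homog ?Q i"
    then show "r \<odot>\<^bsub>?Q\<^esub> a \<in> homog ?Q i"
      using homog_closed homog_smult by (auto simp: quot_cplx_smult)
  qed
  interpret G: graded_module R ?Q
    by (intro graded_module.intro graded_module_axioms.intro quot_cplx_module sub)
  have cl_closed: "?cl x \<in> carrier ?Q" if "x \<in> carrier X" for x using that by simp
  have cl_add: "?cl (x \<oplus>\<^bsub>X\<^esub> y) = ?cl x \<oplus>\<^bsub>?Q\<^esub> ?cl y" if "x \<in> carrier X" "y \<in> carrier X" for x y
    using that by (simp add: Q.a_rcos_sum)
  have cl_zero: "?cl \<zero>\<^bsub>X\<^esub> = \<zero>\<^bsub>?Q\<^esub>"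
    using Q.coset_eq_zero_iff[of "\<zero>\<^bsub>X\<^esub>"] by simp
  have "\<exists>!c. is_hdecomp ?Q C c" if C: "C \<in> carrier ?Q" for C
  proof -
    obtain x where x: "x \<in> carrier X" "C = ?cl x" using C by auto
    have "is_hdecomp ?Q C (\<lambda>i. ?cl (hcomp X x i))"
    proof (rule G.is_hdecompI[OF hcomp_finite[OF x(1)]])
      show "C = finsum ?Q (\<lambda>i. ?cl (hcomp X x i)) {i. hcomp X x i \<noteq> \<zero>\<^bsub>X\<^esub>}"
        unfolding x(2)
        by (subst additive_map_finsum[OF M.abelian_group_axioms QM.M.abelian_group_axioms
              cl_closed cl_add, symmetric]) (use x hcomp_finsum in auto)
    qed (use x cl_zero in auto)
    moreover have "c i = ?cl (hcomp X x i)" if c: "is_hdecomp ?Q C c" for c i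
    proof -
      have "?cl (hcomp X y i) = ?cl (hcomp X z i)"
        if "y \<in> carrier X" "z \<in> carrier X" "?cl y = ?cl z" for y z
        using that Y_hcomp[of "y \<ominus>\<^bsub>X\<^esub> z" i] by (simp add: Q.coset_eq_iff hcomp_minus)
      then obtain p where p: "\<And>y. y \<in> carrier X \<Longrightarrow> p (?cl y) = ?cl (hcomp X y i)"
        using factor_through_image[of "carrier X" ?cl "\<lambda>y. ?cl (hcomp X y i)"] by blast
      have "p C = p (c i)"
      proof (rule G.hdecomp_eq_proj[OF c QM.M.abelian_group_axioms])
        fix D E assume "D \<in> carrier ?Q" "E \<in> carrier ?Q"
        then obtain y z where "y \<in> carrier X" "D = ?cl y" "z \<in> carrier X" "E = ?cl z" by auto
        then show "p (D \<oplus>\<^bsub>?Q\<^esub> E) = p D \<oplus>\<^bsub>?Q\<^esub> p E"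
          using p[of y] p[of z] p[of "y \<oplus>\<^bsub>X\<^esub> z"] by (simp add: hcomp_add Q.a_rcos_sum)
      next
        fix k D assume "k \<noteq> i" "D \<in> homog ?Q k"
        then show "p D = \<zero>\<^bsub>?Q\<^esub>"
          using p homog_closed cl_zero by (auto simp: hcomp_of_homog)
      qed (use p in auto)
      moreover obtain y where "y \<in> homog X i" "c i = ?cl y"
        using c unfolding is_hdecomp_def by auto
      ultimately show ?thesis
        using p[of y] p[OF x(1)] x(2) homog_closed[of y i] by (simp add: hcomp_of_homog)
    qed
    then have "c = (\<lambda>i. ?cl (hcomp X x i))" if "is_hdecomp ?Q C c" for c using that by blast
    ultimately show ?thesis by blast
  qed
  then show ?thesis
    by (intro rcomplex.intro rcomplex_axioms.intro quot_cplx_module sub)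
      (use homog_closed diff_degree in \<open>auto simp: Q.a_rcos_sum quot_cplx_smult quot_cplx_diff diff_add diff_smult
        diff_diff cl_zero[simplified]\<close>)
qed

lemma quot_cplx_proj: "chain_map R X (quot_cplx X Y) (\<lambda>x. Y +>\<^bsub>X\<^esub> x)"
  by (intro chain_map.intro chain_map_axioms.intro quot_cplx_rcomplex rcomplex_axioms)
    (auto simp: Q.a_rcos_sum quot_cplx_smult quot_cplx_diff)

end

section \<open>Quotients and modules of MDG algebras\<close>

text \<open>Used twice: for \<langle>A\<rangle> in the possibly nonassociative \<open>A\<close>, and
  for \<open>\<ss>\<close> in \<open>S\<close>.\<close>

locale mdg_ideal = mdg_algebra R A
  for R :: "('r, 'p) ring_scheme" and A :: "('r, 'a, 'm) graded_complex_scheme" +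
  fixes N :: "'a set"
  assumes N_subcomplex: "subcomplex R A N"
    and N_left: "\<And>a y. \<lbrakk>a \<in> carrier A; y \<in> N\<rbrakk> \<Longrightarrow> a \<otimes>\<^bsub>A\<^esub> y \<in> N"
    and N_right: "\<And>a y. \<lbrakk>a \<in> carrier A; y \<in> N\<rbrakk> \<Longrightarrow> y \<otimes>\<^bsub>A\<^esub> a \<in> N"
begin

sublocale N: subcomplex_of R A N
  by unfold_locales (rule N_subcomplex)

lemma act_minus_left:
  "\<lbrakk>a \<in> carrier A; b \<in> carrier A; c \<in> carrier A\<rbrakk>
    \<Longrightarrow> (a \<ominus>\<^bsub>A\<^esub> b) \<otimes>\<^bsub>A\<^esub> c = a \<otimes>\<^bsub>A\<^esub> c \<ominus>\<^bsub>A\<^esub> b \<otimes>\<^bsub>A\<^esub> c"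
  by (rule additive_map_minus[OF A.M.abelian_group_axioms A.M.abelian_group_axioms, of "\<lambda>a. a \<otimes>\<^bsub>A\<^esub> c"])
    (simp_all add: act_closed act_add_left)

lemma act_minus_right:
  "\<lbrakk>a \<in> carrier A; b \<in> carrier A; c \<in> carrier A\<rbrakk>
    \<Longrightarrow> c \<otimes>\<^bsub>A\<^esub> (a \<ominus>\<^bsub>A\<^esub> b) = c \<otimes>\<^bsub>A\<^esub> a \<ominus>\<^bsub>A\<^esub> c \<otimes>\<^bsub>A\<^esub> b"
  by (rule additive_map_minus[OF A.M.abelian_group_axioms A.M.abelian_group_axioms, of "\<lambda>a. c \<otimes>\<^bsub>A\<^esub> a"])
    (simp_all add: act_closed act_add_right)

text \<open>\<open>A\<close> is not assumed associative, so well-definedness is verified directly: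
  each factor is replaced in turn, and bilinearity with absorption keeps the change inside
  \<open>N\<close>.\<close>

lemma quot_mult:
  assumes a: "a \<in> carrier A" and b: "b \<in> carrier A"
  shows "rcoset_mult A N (N +>\<^bsub>A\<^esub> a) (N +>\<^bsub>A\<^esub> b) = N +>\<^bsub>A\<^esub> (a \<otimes>\<^bsub>A\<^esub> b)"
proof -
  have "(\<Union>y\<in>N +>\<^bsub>A\<^esub> b. N +>\<^bsub>A\<^esub> (x \<otimes>\<^bsub>A\<^esub> y)) = N +>\<^bsub>A\<^esub> (x \<otimes>\<^bsub>A\<^esub> b)" if x: "x \<in> carrier A" for x
    by (rule N.Q.UN_coset[OF b])
      (use x b N_left in \<open>simp add: N.Q.coset_eq_iff act_closed flip: act_minus_right\<close>)
  then have "rcoset_mult A N (N +>\<^bsub>A\<^esub> a) (N +>\<^bsub>A\<^esub> b) = (\<Union>x\<in>N +>\<^bsub>A\<^esub> a. N +>\<^bsub>A\<^esub> (x \<otimes>\<^bsub>A\<^esub> b))"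
    unfolding rcoset_mult_def using N.Q.a_elemrcos_carrier[OF a] by (intro SUP_cong) auto
  also have "\<dots> = N +>\<^bsub>A\<^esub> (a \<otimes>\<^bsub>A\<^esub> b)"
    by (rule N.Q.UN_coset[OF a])
      (use a b N_right in \<open>simp add: N.Q.coset_eq_iff act_closed flip: act_minus_left\<close>)
  finally show ?thesis .
qed

lemma quot_ksign: "x \<in> carrier A \<Longrightarrow> ksign (quot_cplx A N) i (N +>\<^bsub>A\<^esub> x) = N +>\<^bsub>A\<^esub> ksign A i x"
  by (rule chain_map.map_ksign[OF N.quot_cplx_proj, symmetric])

lemma quot_mdg_algebra: "mdg_algebra R (quot_cplx A N)"
proof -
  let ?Q = "quot_cplx A N"
  have one: "\<one>\<^bsub>A\<^esub> \<in> carrier A" using one_degree A.homog_closed by blast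
  have "chain_pairing R ?Q ?Q ?Q (mult ?Q)"
  proof (intro chain_pairing.intro chain_pairing_axioms.intro N.quot_cplx_rcomplex)
    fix i C D assume "C \<in> homog ?Q i" "D \<in> carrier ?Q"
    then obtain a b where ab: "a \<in> homog A i" "C = N +>\<^bsub>A\<^esub> a" "b \<in> carrier A" "D = N +>\<^bsub>A\<^esub> b" by auto
    have a: "a \<in> carrier A" using ab A.homog_closed by auto
    show "diff ?Q (C \<otimes>\<^bsub>?Q\<^esub> D) = diff ?Q C \<otimes>\<^bsub>?Q\<^esub> D \<oplus>\<^bsub>?Q\<^esub> ksign ?Q i (C \<otimes>\<^bsub>?Q\<^esub> diff ?Q D)"
      using a ab by (simp add: quot_mult N.quot_cplx_diff quot_ksign act_closed act_diff N.Q.a_rcos_sum)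
  next
    fix i j C D assume "C \<in> homog ?Q i" "D \<in> homog ?Q j"
    then show "C \<otimes>\<^bsub>?Q\<^esub> D \<in> homog ?Q (i + j)"
      using A.homog_closed act_degree by (auto simp: quot_mult)
  qed (auto simp: quot_mult N.Q.a_rcos_sum N.quot_cplx_smult act_closed act_add_left act_add_right
      act_smult_left act_smult_right)
  then show ?thesis
  proof (intro mdg_algebra.intro mdg_algebra_axioms.intro)
    fix i j C D assume "C \<in> homog ?Q i" "D \<in> homog ?Q j"
    then obtain a b where ab: "a \<in> homog A i" "C = N +>\<^bsub>A\<^esub> a" "b \<in> homog A j" "D = N +>\<^bsub>A\<^esub> b" by auto
    then have "a \<in> carrier A" "b \<in> carrier A" using A.homog_closed by auto
    then show "C \<otimes>\<^bsub>?Q\<^esub> D = ksign ?Q (i * j) (D \<otimes>\<^bsub>?Q\<^esub> C)"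
      using ab graded_comm[OF ab(1,3)] by (simp add: quot_mult quot_ksign act_closed)
  next
    fix i :: int and C assume "odd i" "C \<in> homog ?Q i"
    then show "C \<otimes>\<^bsub>?Q\<^esub> C = \<zero>\<^bsub>?Q\<^esub>"
      using odd_square A.homog_closed N.Q.coset_eq_zero_iff[of "\<zero>\<^bsub>A\<^esub>"] by (auto simp: quot_mult)
  qed (use one one_degree in \<open>auto simp: quot_mult one_left one_right\<close>)
qed

text \<open>Serves \<open>assoc_sub\<close>, which contains the associators, and
  \<open>\<ss>\<close>, where the associators of \<open>S\<close> are zero.\<close>

lemma quot_dg_algebra:
  assumes "\<And>a b c. \<lbrakk>a \<in> carrier A; b \<in> carrier A; c \<in> carrier A\<rbrakk>
    \<Longrightarrow> (a \<otimes>\<^bsub>A\<^esub> b) \<otimes>\<^bsub>A\<^esub> c \<ominus>\<^bsub>A\<^esub> a \<otimes>\<^bsub>A\<^esub> (b \<otimes>\<^bsub>A\<^esub> c) \<in> N"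
  shows "dg_algebra R (quot_cplx A N)"
proof (intro dg_algebra.intro dg_algebra_axioms.intro quot_mdg_algebra)
  fix C D E
  assume "C \<in> carrier (quot_cplx A N)" "D \<in> carrier (quot_cplx A N)" "E \<in> carrier (quot_cplx A N)"
  then obtain a b c where abc: "a \<in> carrier A" "b \<in> carrier A" "c \<in> carrier A"
    and eq: "C = N +>\<^bsub>A\<^esub> a" "D = N +>\<^bsub>A\<^esub> b" "E = N +>\<^bsub>A\<^esub> c" by auto
  have "N +>\<^bsub>A\<^esub> (a \<otimes>\<^bsub>A\<^esub> b) \<otimes>\<^bsub>A\<^esub> c = N +>\<^bsub>A\<^esub> a \<otimes>\<^bsub>A\<^esub> (b \<otimes>\<^bsub>A\<^esub> c)"
    using assms[OF abc] abc by (simp add: N.Q.coset_eq_iff act_closed)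
  then show "(C \<otimes>\<^bsub>quot_cplx A N\<^esub> D) \<otimes>\<^bsub>quot_cplx A N\<^esub> E
      = C \<otimes>\<^bsub>quot_cplx A N\<^esub> (D \<otimes>\<^bsub>quot_cplx A N\<^esub> E)"
    using abc by (simp add: eq quot_mult act_closed)
qed

end

text \<open>MDG modules carry no associativity law, so a unital chain map is enough to let
  \<open>A\<close> act on \<open>B\<close> through the product of \<open>B\<close>.\<close>

lemma mdg_module_via:
  assumes "mdg_algebra R A" "mdg_algebra R B" "chain_map R A B f" "f \<one>\<^bsub>A\<^esub> = \<one>\<^bsub>B\<^esub>"
  shows "mdg_module R A B (\<lambda>a x. f a \<otimes>\<^bsub>B\<^esub> x)"
proof -
  interpret A: mdg_algebra R A by fact
  interpret B: mdg_algebra R B by fact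
  interpret f: chain_map R A B f by fact
  have "chain_pairing R A B B (\<lambda>a x. f a \<otimes>\<^bsub>B\<^esub> x)"
  proof (intro chain_pairing.intro chain_pairing_axioms.intro A.A.rcomplex_axioms B.A.rcomplex_axioms)
    fix i a x assume "a \<in> homog A i" "x \<in> carrier B"
    then show "diff B (f a \<otimes>\<^bsub>B\<^esub> x) = f (diff A a) \<otimes>\<^bsub>B\<^esub> x \<oplus>\<^bsub>B\<^esub> ksign B i (f a \<otimes>\<^bsub>B\<^esub> diff B x)"
      using B.act_diff[OF f.map_degree] A.A.homog_closed by (simp add: f.map_diff)
  qed (simp_all add: f.map_closed f.map_add f.map_smult f.map_degree B.act_closed B.act_add_left
      B.act_add_right B.act_smult_left B.act_smult_right B.act_degree)
  then show ?thesis
    by (intro mdg_module.intro mdg_module_axioms.intro assms(1)) (simp_all add: assms(4) B.one_left)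
qed

lemma mdg_module_self:
  assumes "mdg_algebra R A"
  shows "mdg_module R A A (mult A)"
proof -
  interpret A: mdg_algebra R A by fact
  show ?thesis
    by (intro mdg_module.intro mdg_module_axioms.intro assms A.chain_pairing_axioms) (rule A.one_left)
qed

lemma dg_module_self:
  assumes "dg_algebra R A"
  shows "dg_module R A A (mult A)"
proof -
  interpret A: dg_algebra R A by fact
  show ?thesis
    by (intro dg_module.intro dg_module_axioms.intro mdg_module_self A.mdg_algebra_axioms assms) (rule A.assoc)
qed

lemma dg_module_via:
  assumes "dg_algebra_hom R A B f"
  shows "dg_module R A B (\<lambda>a x. f a \<otimes>\<^bsub>B\<^esub> x)"
proof -
  interpret f: dg_algebra_hom R A B f by fact
  show ?thesis
  proof (intro dg_module.intro dg_module_axioms.intro f.dom.dg_algebra_axioms)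
    show "mdg_module R A B (\<lambda>a x. f a \<otimes>\<^bsub>B\<^esub> x)"
      by (rule mdg_module_via[OF f.dom.mdg_algebra_axioms f.cod.mdg_algebra_axioms f.chain_map_axioms f.hom_one])
  qed (simp add: f.hom_mult f.map_closed f.cod.assoc)
qed

lemma dg_module_hom_via:
  assumes "dg_algebra_hom R A B f"
  shows "dg_module_hom R A A (mult A) B (\<lambda>a x. f a \<otimes>\<^bsub>B\<^esub> x) f"
proof -
  interpret f: dg_algebra_hom R A B f by fact
  note A = dg_module_self[OF f.dom.dg_algebra_axioms] and B = dg_module_via[OF assms]
  show ?thesis
    by (intro dg_module_hom.intro mdg_module_hom.intro mdg_module_hom_axioms.intro A B
        dg_module.axioms(2)[OF A] dg_module.axioms(2)[OF B] f.chain_map_axioms)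
      (rule f.hom_mult)
qed

lemma dg_module_sub:
  assumes "dg_algebra R A" "subcomplex R A Y" "\<And>a y. \<lbrakk>a \<in> carrier A; y \<in> Y\<rbrakk> \<Longrightarrow> a \<otimes>\<^bsub>A\<^esub> y \<in> Y"
  shows "dg_module_hom R A (sub_cplx A Y) (mult A) A (mult A) (\<lambda>x. x)"
proof -
  interpret A: dg_algebra R A by fact
  interpret Y: subcomplex_of R A Y by unfold_locales fact
  interpret YC: rcomplex R "sub_cplx A Y" by (rule Y.sub_cplx_rcomplex)
  have ks: "ksign (sub_cplx A Y) i y = ksign A i y" if "y \<in> Y" for i y
    using chain_map.map_ksign[OF Y.sub_cplx_incl, of y i] that by simp
  have "chain_pairing R A (sub_cplx A Y) (sub_cplx A Y) (mult A)"
    by (intro chain_pairing.intro chain_pairing_axioms.intro A.A.rcomplex_axioms YC.rcomplex_axioms)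
      (use Y.Y_closed Y.Y_diff assms(3) A.A.homog_closed in \<open>auto simp: A.act_add_left
        A.act_add_right A.act_smult_left A.act_smult_right A.act_degree A.act_diff ks\<close>)
  then have m: "mdg_module R A (sub_cplx A Y) (mult A)"
    by (intro mdg_module.intro mdg_module_axioms.intro A.mdg_algebra_axioms)
      (use Y.Y_closed in \<open>simp_all add: A.one_left\<close>)
  have d: "dg_module R A (sub_cplx A Y) (mult A)"
    by (intro dg_module.intro dg_module_axioms.intro m A.dg_algebra_axioms)
      (use Y.Y_closed in \<open>simp_all add: A.assoc\<close>)
  note s = dg_module_self[OF assms(1)]
  show ?thesis
    by (intro dg_module_hom.intro mdg_module_hom.intro mdg_module_hom_axioms.intro d s m
        dg_module.axioms(2)[OF s] Y.sub_cplx_incl) simp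
qed

lemma dg_algebra_hom_factor:
  assumes p: "dg_algebra_hom R S B p" and q: "dg_algebra_hom R S C q"
    and surj: "p ` carrier S = carrier B"
    and ker: "\<And>x. \<lbrakk>x \<in> carrier S; p x = \<zero>\<^bsub>B\<^esub>\<rbrakk> \<Longrightarrow> q x = \<zero>\<^bsub>C\<^esub>"
  obtains f where "dg_algebra_hom R B C f" "\<And>x. x \<in> carrier S \<Longrightarrow> f (p x) = q x"
proof -
  interpret p: dg_algebra_hom R S B p by fact
  interpret q: dg_algebra_hom R S C q by fact
  have "q x = q y" if xy: "x \<in> carrier S" "y \<in> carrier S" "p x = p y" for x y
  proof -
    have "p (x \<ominus>\<^bsub>S\<^esub> y) = \<zero>\<^bsub>B\<^esub>"
      using xy by (simp add: p.map_minus p.cod.A.M.minus_eq_zero_iff p.map_closed)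
    then have "q (x \<ominus>\<^bsub>S\<^esub> y) = \<zero>\<^bsub>C\<^esub>" using xy by (intro ker) simp_all
    then show ?thesis using xy by (simp add: q.map_minus q.cod.A.M.minus_eq_zero_iff q.map_closed)
  qed
  then obtain f where f: "\<And>x. x \<in> carrier S \<Longrightarrow> f (p x) = q x"
    using factor_through_image[of "carrier S" p q] by blast
  have lift: "\<exists>x\<in>carrier S. y = p x" if "y \<in> carrier B" for y using surj that by auto
  have "chain_map R B C f"
  proof (intro chain_map.intro chain_map_axioms.intro p.cod.A.rcomplex_axioms q.cod.A.rcomplex_axioms)
    fix i y assume y: "y \<in> homog B i"
    then obtain x where x: "x \<in> carrier S" "y = p x" using lift p.cod.A.homog_closed by blast
    \<comment> \<open>An arbitrary preimage of a homogeneous \<open>y\<close> is replaced by its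
      component of the same degree, which is again a preimage.\<close>
    have "y = p (hcomp S x i)"
      using p.map_hcomp[OF x(1), of i] x(2) p.cod.A.hcomp_of_homog[OF y, of i] by simp
    then show "f y \<in> homog C i" using x f q.map_degree[OF p.dom.A.hcomp_homog[OF x(1)]] by simp
  next
    fix y assume "y \<in> carrier B"
    then obtain x where "x \<in> carrier S" "y = p x" using lift by blast
    then show "f y \<in> carrier C" "f (diff B y) = diff C (f y)"
      using f q.map_closed by (simp_all add: q.map_diff flip: p.map_diff)
  next
    fix y y' assume "y \<in> carrier B" "y' \<in> carrier B"
    then obtain x x' where "x \<in> carrier S" "y = p x" "x' \<in> carrier S" "y' = p x'" using lift by blast
    then show "f (y \<oplus>\<^bsub>B\<^esub> y') = f y \<oplus>\<^bsub>C\<^esub> f y'" using f by (simp add: q.map_add flip: p.map_add)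
  next
    fix r y assume "r \<in> carrier R" "y \<in> carrier B"
    then obtain x where "x \<in> carrier S" "y = p x" "r \<in> carrier R" using lift by blast
    then show "f (r \<odot>\<^bsub>B\<^esub> y) = r \<odot>\<^bsub>C\<^esub> f y" using f by (simp add: q.map_smult flip: p.map_smult)
  qed
  then have "dg_algebra_hom R B C f"
  proof (intro dg_algebra_hom.intro dg_algebra_hom_axioms.intro p.cod.dg_algebra_axioms q.cod.dg_algebra_axioms)
    have "\<one>\<^bsub>S\<^esub> \<in> carrier S" using p.dom.one_degree p.dom.A.homog_closed by blast
    then show "f \<one>\<^bsub>B\<^esub> = \<one>\<^bsub>C\<^esub>" using f p.hom_one q.hom_one by metis
    fix y y' assume "y \<in> carrier B" "y' \<in> carrier B"
    then obtain x x' where "x \<in> carrier S" "y = p x" "x' \<in> carrier S" "y' = p x'" using lift by blast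
    then show "f (y \<otimes>\<^bsub>B\<^esub> y') = f y \<otimes>\<^bsub>C\<^esub> f y'"
      using f p.dom.act_closed by (simp add: q.hom_mult flip: p.hom_mult)
  qed
  then show ?thesis using that f by blast
qed

section \<open>DG algebra homomorphisms out of the symmetric algebra\<close>

lemma dg_algebra_ralgebra:
  assumes "dg_algebra R B"
  shows "ralgebra R B"
proof -
  interpret B: dg_algebra R B by fact
  have "\<one>\<^bsub>B\<^esub> \<in> carrier B" using B.one_degree B.A.homog_closed by blast
  then have "Group.monoid B"
    by (intro monoidI) (simp_all add: B.act_closed B.assoc B.one_left B.one_right)
  then have "ring B"
    by (intro ringI B.A.M.abelian_group_axioms) (simp_all add: B.act_add_left B.act_add_right)
  then show ?thesis
    by (intro ralgebra.intro ralgebra_axioms.intro B.A.module_axioms)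
      (simp_all add: B.act_smult_left B.act_smult_right)
qed

lemma dg_algebra_hom_cong:
  assumes "dg_algebra_hom R B C f" "\<And>x. x \<in> carrier B \<Longrightarrow> g x = f x"
  shows "dg_algebra_hom R B C g"
proof -
  interpret f: dg_algebra_hom R B C f by fact
  have "\<one>\<^bsub>B\<^esub> \<in> carrier B" using f.dom.one_degree f.dom.A.homog_closed by blast
  then show ?thesis
    by (intro dg_algebra_hom.intro dg_algebra_hom_axioms.intro f.dom.dg_algebra_axioms
        f.cod.dg_algebra_axioms chain_map_cong[OF f.chain_map_axioms assms(2)])
      (simp_all add: assms(2) f.hom_one f.hom_mult f.dom.act_closed)
qed

lemma chain_map_comp:
  assumes "chain_map R X Y f" "chain_map R Y Z g"
  shows "chain_map R X Z (\<lambda>x. g (f x))"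
proof -
  interpret f: chain_map R X Y f by fact
  interpret g: chain_map R Y Z g by fact
  show ?thesis
    by (intro chain_map.intro chain_map_axioms.intro f.X.rcomplex_axioms g.Y.rcomplex_axioms)
      (simp_all add: f.map_closed g.map_closed f.map_add g.map_add f.map_smult g.map_smult
        f.map_degree g.map_degree f.map_diff g.map_diff)
qed

context centered_complex
begin

lemma sym_incl_chain_map: "chain_map R A S \<iota>"
  by (intro chain_map.intro chain_map_axioms.intro rcomplex_axioms S.A.rcomplex_axioms)
    (simp_all add: sym_incl_add sym_incl_smult sym_incl_homog homog_sym_dg sym_diff_incl)

lemma sym_dg_hom_unique:
  assumes f: "dg_algebra_hom R S B f" and g: "dg_algebra_hom R S B g"
    and eq: "\<And>a. a \<in> carrier A \<Longrightarrow> f (\<iota> a) = g (\<iota> a)" and x: "x \<in> carrier S"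
  shows "f x = g x"
proof -
  interpret f: dg_algebra_hom R S B f by fact
  interpret g: dg_algebra_hom R S B g by fact
  from x show ?thesis
  proof (induction x rule: sym_dg_induct)
    case (incl i a x)
    then have "a \<in> carrier A" using homog_closed by blast
    then show ?case using incl eq by (simp add: f.hom_mult g.hom_mult)
  qed (simp_all add: f.hom_one g.hom_one f.map_add g.map_add f.map_smult g.map_smult)
qed

text \<open>Graded commutativity of \<open>B\<close> supplies the relations. Compatibility with the
  differentials passes from generators to products because both sides obey the Leibniz rule.\<close>

theorem sym_dg_universal:
  assumes "dg_algebra R B" "chain_map R A B f" "f \<one>\<^bsub>A\<^esub> = \<one>\<^bsub>B\<^esub>"
  obtains \<Phi> where "dg_algebra_hom R S B \<Phi>" "\<And>a. a \<in> carrier A \<Longrightarrow> \<Phi> (\<iota> a) = f a"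
proof -
  interpret B: dg_algebra R B by fact
  interpret B': ralgebra R B by (rule dg_algebra_ralgebra) fact
  interpret f: chain_map R A B f by fact
  define c where "c r = r \<odot>\<^bsub>B\<^esub> \<one>\<^bsub>B\<^esub>" for r
  have c_hom: "c \<in> ring_hom R B"
    by (rule ring_hom_memI)
      (auto simp: c_def B.A.smult_l_distr B'.smult_mult_left B.A.smult_assoc1)
  obtain \<Phi> where \<Phi>: "\<Phi> \<in> ring_hom S B"
    and \<Phi>_smult: "\<And>r x. \<lbrakk>r \<in> carrier R; x \<in> carrier S\<rbrakk> \<Longrightarrow> \<Phi> (r \<odot>\<^bsub>S\<^esub> x) = c r \<otimes>\<^bsub>B\<^esub> \<Phi> x"
    and \<Phi>_incl: "\<And>a. a \<in> carrier A \<Longrightarrow> \<Phi> (\<iota> a) = f a"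
  proof (rule sym_dg_lift[OF B'.X.ring_axioms c_hom])
    fix \<Phi> assume "\<Phi> \<in> ring_hom S B"
      "\<And>r x. \<lbrakk>r \<in> carrier R; x \<in> carrier S\<rbrakk> \<Longrightarrow> \<Phi> (r \<odot>\<^bsub>S\<^esub> x) = c r \<otimes>\<^bsub>B\<^esub> \<Phi> x"
      "\<And>a. a \<in> carrier A \<Longrightarrow> \<Phi> (\<iota> a) = f a"
    then show thesis by (rule that)
  next
    fix i j a b assume "a \<in> homog A i" "b \<in> homog A j"
    then show "f a \<otimes>\<^bsub>B\<^esub> f b = ksign B (i * j) (f b \<otimes>\<^bsub>B\<^esub> f a)"
      by (intro B.graded_comm f.map_degree)
  next
    fix i :: int and a assume "odd i" "a \<in> homog A i"
    then show "f a \<otimes>\<^bsub>B\<^esub> f a = \<zero>\<^bsub>B\<^esub>" by (intro B.odd_square f.map_degree)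
  qed (simp_all add: c_def B'.smult_mult_left B'.smult_mult_right f.map_closed f.map_add f.map_smult assms(3))
  have \<Phi>_closed: "\<Phi> x \<in> carrier B" if "x \<in> carrier S" for x using ring_hom_closed[OF \<Phi> that] .
  have \<Phi>_smult': "\<Phi> (r \<odot>\<^bsub>S\<^esub> x) = r \<odot>\<^bsub>B\<^esub> \<Phi> x" if "r \<in> carrier R" "x \<in> carrier S" for r x
    using that \<Phi>_closed by (simp add: \<Phi>_smult c_def B'.smult_mult_left)
  have \<Phi>_ksign: "\<Phi> (ksign S i x) = ksign B i (\<Phi> x)" if "x \<in> carrier S" for i x
    by (rule ring_hom_ksign[OF S.X.ring_axioms B'.X.ring_axioms \<Phi> that])
  have "chain_map R S B \<Phi>"
  proof (intro chain_map.intro chain_map_axioms.intro S.A.rcomplex_axioms B.A.rcomplex_axioms)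
    show "\<Phi> x \<in> homog B i" if "x \<in> homog S i" for i x
      using that unfolding homog_sym_dg
    proof (induction rule: sym_homog_induct)
      case zero
      then show ?case using ring_hom_zero[OF \<Phi> S.X.ring_axioms B'.X.ring_axioms] by simp
    next
      case (incl n a i x)
      then show ?case
        using sym_homog_closed homog_closed[OF incl(2)] f.map_degree[OF incl(2)]
        by (simp add: ring_hom_mult[OF \<Phi>] \<Phi>_incl B.act_degree)
    qed (use sym_homog_closed in \<open>auto simp: ring_hom_add[OF \<Phi>] \<Phi>_smult' ring_hom_one[OF \<Phi>]
        B.A.homog_add B.A.homog_smult B.one_degree\<close>)
    show "\<Phi> (diff S x) = diff B (\<Phi> x)" if "x \<in> carrier S" for x
      using that
    proof (induction x rule: sym_dg_induct)
      case one
      have "diff A \<one>\<^bsub>A\<^esub> = \<zero>\<^bsub>A\<^esub>"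
        using diff_degree[OF one_homog] homog_neg_degree[of "-1"] by simp
      then have "diff B \<one>\<^bsub>B\<^esub> = \<zero>\<^bsub>B\<^esub>"
        using f.map_diff[of "\<one>\<^bsub>A\<^esub>"] f.map_zero by (simp add: assms(3))
      then show ?case
        using ring_hom_zero[OF \<Phi> S.X.ring_axioms B'.X.ring_axioms]
        by (simp add: sym_diff_one ring_hom_one[OF \<Phi>])
    next
      case (incl i a x)
      have a: "a \<in> carrier A" using incl homog_closed by blast
      show ?case
        using incl a f.map_degree[OF incl(2)]
        by (simp add: sym_dg_leibniz[OF sym_incl_homog[OF incl(2)]] sym_diff_incl
            ring_hom_add[OF \<Phi>] ring_hom_mult[OF \<Phi>] \<Phi>_ksign \<Phi>_incl f.map_diff \<Phi>_closed
            B.act_diff[OF f.map_degree[OF incl(2)]])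
    qed (simp_all add: sym_diff_add sym_diff_smult ring_hom_add[OF \<Phi>] \<Phi>_smult' \<Phi>_closed
        B.A.diff_add B.A.diff_smult)
  qed (simp_all add: \<Phi>_closed ring_hom_add[OF \<Phi>] \<Phi>_smult')
  then have "dg_algebra_hom R S B \<Phi>"
    by (intro dg_algebra_hom.intro dg_algebra_hom_axioms.intro sym_dg_algebra assms(1))
      (simp_all add: ring_hom_one[OF \<Phi>] ring_hom_mult[OF \<Phi>])
  then show ?thesis using that \<Phi>_incl by blast
qed

lemma sym_incl_image_subcomplex: "subcomplex R S (\<iota> ` carrier A)"
  by (rule chain_map.image_subcomplex[OF sym_incl_chain_map subcomplex_carrier])

end

section \<open>The maximal associative quotient and the ideal of multiplication defects\<close>

locale centered_mdg = centered_complex R A + mdg_algebra R A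
  for R :: "('r, 'p) ring_scheme" and A :: "('r, 'a, 'm) graded_complex_scheme"
begin

abbreviation "N \<equiv> assoc_sub R A"
abbreviation "Aas \<equiv> max_assoc R A"
abbreviation "q \<equiv> max_assoc_proj R A"
abbreviation "\<ss> \<equiv> mult_ideal R A"

lemma assoc_sub_ideal:
  shows assoc_sub_subcomplex: "subcomplex R A N"
    and associators_assoc_sub: "associators A \<subseteq> N"
    and assoc_sub_left: "\<lbrakk>a \<in> carrier A; y \<in> N\<rbrakk> \<Longrightarrow> a \<otimes>\<^bsub>A\<^esub> y \<in> N"
    and assoc_sub_right: "\<lbrakk>a \<in> carrier A; y \<in> N\<rbrakk> \<Longrightarrow> y \<otimes>\<^bsub>A\<^esub> a \<in> N"
proof -
  let ?P = "\<lambda>Y. subcomplex R A Y \<and> associators A \<subseteq> Y \<and>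
     (\<forall>a\<in>carrier A. \<forall>y\<in>Y. a \<otimes>\<^bsub>A\<^esub> y \<in> Y \<and> y \<otimes>\<^bsub>A\<^esub> a \<in> Y)"
  \<comment> \<open>The whole of \<open>A\<close> belongs to the family that is intersected, so the
    intersection lies in the carrier. Each required closure property survives intersections.\<close>
  have carr: "?P (carrier A)"
    using subcomplex_carrier by (auto simp: associators_def act_closed)
  have mem: "y \<in> N \<longleftrightarrow> (\<forall>Y. ?P Y \<longrightarrow> y \<in> Y)" for y by (auto simp: assoc_sub_def)
  have sub: "submodule N R A"
  proof (rule submoduleI_smult)
    show "N \<subseteq> carrier A" using carr mem by blast
    show "\<zero>\<^bsub>A\<^esub> \<in> N" unfolding mem subcomplex_def using submodule_zero by blast
    show "a \<oplus>\<^bsub>A\<^esub> b \<in> N" if "a \<in> N" "b \<in> N" for a b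
      using that unfolding mem subcomplex_def using submoduleE(5) by blast
    show "r \<odot>\<^bsub>A\<^esub> a \<in> N" if "r \<in> carrier R" "a \<in> N" for r a
      using that unfolding mem subcomplex_def using submoduleE(4) by blast
  qed
  show "subcomplex R A N"
    unfolding subcomplex_def
  proof (intro conjI ballI allI sub)
    show "hcomp A y i \<in> N" if "y \<in> N" for y i
      using that unfolding mem subcomplex_def by blast
    show "diff A y \<in> N" if "y \<in> N" for y
      using that unfolding mem subcomplex_def by blast
  qed
  show "associators A \<subseteq> N" "\<lbrakk>a \<in> carrier A; y \<in> N\<rbrakk> \<Longrightarrow> a \<otimes>\<^bsub>A\<^esub> y \<in> N"
    "\<lbrakk>a \<in> carrier A; y \<in> N\<rbrakk> \<Longrightarrow> y \<otimes>\<^bsub>A\<^esub> a \<in> N"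
    unfolding mem subset_iff by blast+
qed

lemma assoc_sub_least:
  assumes "subcomplex R A Y" "associators A \<subseteq> Y"
    "\<And>a y. \<lbrakk>a \<in> carrier A; y \<in> Y\<rbrakk> \<Longrightarrow> a \<otimes>\<^bsub>A\<^esub> y \<in> Y \<and> y \<otimes>\<^bsub>A\<^esub> a \<in> Y"
  shows "N \<subseteq> Y"
  using assms unfolding assoc_sub_def by blast

sublocale N: mdg_ideal R A N
  by (intro mdg_ideal.intro mdg_ideal_axioms.intro mdg_algebra_axioms assoc_sub_subcomplex
      assoc_sub_left assoc_sub_right)

lemma max_assoc_dg: "dg_algebra R Aas"
  unfolding max_assoc_def
  by (rule N.quot_dg_algebra) (use associators_assoc_sub in \<open>auto simp: associators_def\<close>)

lemma max_assoc_proj_chain_map: "chain_map R A Aas q"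
  using N.N.quot_cplx_proj unfolding max_assoc_def max_assoc_proj_def[abs_def] .

lemma max_assoc_proj_one: "q \<one>\<^bsub>A\<^esub> = \<one>\<^bsub>Aas\<^esub>"
  by (simp add: max_assoc_def max_assoc_proj_def)

lemma max_assoc_proj_mult:
  "\<lbrakk>a \<in> carrier A; b \<in> carrier A\<rbrakk> \<Longrightarrow> q (a \<otimes>\<^bsub>A\<^esub> b) = q a \<otimes>\<^bsub>Aas\<^esub> q b"
  by (simp add: max_assoc_def max_assoc_proj_def N.quot_mult)

lemma max_assoc_proj_zero_iff: "a \<in> carrier A \<Longrightarrow> q a = \<zero>\<^bsub>Aas\<^esub> \<longleftrightarrow> a \<in> N"
  by (simp add: max_assoc_def max_assoc_proj_def N.N.Q.coset_eq_zero_iff)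

lemma max_assoc_proj_surj: "q ` carrier A = carrier Aas"
  by (simp add: max_assoc_def max_assoc_proj_def[abs_def])

lemma is_pi_as_ex1: "\<exists>!\<pi>. is_pi_as R A \<pi>"
proof -
  obtain \<Phi> where \<Phi>: "dg_algebra_hom R S Aas \<Phi>" "\<And>a. a \<in> carrier A \<Longrightarrow> \<Phi> (\<iota> a) = q a"
    by (rule sym_dg_universal[OF max_assoc_dg max_assoc_proj_chain_map max_assoc_proj_one]) (rule that)
  show ?thesis
  proof
    show "is_pi_as R A (restrict \<Phi> (carrier S))"
      using \<Phi> dg_algebra_hom_cong[OF \<Phi>(1), of "restrict \<Phi> (carrier S)"] by (simp add: is_pi_as_def)
    fix \<pi> assume \<pi>: "is_pi_as R A \<pi>"
    show "\<pi> = restrict \<Phi> (carrier S)"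
    proof (rule extensionalityI[of _ "carrier S"])
      show "\<pi> \<in> extensional (carrier S)" using \<pi> by (simp add: is_pi_as_def)
      fix x assume x: "x \<in> carrier S"
      have "\<pi> x = \<Phi> x"
        by (rule sym_dg_hom_unique[OF _ \<Phi>(1) _ x]) (use \<pi> \<Phi>(2) in \<open>simp_all add: is_pi_as_def\<close>)
      then show "\<pi> x = restrict \<Phi> (carrier S) x" using x by simp
    qed simp
  qed
qed

abbreviation "\<pi> \<equiv> pi_as R A"

lemma pi_as_spec: "is_pi_as R A \<pi>"
  unfolding pi_as_def by (rule theI'[OF is_pi_as_ex1])

lemma pi_as_hom: "dg_algebra_hom R S Aas \<pi>"
  and pi_as_incl: "a \<in> carrier A \<Longrightarrow> \<pi> (\<iota> a) = q a"
  using pi_as_spec by (simp_all add: is_pi_as_def)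

sublocale pi: dg_algebra_hom R S Aas \<pi>
  by (rule pi_as_hom)

lemma pi_as_surj: "\<pi> ` carrier S = carrier Aas"
proof
  show "\<pi> ` carrier S \<subseteq> carrier Aas" using pi.map_closed by auto
  show "carrier Aas \<subseteq> \<pi> ` carrier S"
    unfolding max_assoc_proj_surj[symmetric] by (auto simp flip: pi_as_incl)
qed

section \<open>The ideal \<open>\<ss>\<close> generated by the defects [a, b]\<close>

definition mdefect :: "'a \<Rightarrow> 'a \<Rightarrow> ('r, 'a) symm" where
  "mdefect a b = \<iota> (a \<otimes>\<^bsub>A\<^esub> b) \<ominus>\<^bsub>S\<^esub> \<iota> a \<otimes>\<^bsub>S\<^esub> \<iota> b"

abbreviation "mdefects \<equiv> {mdefect a b | a b. a \<in> carrier A \<and> b \<in> carrier A}"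

lemma mult_ideal_eq: "\<ss> = Idl\<^bsub>S\<^esub> mdefects"
  by (simp add: mult_ideal_def Let_def mdefect_def)

lemma mdefect_closed [simp]: "\<lbrakk>a \<in> carrier A; b \<in> carrier A\<rbrakk> \<Longrightarrow> mdefect a b \<in> carrier S"
  by (simp add: mdefect_def act_closed)

lemma mdefect_add_left:
  "\<lbrakk>a \<in> carrier A; a' \<in> carrier A; b \<in> carrier A\<rbrakk>
    \<Longrightarrow> mdefect (a \<oplus>\<^bsub>A\<^esub> a') b = mdefect a b \<oplus>\<^bsub>S\<^esub> mdefect a' b"
  by (simp add: mdefect_def act_closed act_add_left sym_incl_add S.X.l_distr a_minus_def S.M.minus_add S.M.a_ac)

lemma mdefect_add_right:
  "\<lbrakk>a \<in> carrier A; b \<in> carrier A; b' \<in> carrier A\<rbrakk>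
    \<Longrightarrow> mdefect a (b \<oplus>\<^bsub>A\<^esub> b') = mdefect a b \<oplus>\<^bsub>S\<^esub> mdefect a b'"
  by (simp add: mdefect_def act_closed act_add_right sym_incl_add S.X.r_distr a_minus_def S.M.minus_add S.M.a_ac)

lemma mdefect_zero:
  assumes "a \<in> carrier A"
  shows "mdefect \<zero>\<^bsub>A\<^esub> a = \<zero>\<^bsub>S\<^esub>" "mdefect a \<zero>\<^bsub>A\<^esub> = \<zero>\<^bsub>S\<^esub>"
proof -
  show "mdefect \<zero>\<^bsub>A\<^esub> a = \<zero>\<^bsub>S\<^esub>"
    by (rule additive_map_zero[OF M.abelian_group_axioms S.M.abelian_group_axioms, of "\<lambda>b. mdefect b a"])
      (use assms mdefect_add_left in auto)
  show "mdefect a \<zero>\<^bsub>A\<^esub> = \<zero>\<^bsub>S\<^esub>"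
    by (rule additive_map_zero[OF M.abelian_group_axioms S.M.abelian_group_axioms, of "mdefect a"])
      (use assms mdefect_add_right in auto)
qed

lemma mult_ideal_ideal: "ideal \<ss> S"
  unfolding mult_ideal_eq by (rule S.X.genideal_ideal) auto

sublocale ss: ideal \<ss> S
  by (rule mult_ideal_ideal)

lemma mult_ideal_submodule: "submodule \<ss> R S"
  by (rule S.ideal_submodule[OF mult_ideal_ideal])

lemma mdefect_mem: "\<lbrakk>a \<in> carrier A; b \<in> carrier A\<rbrakk> \<Longrightarrow> mdefect a b \<in> \<ss>"
  unfolding mult_ideal_eq by (rule subsetD[OF S.X.genideal_self]) auto

lemma mult_ideal_least:
  assumes "ideal I S" "\<And>a b. \<lbrakk>a \<in> carrier A; b \<in> carrier A\<rbrakk> \<Longrightarrow> mdefect a b \<in> I"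
  shows "\<ss> \<subseteq> I"
  unfolding mult_ideal_eq by (rule S.X.genideal_minimal) (use assms in auto)

lemma mdefect_homog:
  assumes "a \<in> homog A i" "b \<in> homog A j"
  shows "mdefect a b \<in> homog S (i + j)"
proof -
  have "\<iota> (a \<otimes>\<^bsub>A\<^esub> b) \<in> homog S (i + j)" "\<iota> a \<otimes>\<^bsub>S\<^esub> \<iota> b \<in> homog S (i + j)"
    unfolding homog_sym_dg using assms
    by (auto intro: sym_incl_homog act_degree sym_homog_mult)
  then show ?thesis
    unfolding mdefect_def by (rule S.submodule_minus[OF S.A.homog_submodule])
qed

text \<open>Both products obey the same Leibniz rule, hence so does their difference: the
  differential of a defect is a combination of defects.\<close>

lemma mdefect_diff:
  assumes "a \<in> homog A i" "b \<in> carrier A"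
  shows "diff S (mdefect a b) = mdefect (diff A a) b \<oplus>\<^bsub>S\<^esub> ksign S i (mdefect a (diff A b))"
proof -
  have a: "a \<in> carrier A" using assms homog_closed by blast
  have "diff S (mdefect a b) = \<iota> (diff A a \<otimes>\<^bsub>A\<^esub> b \<oplus>\<^bsub>A\<^esub> ksign A i (a \<otimes>\<^bsub>A\<^esub> diff A b))
      \<ominus>\<^bsub>S\<^esub> (\<iota> (diff A a) \<otimes>\<^bsub>S\<^esub> \<iota> b \<oplus>\<^bsub>S\<^esub> ksign S i (\<iota> a \<otimes>\<^bsub>S\<^esub> \<iota> (diff A b)))"
    using a assms(2) unfolding mdefect_def
    by (simp add: S.A.diff_minus act_closed sym_diff_incl act_diff[OF assms(1)]
        sym_dg_leibniz[OF sym_incl_homog[OF assms(1)]])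
  then show ?thesis
    using a assms(2)
    by (simp add: mdefect_def act_closed sym_incl_add sym_incl_ksign ksign_def a_minus_def
        sym_incl_neg S.M.minus_add S.M.a_ac)
qed

text \<open>An ideal generated by homogeneous elements is homogeneous; the differential is carried along.\<close>

lemma mult_ideal_components:
  assumes "x \<in> \<ss>"
  shows "hcomp S x i \<in> \<ss>" "diff S (hcomp S x i) \<in> \<ss>"
proof -
  \<comment> \<open>The differential is controlled on the components, not on \<open>x\<close>
    itself, because the Leibniz rule asks for a homogeneous left factor. It remains to show that
    \<open>?H\<close> is an ideal containing the defects.\<close>
  let ?H = "{x \<in> carrier S. \<forall>i. hcomp S x i \<in> \<ss> \<and> diff S (hcomp S x i) \<in> \<ss>}"
  have H_sub: "submodule ?H R S"
    by (rule S.submoduleI_smult)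
      (use S.submoduleE(4,5)[OF mult_ideal_submodule] S.submodule_zero[OF mult_ideal_submodule]
          S.A.hcomp_of_homog[of "\<zero>\<^bsub>S\<^esub>" 0]
        in \<open>auto simp: S.A.hcomp_add S.A.hcomp_smult sym_diff_add sym_diff_smult sym_diff_zero\<close>)
  have H_homog: "x \<in> ?H" if "x \<in> homog S i" "x \<in> \<ss>" "diff S x \<in> \<ss>" for x i
    using that S.A.homog_closed by (auto simp: S.A.hcomp_of_homog sym_diff_zero)
  \<comment> \<open>For homogeneous \<open>s\<close> the product is expanded along the components of
    \<open>x\<close>; each term is homogeneous, and its differential stays in \<open>\<ss>\<close>
    since both the component and its differential do.\<close>
  have left: "s \<otimes>\<^bsub>S\<^esub> x \<in> ?H" and right: "x \<otimes>\<^bsub>S\<^esub> s \<in> ?H" if s: "s \<in> homog S j" and x: "x \<in> ?H" for s x j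
  proof -
    have sc: "s \<in> carrier S" using s S.A.homog_closed by blast
    have xc: "x \<in> carrier S" using x by simp
    let ?I = "{i. hcomp S x i \<noteq> \<zero>\<^bsub>S\<^esub>}"
    have xi: "hcomp S x i \<in> carrier S" "hcomp S x i \<in> homog S i" "hcomp S x i \<in> \<ss>"
      "diff S (hcomp S x i) \<in> \<ss>" for i
      using x S.A.hcomp_homog[OF xc] by auto
    have "s \<otimes>\<^bsub>S\<^esub> hcomp S x i \<in> ?H" for i
    proof (rule H_homog)
      show "s \<otimes>\<^bsub>S\<^esub> hcomp S x i \<in> homog S (j + i)" by (rule S.act_degree[OF s xi(2)])
      show "s \<otimes>\<^bsub>S\<^esub> hcomp S x i \<in> \<ss>" using xi sc by (intro ss.I_l_closed)
      show "diff S (s \<otimes>\<^bsub>S\<^esub> hcomp S x i) \<in> \<ss>"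
        using xi sc by (simp add: S.act_diff[OF s] ksign_def ss.I_l_closed)
    qed
    then have "finsum S (\<lambda>i. s \<otimes>\<^bsub>S\<^esub> hcomp S x i) ?I \<in> ?H" by (rule S.submodule_finsum[OF H_sub])
    then show "s \<otimes>\<^bsub>S\<^esub> x \<in> ?H"
      using S.X.finsum_rdistr[of ?I s "hcomp S x"] S.A.hcomp_finite[OF xc] S.A.hcomp_finsum[OF xc] sc xi(1)
      by simp
    have "hcomp S x i \<otimes>\<^bsub>S\<^esub> s \<in> ?H" for i
    proof (rule H_homog)
      show "hcomp S x i \<otimes>\<^bsub>S\<^esub> s \<in> homog S (i + j)" by (rule S.act_degree[OF xi(2) s])
      show "hcomp S x i \<otimes>\<^bsub>S\<^esub> s \<in> \<ss>" using xi sc by (intro ss.I_r_closed)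
      show "diff S (hcomp S x i \<otimes>\<^bsub>S\<^esub> s) \<in> \<ss>"
        using xi sc by (simp add: S.act_diff[OF xi(2)] ksign_def ss.I_r_closed)
    qed
    then have "finsum S (\<lambda>i. hcomp S x i \<otimes>\<^bsub>S\<^esub> s) ?I \<in> ?H" by (rule S.submodule_finsum[OF H_sub])
    then show "x \<otimes>\<^bsub>S\<^esub> s \<in> ?H"
      using S.X.finsum_ldistr[of ?I s "hcomp S x"] S.A.hcomp_finite[OF xc] S.A.hcomp_finsum[OF xc] sc xi(1)
      by simp
  qed
  have mult: "s \<otimes>\<^bsub>S\<^esub> x \<in> ?H \<and> x \<otimes>\<^bsub>S\<^esub> s \<in> ?H" if s: "s \<in> carrier S" and x: "x \<in> ?H" for s x
    using s
  proof (induction s rule: S.A.homog_induct)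
    case zero
    then show ?case using x S.submodule_zero[OF H_sub] by simp
  next
    case (homog i s)
    then show ?case using left right x by blast
  next
    case (add s t)
    have "x \<in> carrier S" using x by simp
    then show ?case using add S.submoduleE(5)[OF H_sub] by (simp only: S.X.l_distr S.X.r_distr)
  qed
  have "ideal ?H S"
    by (rule idealI[OF S.X.ring_axioms submodule.axioms(1)[OF H_sub]]) (use mult in blast)+
  moreover have "mdefect a b \<in> ?H" if a: "a \<in> carrier A" and b: "b \<in> carrier A" for a b
    using a
  proof (induction a rule: homog_induct)
    case zero
    then show ?case using mdefect_zero[OF b] S.submodule_zero[OF H_sub] by simp
  next
    case (homog i a)
    from b show ?case
    proof (induction b rule: homog_induct)
      case zero
      have "mdefect a \<zero>\<^bsub>A\<^esub> = \<zero>\<^bsub>S\<^esub>" using mdefect_zero homog homog_closed by blast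
      then show ?case using S.submodule_zero[OF H_sub] by simp
    next
      case (homog j b)
      have ac: "a \<in> carrier A" "b \<in> carrier A" using \<open>a \<in> homog A i\<close> homog homog_closed by auto
      show ?case
        by (rule H_homog[OF mdefect_homog[OF \<open>a \<in> homog A i\<close> homog]])
          (use ac mdefect_mem mdefect_diff[OF \<open>a \<in> homog A i\<close> ac(2)] in \<open>auto simp: ksign_def\<close>)
    next
      case (add b b')
      have "a \<in> carrier A" using \<open>a \<in> homog A i\<close> homog_closed by auto
      then show ?case using add S.submoduleE(5)[OF H_sub] by (simp only: mdefect_add_right)
    qed
  next
    case (add a a')
    then show ?case using b S.submoduleE(5)[OF H_sub] by (simp only: mdefect_add_left)
  qed
  ultimately have "\<ss> \<subseteq> ?H" by (rule mult_ideal_least)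
  then show "hcomp S x i \<in> \<ss>" "diff S (hcomp S x i) \<in> \<ss>" using assms by auto
qed

lemma mult_ideal_subcomplex: "subcomplex R S \<ss>"
  unfolding subcomplex_def
proof (intro conjI ballI allI mult_ideal_submodule mult_ideal_components(1))
  fix x assume x: "x \<in> \<ss>"
  have xc: "x \<in> carrier S" using x ss.Icarr by blast
  have "diff S x = diff S (finsum S (hcomp S x) {i. hcomp S x i \<noteq> \<zero>\<^bsub>S\<^esub>})"
    using S.A.hcomp_finsum[OF xc] by simp
  also have "\<dots> = finsum S (\<lambda>i. diff S (hcomp S x i)) {i. hcomp S x i \<noteq> \<zero>\<^bsub>S\<^esub>}"
    by (rule additive_map_finsum[OF S.M.abelian_group_axioms S.M.abelian_group_axioms])
      (use xc in \<open>auto simp: sym_diff_add\<close>)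
  also have "\<dots> \<in> \<ss>"
    by (rule S.submodule_finsum[OF mult_ideal_submodule]) (rule mult_ideal_components(2)[OF x])
  finally show "diff S x \<in> \<ss>" .
qed

lemma assoc_sub_incl: "a \<in> N \<Longrightarrow> \<iota> a \<in> \<ss>"
proof -
  let ?Y = "{a \<in> carrier A. \<iota> a \<in> \<ss>}"
  have \<iota>_mult: "\<iota> (a \<otimes>\<^bsub>A\<^esub> b) = mdefect a b \<oplus>\<^bsub>S\<^esub> \<iota> a \<otimes>\<^bsub>S\<^esub> \<iota> b" if "a \<in> carrier A" "b \<in> carrier A" for a b
    using that by (simp add: mdefect_def act_closed a_minus_def S.M.a_assoc S.M.l_neg)
  have "N \<subseteq> ?Y"
  proof (rule assoc_sub_least)
    show "subcomplex R A ?Y"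
      by (rule chain_map.vimage_subcomplex[OF sym_incl_chain_map mult_ideal_subcomplex])
    show "a \<otimes>\<^bsub>A\<^esub> y \<in> ?Y \<and> y \<otimes>\<^bsub>A\<^esub> a \<in> ?Y" if "a \<in> carrier A" "y \<in> ?Y" for a y
      using that mdefect_mem ss.I_l_closed ss.I_r_closed by (simp add: act_closed \<iota>_mult)
    show "associators A \<subseteq> ?Y"
    proof
      fix x assume "x \<in> associators A"
      then obtain a b c where abc: "a \<in> carrier A" "b \<in> carrier A" "c \<in> carrier A"
        and x: "x = (a \<otimes>\<^bsub>A\<^esub> b) \<otimes>\<^bsub>A\<^esub> c \<ominus>\<^bsub>A\<^esub> a \<otimes>\<^bsub>A\<^esub> (b \<otimes>\<^bsub>A\<^esub> c)" by (auto simp: associators_def)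
      \<comment> \<open>Both bracketings in \<open>A\<close> equal the one associative product
        \<open>?p\<close> in \<open>S\<close> up to the corrections \<open>?u\<close> and
        \<open>?v\<close> in \<open>\<ss>\<close>, so their difference is \<open>?u\<close> minus
        \<open>?v\<close>.\<close>
      let ?p = "\<iota> a \<otimes>\<^bsub>S\<^esub> (\<iota> b \<otimes>\<^bsub>S\<^esub> \<iota> c)"
      let ?u = "mdefect (a \<otimes>\<^bsub>A\<^esub> b) c \<oplus>\<^bsub>S\<^esub> mdefect a b \<otimes>\<^bsub>S\<^esub> \<iota> c"
      let ?v = "mdefect a (b \<otimes>\<^bsub>A\<^esub> c) \<oplus>\<^bsub>S\<^esub> \<iota> a \<otimes>\<^bsub>S\<^esub> mdefect b c"
      have u: "?u \<in> \<ss>" and v: "?v \<in> \<ss>"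
        using abc mdefect_mem ss.I_l_closed ss.I_r_closed by (simp_all add: act_closed)
      note uc = ss.Icarr[OF u] and vc = ss.Icarr[OF v]
      have "\<iota> ((a \<otimes>\<^bsub>A\<^esub> b) \<otimes>\<^bsub>A\<^esub> c) = ?u \<oplus>\<^bsub>S\<^esub> ?p" "\<iota> (a \<otimes>\<^bsub>A\<^esub> (b \<otimes>\<^bsub>A\<^esub> c)) = ?v \<oplus>\<^bsub>S\<^esub> ?p"
        using abc by (simp_all add: \<iota>_mult act_closed S.X.l_distr S.X.r_distr S.X.m_assoc S.M.a_assoc)
      then have "\<iota> x = (?u \<oplus>\<^bsub>S\<^esub> ?p) \<ominus>\<^bsub>S\<^esub> (?v \<oplus>\<^bsub>S\<^esub> ?p)"
        using abc by (simp add: x sym_incl_minus act_closed)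
      also have "\<dots> = ?u \<ominus>\<^bsub>S\<^esub> ?v"
      proof -
        have pc: "?p \<in> carrier S" using abc by simp
        have "(u \<oplus>\<^bsub>S\<^esub> p) \<ominus>\<^bsub>S\<^esub> (v \<oplus>\<^bsub>S\<^esub> p) = u \<ominus>\<^bsub>S\<^esub> v"
          if "u \<in> carrier S" "v \<in> carrier S" "p \<in> carrier S" for u v p
        proof -
          have "\<ominus>\<^bsub>S\<^esub> (v \<oplus>\<^bsub>S\<^esub> p) = \<ominus>\<^bsub>S\<^esub> p \<oplus>\<^bsub>S\<^esub> \<ominus>\<^bsub>S\<^esub> v" using that by (simp add: S.M.minus_add S.M.a_comm)
          then show ?thesis using that by (simp add: a_minus_def S.M.a_assoc S.M.r_neg1 S.M.r_neg2)
        qed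
        from this[OF uc vc pc] show ?thesis .
      qed
      also have "\<dots> \<in> \<ss>" by (rule S.submodule_minus[OF mult_ideal_submodule u v])
      finally show "x \<in> ?Y" using abc by (simp add: x act_closed)
    qed
  qed
  then show "a \<in> N \<Longrightarrow> \<iota> a \<in> \<ss>" by blast
qed

text \<open>Modulo \<open>\<ss>\<close>, products in \<open>S\<close> may be evaluated in \<open>A\<close>.\<close>

lemma sym_congruent_incl:
  assumes "x \<in> carrier S"
  obtains a where "a \<in> carrier A" "x \<ominus>\<^bsub>S\<^esub> \<iota> a \<in> \<ss>"
proof -
  have "\<exists>a\<in>carrier A. \<exists>y\<in>\<ss>. x = \<iota> a \<oplus>\<^bsub>S\<^esub> y"
    using assms
  proof (induction x rule: sym_dg_induct)
    case one
    have "\<one>\<^bsub>S\<^esub> = \<iota> \<one>\<^bsub>A\<^esub> \<oplus>\<^bsub>S\<^esub> \<zero>\<^bsub>S\<^esub>" by (simp add: sym_incl_one)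
    then show ?case using one_closed ss.zero_closed by blast
  next
    case (add x x')
    then obtain a y a' y' where h: "a \<in> carrier A" "y \<in> \<ss>" "x = \<iota> a \<oplus>\<^bsub>S\<^esub> y"
      "a' \<in> carrier A" "y' \<in> \<ss>" "x' = \<iota> a' \<oplus>\<^bsub>S\<^esub> y'" by blast
    have "y \<in> carrier S" "y' \<in> carrier S" using h ss.Icarr by auto
    then have "x \<oplus>\<^bsub>S\<^esub> x' = \<iota> (a \<oplus>\<^bsub>A\<^esub> a') \<oplus>\<^bsub>S\<^esub> (y \<oplus>\<^bsub>S\<^esub> y')"
      using h by (simp add: sym_incl_add S.M.a_ac)
    then show ?case using h ss.a_closed M.a_closed by blast
  next
    case (smult r x)
    then obtain a y where h: "a \<in> carrier A" "y \<in> \<ss>" "x = \<iota> a \<oplus>\<^bsub>S\<^esub> y" by blast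
    have "y \<in> carrier S" using h ss.Icarr by auto
    then have "r \<odot>\<^bsub>S\<^esub> x = \<iota> (r \<odot>\<^bsub>A\<^esub> a) \<oplus>\<^bsub>S\<^esub> r \<odot>\<^bsub>S\<^esub> y"
      using h smult by (simp add: sym_incl_smult S.smult_r_distr)
    then show ?case using h smult S.submoduleE(4)[OF mult_ideal_submodule] smult_closed by blast
  next
    case (incl i b x)
    then obtain a y where h: "a \<in> carrier A" "y \<in> \<ss>" "x = \<iota> a \<oplus>\<^bsub>S\<^esub> y" by blast
    have b: "b \<in> carrier A" using incl homog_closed by auto
    have y: "y \<in> carrier S" using h ss.Icarr by auto
    \<comment> \<open>The product of two elements of \<open>A\<close> formed in \<open>S\<close> is
      traded for their product in \<open>A\<close>, at the cost of a defect.\<close>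
    have "\<iota> b \<otimes>\<^bsub>S\<^esub> \<iota> a = \<iota> (b \<otimes>\<^bsub>A\<^esub> a) \<ominus>\<^bsub>S\<^esub> mdefect b a"
      using b h by (simp add: mdefect_def act_closed a_minus_def S.M.minus_add S.M.minus_minus S.M.r_neg1 S.M.r_neg2)
    then have "\<iota> b \<otimes>\<^bsub>S\<^esub> x = \<iota> (b \<otimes>\<^bsub>A\<^esub> a) \<oplus>\<^bsub>S\<^esub> (\<iota> b \<otimes>\<^bsub>S\<^esub> y \<ominus>\<^bsub>S\<^esub> mdefect b a)"
      using b h y by (simp add: S.X.r_distr act_closed a_minus_def S.M.a_ac)
    moreover have "\<iota> b \<otimes>\<^bsub>S\<^esub> y \<ominus>\<^bsub>S\<^esub> mdefect b a \<in> \<ss>"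
      using b h ss.I_l_closed mdefect_mem by (intro S.submodule_minus[OF mult_ideal_submodule]) auto
    ultimately show ?case using b h act_closed by blast
  qed
  then obtain a y where h: "a \<in> carrier A" "y \<in> \<ss>" "x = \<iota> a \<oplus>\<^bsub>S\<^esub> y" by blast
  then have "x \<ominus>\<^bsub>S\<^esub> \<iota> a = y" using ss.Icarr by (simp add: a_minus_def S.M.a_ac S.M.r_neg)
  then show ?thesis using that h by simp
qed

lemma pi_as_kernel: 
  assumes x: "x \<in> carrier S"
  shows "\<pi> x = \<zero>\<^bsub>Aas\<^esub> \<longleftrightarrow> x \<in> \<ss>"
proof
  interpret Q: ralgebra R Aas by (rule dg_algebra_ralgebra[OF max_assoc_dg])
  have \<pi>_hom: "\<pi> \<in> ring_hom S Aas"
    by (rule ring_hom_memI) (simp_all add: pi.map_closed pi.map_add pi.hom_mult pi.hom_one)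
  interpret h: ring_hom_ring S Aas \<pi>
    by (rule ring_hom_ringI2) (use \<pi>_hom S.X.ring_axioms Q.X.ring_axioms in auto)
  have "\<ss> \<subseteq> a_kernel S Aas \<pi>"
  proof (rule mult_ideal_least[OF h.kernel_is_ideal])
    fix a b assume ab: "a \<in> carrier A" "b \<in> carrier A"
    then have "\<pi> (mdefect a b) = q (a \<otimes>\<^bsub>A\<^esub> b) \<ominus>\<^bsub>Aas\<^esub> q a \<otimes>\<^bsub>Aas\<^esub> q b"
      by (simp add: mdefect_def act_closed pi.map_minus pi.hom_mult pi_as_incl)
    also have "\<dots> = \<zero>\<^bsub>Aas\<^esub>"
      using ab chain_map.map_closed[OF max_assoc_proj_chain_map]
      by (simp add: max_assoc_proj_mult pi.cod.A.M.minus_eq_zero_iff)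
    finally show "mdefect a b \<in> a_kernel S Aas \<pi>"
      unfolding a_kernel_eq by (intro CollectI conjI mdefect_closed ab)
  qed
  then have zero: "\<pi> y = \<zero>\<^bsub>Aas\<^esub>" if "y \<in> \<ss>" for y
    using that unfolding a_kernel_eq by blast
  show "\<pi> x = \<zero>\<^bsub>Aas\<^esub>" if "x \<in> \<ss>" using that by (rule zero)
  assume "\<pi> x = \<zero>\<^bsub>Aas\<^esub>"
  note x = x this
  \<comment> \<open>As \<open>\<pi>\<close> vanishes on \<open>\<ss>\<close>, the representative
    \<open>a\<close> has the same image as \<open>x\<close>, namely zero. So \<open>a\<close> lies
    in \<langle>A\<rangle>, its image in \<open>S\<close> lies in \<open>\<ss>\<close>, and
    \<open>x\<close> follows.\<close>
  obtain a where a: "a \<in> carrier A" "x \<ominus>\<^bsub>S\<^esub> \<iota> a \<in> \<ss>" using sym_congruent_incl[OF x(1)] .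
  have "\<zero>\<^bsub>Aas\<^esub> = \<pi> x \<ominus>\<^bsub>Aas\<^esub> q a" using zero[OF a(2)] a x by (simp add: pi.map_minus pi_as_incl)
  then have "q a = \<pi> x"
    using a x pi.cod.A.M.minus_eq_zero_iff[of "\<pi> x" "q a"] pi.map_closed
      chain_map.map_closed[OF max_assoc_proj_chain_map a(1)] by metis
  then have "\<iota> a \<in> \<ss>" using x max_assoc_proj_zero_iff[OF a(1)] assoc_sub_incl by simp
  then have "(x \<ominus>\<^bsub>S\<^esub> \<iota> a) \<oplus>\<^bsub>S\<^esub> \<iota> a \<in> \<ss>" using a(2) by simp
  then show "x \<in> \<ss>" using x a by (simp add: a_minus_def S.M.a_assoc S.M.l_neg)
qed

lemma sym_incl_mult_ideal_iff: "a \<in> carrier A \<Longrightarrow> \<iota> a \<in> \<ss> \<longleftrightarrow> a \<in> N"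
  using pi_as_kernel[of "\<iota> a"] max_assoc_proj_zero_iff[of a] by (simp add: pi_as_incl)

lemma assoc_sub_image: "\<iota> ` N = \<iota> ` carrier A \<inter> \<ss>"
  using sym_incl_mult_ideal_iff N.N.Y_closed by auto

section \<open>The quotient of \<open>S\<close> by \<open>\<ss>\<close> and the quotient of
  \<open>S\<close> by \<open>A\<close>\<close>

sublocale ss: mdg_ideal R S \<ss>
  by (intro mdg_ideal.intro mdg_ideal_axioms.intro S.mdg_algebra_axioms mult_ideal_subcomplex
      ss.I_l_closed ss.I_r_closed)

sublocale le1: subcomplex_of R S "\<iota> ` carrier A"
  by (intro subcomplex_of.intro subcomplex_of_axioms.intro S.A.rcomplex_axioms sym_incl_image_subcomplex)

abbreviation "Scoker \<equiv> quot_cplx S \<ss>"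
abbreviation "p \<equiv> \<lambda>s\<in>carrier S. \<ss> +>\<^bsub>S\<^esub> s"
abbreviation "\<ss>1 \<equiv> \<ss> \<inter> sym_le1 R A"
text \<open>Inverts \<open>\<iota>\<close> on its image, and thereby embeds \<open>\<ss>1\<close>, a
  subset of \<open>S\<close>, into \<open>A\<close>.\<close>

abbreviation "j \<equiv> inv_into (carrier A) \<iota>"

lemma coker_dg: "dg_algebra R Scoker"
  by (rule ss.quot_dg_algebra)
    (simp add: S.X.m_assoc a_minus_def S.M.r_neg)

lemma coker_proj_hom: "dg_algebra_hom R S Scoker p"
proof (rule dg_algebra_hom_cong[where f = "\<lambda>s. \<ss> +>\<^bsub>S\<^esub> s"])
  show "dg_algebra_hom R S Scoker (\<lambda>s. \<ss> +>\<^bsub>S\<^esub> s)"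
    by (intro dg_algebra_hom.intro dg_algebra_hom_axioms.intro sym_dg_algebra coker_dg ss.N.quot_cplx_proj)
      (simp_all add: ss.quot_mult)
qed simp

text \<open>\<open>\<pi>\<close> and \<open>p\<close> are surjective with the same kernel, so each
  factors through the other. Surjectivity of \<open>\<pi>\<close> forces the isomorphism on every
  element of the carrier, and extensionality does so outside it.\<close>

lemma coker_iso: "\<exists>!\<phi>. \<phi> \<in> extensional (carrier Aas) \<and> dg_over_iso R S Aas \<pi> Scoker p \<phi>"
proof -
  obtain f where f: "dg_algebra_hom R Aas Scoker f" "\<And>x. x \<in> carrier S \<Longrightarrow> f (\<pi> x) = p x"
  proof (rule dg_algebra_hom_factor[OF pi_as_hom coker_proj_hom pi_as_surj])
    show "p x = \<zero>\<^bsub>Scoker\<^esub>" if "x \<in> carrier S" "\<pi> x = \<zero>\<^bsub>Aas\<^esub>" for x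
      using that pi_as_kernel[OF that(1)] by (simp add: ss.N.Q.coset_eq_zero_iff)
  qed (rule that)
  let ?f = "restrict f (carrier Aas)"
  have bij: "bij_betw f (carrier Aas) (carrier Scoker)"
    unfolding bij_betw_def
  proof
    show "f ` carrier Aas = carrier Scoker"
      unfolding pi_as_surj[symmetric] image_image using f(2) by simp
    show "inj_on f (carrier Aas)"
    proof (rule inj_onI)
      fix u v assume "u \<in> carrier Aas" "v \<in> carrier Aas" and eq: "f u = f v"
      then obtain x y where xy: "x \<in> carrier S" "u = \<pi> x" "y \<in> carrier S" "v = \<pi> y"
        unfolding pi_as_surj[symmetric] by auto
      then have "x \<ominus>\<^bsub>S\<^esub> y \<in> \<ss>" using eq f(2) by (simp add: ss.N.Q.coset_eq_iff)
      then have "\<pi> x \<ominus>\<^bsub>Aas\<^esub> \<pi> y = \<zero>\<^bsub>Aas\<^esub>"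
        using xy pi_as_kernel[of "x \<ominus>\<^bsub>S\<^esub> y"] by (simp add: pi.map_minus)
      then show "u = v" using xy by (simp add: pi.cod.A.M.minus_eq_zero_iff pi.map_closed)
    qed
  qed
  show ?thesis
  proof
    have "bij_betw ?f (carrier Aas) (carrier Scoker)" using bij by (subst bij_betw_cong) auto
    moreover have "dg_algebra_hom R Aas Scoker ?f" by (rule dg_algebra_hom_cong[OF f(1)]) simp
    ultimately show "?f \<in> extensional (carrier Aas) \<and> dg_over_iso R S Aas \<pi> Scoker p ?f"
      using f(2) pi.map_closed by (simp add: dg_over_iso_def)
    fix \<phi> assume \<phi>: "\<phi> \<in> extensional (carrier Aas) \<and> dg_over_iso R S Aas \<pi> Scoker p \<phi>"
    show "\<phi> = ?f"
    proof (rule extensionalityI[of _ "carrier Aas"])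
      fix u assume u: "u \<in> carrier Aas"
      then obtain x where "x \<in> carrier S" "u = \<pi> x" unfolding pi_as_surj[symmetric] by auto
      then show "\<phi> u = ?f u" using \<phi> f(2) u unfolding dg_over_iso_def by auto
    qed (use \<phi> in auto)
  qed
qed

lemma ge2_cplx_eq: "sym_ge2_cplx R A = quot_cplx S (\<iota> ` carrier A)"
  by (simp add: sym_ge2_cplx_def)

lemma ge2_proj_eq: "sym_ge2_proj R A = (\<lambda>s. \<iota> ` carrier A +>\<^bsub>S\<^esub> s)"
  by (simp add: sym_ge2_proj_def[abs_def])

lemma ge2_proj_zero_iff: "x \<in> carrier S \<Longrightarrow> sym_ge2_proj R A x = \<zero>\<^bsub>sym_ge2_cplx R A\<^esub> \<longleftrightarrow> x \<in> \<iota> ` carrier A"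
  by (simp add: ge2_cplx_eq ge2_proj_eq le1.Q.coset_eq_zero_iff)

lemma ge2_proj_eq_iff:
  "\<lbrakk>x \<in> carrier S; y \<in> carrier S\<rbrakk>
    \<Longrightarrow> sym_ge2_proj R A x = sym_ge2_proj R A y \<longleftrightarrow> x \<ominus>\<^bsub>S\<^esub> y \<in> \<iota> ` carrier A"
  by (simp add: ge2_proj_eq le1.Q.coset_eq_iff)

lemma ge2_proj_chain_map: "chain_map R S (sym_ge2_cplx R A) (sym_ge2_proj R A)"
  unfolding ge2_cplx_eq ge2_proj_eq by (rule le1.quot_cplx_proj)

lemma ge2_carrier: "carrier (sym_ge2_cplx R A) = sym_ge2_proj R A ` carrier S"
  by (simp add: ge2_cplx_eq ge2_proj_eq)

text \<open>\<open>sym_ge2\<close> is a complement of \<open>A\<close> in \<open>S\<close>: the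
  intersection is trivial by \<open>sym_le1_ge2_trivial\<close> and the sum is everything by
  \<open>sym_le1_ge2_sum\<close>.\<close>

lemma ge2_bij: "bij_betw (sym_ge2_proj R A) (sym_ge2 R A) (carrier (sym_ge2_cplx R A))"
  unfolding bij_betw_def
proof
  note sub = sym_ge2_submodule
  have c: "x \<in> carrier S" if "x \<in> sym_ge2 R A" for x using S.submoduleE(1)[OF sub] that by blast
  show "inj_on (sym_ge2_proj R A) (sym_ge2 R A)"
  proof (rule inj_onI)
    fix x y assume xy: "x \<in> sym_ge2 R A" "y \<in> sym_ge2 R A" "sym_ge2_proj R A x = sym_ge2_proj R A y"
    then obtain a where a: "a \<in> carrier A" "x \<ominus>\<^bsub>S\<^esub> y = \<iota> a" using ge2_proj_eq_iff c by blast
    have "x \<ominus>\<^bsub>S\<^esub> y \<in> sym_ge2 R A" by (rule S.submodule_minus[OF sub xy(1,2)])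
    then have "x \<ominus>\<^bsub>S\<^esub> y = \<zero>\<^bsub>S\<^esub>" using a sym_le1_ge2_trivial by simp
    then show "x = y" using xy c by (simp add: S.M.minus_eq_zero_iff)
  qed
  show "sym_ge2_proj R A ` sym_ge2 R A = carrier (sym_ge2_cplx R A)"
  proof
    show "sym_ge2_proj R A ` sym_ge2 R A \<subseteq> carrier (sym_ge2_cplx R A)"
      unfolding ge2_carrier using c by blast
    show "carrier (sym_ge2_cplx R A) \<subseteq> sym_ge2_proj R A ` sym_ge2 R A"
      unfolding ge2_carrier
    proof
      fix u assume "u \<in> sym_ge2_proj R A ` carrier S"
      then obtain x where x: "x \<in> carrier S" "u = sym_ge2_proj R A x" by blast
      obtain a y where ay: "a \<in> carrier A" "y \<in> sym_ge2 R A" "x = \<iota> a \<oplus>\<^bsub>S\<^esub> y"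
        using sym_le1_ge2_sum[OF x(1)] .
      have "x \<ominus>\<^bsub>S\<^esub> y = \<iota> a"
        using ay c[OF ay(2)] by (simp add: a_minus_def S.M.a_assoc S.M.r_neg)
      then have "sym_ge2_proj R A x = sym_ge2_proj R A y"
        using ge2_proj_eq_iff[OF x(1) c[OF ay(2)]] ay(1) by simp
      then show "u \<in> sym_ge2_proj R A ` sym_ge2 R A" using x ay by blast
    qed
  qed
qed

section \<open>The complex \<open>\<ss>1\<close> and its inclusion into \<open>A\<close>\<close>

lemma le1_ideal_eq: "\<ss>1 = \<iota> ` N"
  unfolding assoc_sub_image sym_le1_eq by blast

lemma j_incl [simp]: "a \<in> carrier A \<Longrightarrow> j (\<iota> a) = a"
  by (rule inv_into_f_f[OF sym_incl_inj])

lemma le1_ideal_subcomplex: "subcomplex R S \<ss>1"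
  unfolding sym_le1_eq by (rule S.A.subcomplex_Int[OF mult_ideal_subcomplex sym_incl_image_subcomplex])

lemma le1_ideal_cplx:
  shows "carrier (sub_cplx S \<ss>1) = \<iota> ` N" "add (sub_cplx S \<ss>1) = add S" "zero (sub_cplx S \<ss>1) = zero S"
    "smult (sub_cplx S \<ss>1) = smult S" "diff (sub_cplx S \<ss>1) = diff S"
    "homog (sub_cplx S \<ss>1) i = homog S i \<inter> \<iota> ` N"
  by (simp_all add: sub_cplx_def le1_ideal_eq)

text \<open>An injective chain map reflects degrees, since it commutes with taking components. This
  is what makes \<open>j\<close> preserve degrees.\<close>

lemma sym_incl_homog_iff:
  assumes "a \<in> carrier A"
  shows "\<iota> a \<in> homog S i \<longleftrightarrow> a \<in> homog A i"
proof
  assume h: "\<iota> a \<in> homog S i"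
  have "\<iota> (hcomp A a i) = \<iota> a"
    using chain_map.map_hcomp[OF sym_incl_chain_map assms, of i] S.A.hcomp_of_homog[OF h, of i] by simp
  then have "hcomp A a i = a" using inj_onD[OF sym_incl_inj] assms by simp
  then show "a \<in> homog A i" using hcomp_homog[OF assms, of i] by simp
qed (simp add: homog_sym_dg sym_incl_homog)

lemma le1_ideal_rcomplex: "rcomplex R (sub_cplx S \<ss>1)"
  by (rule subcomplex_of.sub_cplx_rcomplex)
    (intro subcomplex_of.intro subcomplex_of_axioms.intro S.A.rcomplex_axioms le1_ideal_subcomplex)

lemma j_chain_map: "chain_map R (sub_cplx S \<ss>1) A j"
proof (intro chain_map.intro chain_map_axioms.intro le1_ideal_rcomplex rcomplex_axioms)
  fix x y assume "x \<in> carrier (sub_cplx S \<ss>1)" "y \<in> carrier (sub_cplx S \<ss>1)"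
  then obtain a b where ab: "a \<in> N" "b \<in> N" "x = \<iota> a" "y = \<iota> b" by (auto simp: le1_ideal_cplx)
  then have "a \<in> carrier A" "b \<in> carrier A" using N.N.Y_closed by auto
  with ab show "j (x \<oplus>\<^bsub>sub_cplx S \<ss>1\<^esub> y) = j x \<oplus>\<^bsub>A\<^esub> j y"
    using j_incl[of "a \<oplus>\<^bsub>A\<^esub> b"] by (simp add: le1_ideal_cplx sym_incl_add)
next
  fix r x assume "r \<in> carrier R" "x \<in> carrier (sub_cplx S \<ss>1)"
  then obtain a where a: "r \<in> carrier R" "a \<in> N" "x = \<iota> a" by (auto simp: le1_ideal_cplx)
  then have "a \<in> carrier A" using N.N.Y_closed by auto
  with a show "j (r \<odot>\<^bsub>sub_cplx S \<ss>1\<^esub> x) = r \<odot>\<^bsub>A\<^esub> j x"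
    using j_incl[of "r \<odot>\<^bsub>A\<^esub> a"] by (simp add: le1_ideal_cplx sym_incl_smult)
next
  fix x assume "x \<in> carrier (sub_cplx S \<ss>1)"
  then obtain a where a: "a \<in> N" "x = \<iota> a" by (auto simp: le1_ideal_cplx)
  then have "a \<in> carrier A" using N.N.Y_closed by auto
  with a show "j x \<in> carrier A" "j (diff (sub_cplx S \<ss>1) x) = diff A (j x)"
    by (simp_all add: le1_ideal_cplx sym_diff_incl)
next
  fix i x assume "x \<in> homog (sub_cplx S \<ss>1) i"
  then obtain a where "a \<in> N" "x = \<iota> a" "\<iota> a \<in> homog S i" by (auto simp: le1_ideal_cplx)
  then show "j x \<in> homog A i"
    using N.N.Y_closed[of a] by (simp add: sym_incl_homog_iff)
qed

text \<open>The action is the multiplication of \<open>A\<close> on \<langle>A\<rangle> carried over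
  by \<open>\<iota>\<close>; the product taken in \<open>S\<close> would leave symmetric degree at
  most one.\<close>

lemma le1_ideal_module: "mdg_module R A (sub_cplx S \<ss>1) (\<lambda>a x. \<iota> (a \<otimes>\<^bsub>A\<^esub> j x))"
proof -
  let ?C = "sub_cplx S \<ss>1"
  have sub: "subcomplex_of R S \<ss>1"
    by (intro subcomplex_of.intro subcomplex_of_axioms.intro S.A.rcomplex_axioms le1_ideal_subcomplex)
  have ks: "ksign ?C i x = ksign S i x" if "x \<in> \<iota> ` N" for i x
    using chain_map.map_ksign[OF subcomplex_of.sub_cplx_incl[OF sub], of x i] that
    by (simp add: le1_ideal_cplx)
  have c: "y \<in> carrier A" if "y \<in> N" for y using that by (rule N.N.Y_closed)
  have "chain_pairing R A ?C ?C (\<lambda>a x. \<iota> (a \<otimes>\<^bsub>A\<^esub> j x))"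
  proof (intro chain_pairing.intro chain_pairing_axioms.intro rcomplex_axioms le1_ideal_rcomplex)
    fix i a x assume a: "a \<in> homog A i" and "x \<in> carrier ?C"
    then obtain y where y: "y \<in> N" "x = \<iota> y" by (auto simp: le1_ideal_cplx)
    have ac: "a \<in> carrier A" using a homog_closed by blast
    have "a \<otimes>\<^bsub>A\<^esub> diff A y \<in> N" using ac y assoc_sub_left N.N.Y_diff by blast
    then show "diff ?C (\<iota> (a \<otimes>\<^bsub>A\<^esub> j x)) = \<iota> (diff A a \<otimes>\<^bsub>A\<^esub> j x) \<oplus>\<^bsub>?C\<^esub> ksign ?C i (\<iota> (a \<otimes>\<^bsub>A\<^esub> j (diff ?C x)))"
      using ac y c[OF y(1)]
      by (simp add: le1_ideal_cplx ks sym_diff_incl act_closed act_diff[OF a] sym_incl_add sym_incl_ksign)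
  next
    fix i k a x assume a: "a \<in> homog A i" and "x \<in> homog ?C k"
    then obtain y where y: "y \<in> N" "x = \<iota> y" "\<iota> y \<in> homog S k" by (auto simp: le1_ideal_cplx)
    have ac: "a \<in> carrier A" using a homog_closed by blast
    have "y \<in> homog A k" using y c sym_incl_homog_iff by blast
    then show "\<iota> (a \<otimes>\<^bsub>A\<^esub> j x) \<in> homog ?C (i + k)"
      using ac y c[OF y(1)] act_degree[OF a] assoc_sub_left
      by (simp add: le1_ideal_cplx sym_incl_homog_iff act_closed)
  next
    fix a x y assume a: "a \<in> carrier A" and "x \<in> carrier ?C" "y \<in> carrier ?C"
    then have xy: "x \<in> carrier ?C" "y \<in> carrier ?C" "j x \<in> carrier A" "j y \<in> carrier A"
      using chain_map.map_closed[OF j_chain_map] by auto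
    show "\<iota> (a \<otimes>\<^bsub>A\<^esub> j (x \<oplus>\<^bsub>?C\<^esub> y)) = \<iota> (a \<otimes>\<^bsub>A\<^esub> j x) \<oplus>\<^bsub>?C\<^esub> \<iota> (a \<otimes>\<^bsub>A\<^esub> j y)"
      unfolding chain_map.map_add[OF j_chain_map xy(1,2)]
      unfolding le1_ideal_cplx
      using a xy by (simp add: act_add_right act_closed sym_incl_add)
  next
    fix r a x assume ra: "r \<in> carrier R" "a \<in> carrier A" and x: "x \<in> carrier ?C"
    have jx: "j x \<in> carrier A" by (rule chain_map.map_closed[OF j_chain_map x])
    show "\<iota> (a \<otimes>\<^bsub>A\<^esub> j (r \<odot>\<^bsub>?C\<^esub> x)) = r \<odot>\<^bsub>?C\<^esub> \<iota> (a \<otimes>\<^bsub>A\<^esub> j x)"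
      unfolding chain_map.map_smult[OF j_chain_map ra(1) x]
      unfolding le1_ideal_cplx
      using ra jx by (simp add: act_smult_right act_closed sym_incl_smult)
    show "\<iota> ((r \<odot>\<^bsub>A\<^esub> a) \<otimes>\<^bsub>A\<^esub> j x) = r \<odot>\<^bsub>?C\<^esub> \<iota> (a \<otimes>\<^bsub>A\<^esub> j x)"
      unfolding le1_ideal_cplx using ra jx by (simp add: act_smult_left act_closed sym_incl_smult)
  next
    fix a b x assume ab: "a \<in> carrier A" "b \<in> carrier A" and x: "x \<in> carrier ?C"
    have jx: "j x \<in> carrier A" by (rule chain_map.map_closed[OF j_chain_map x])
    show "\<iota> ((a \<oplus>\<^bsub>A\<^esub> b) \<otimes>\<^bsub>A\<^esub> j x) = \<iota> (a \<otimes>\<^bsub>A\<^esub> j x) \<oplus>\<^bsub>?C\<^esub> \<iota> (b \<otimes>\<^bsub>A\<^esub> j x)"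
      unfolding le1_ideal_cplx using ab jx by (simp add: act_add_left act_closed sym_incl_add)
  next
    fix a x assume "a \<in> carrier A" "x \<in> carrier ?C"
    then show "\<iota> (a \<otimes>\<^bsub>A\<^esub> j x) \<in> carrier ?C"
      using c assoc_sub_left by (auto simp: le1_ideal_cplx)
  qed
  then show ?thesis
  proof (intro mdg_module.intro mdg_module_axioms.intro mdg_algebra_axioms)
    fix x assume "x \<in> carrier ?C"
    then obtain y where "y \<in> N" "x = \<iota> y" by (auto simp: le1_ideal_cplx)
    then show "\<iota> (\<one>\<^bsub>A\<^esub> \<otimes>\<^bsub>A\<^esub> j x) = x" using c by (simp add: one_left)
  qed
qed

lemma j_module_hom:
  "mdg_module_hom R A (sub_cplx S \<ss>1) (\<lambda>a x. \<iota> (a \<otimes>\<^bsub>A\<^esub> j x)) A (mult A) j"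
proof (intro mdg_module_hom.intro mdg_module_hom_axioms.intro le1_ideal_module
    mdg_module_self mdg_algebra_axioms j_chain_map)
  fix a x assume "a \<in> carrier A" "x \<in> carrier (sub_cplx S \<ss>1)"
  then show "j (\<iota> (a \<otimes>\<^bsub>A\<^esub> j x)) = a \<otimes>\<^bsub>A\<^esub> j x"
    using chain_map.map_closed[OF j_chain_map] by (simp add: act_closed)
qed

lemma q_module_hom:
  "mdg_module_hom R A A (mult A) Aas (\<lambda>a x. q a \<otimes>\<^bsub>Aas\<^esub> x) q"
  by (intro mdg_module_hom.intro mdg_module_hom_axioms.intro mdg_module_self mdg_algebra_axioms
      mdg_module_via pi.cod.mdg_algebra_axioms max_assoc_proj_chain_map max_assoc_proj_one)
    (rule max_assoc_proj_mult)

section \<open>Exactness of the four sequences\<close>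

lemma exact_ideal: "short_exact (sub_cplx S \<ss>) (\<lambda>x. x) S \<pi> Aas"
  unfolding short_exact_def a_kernel_eq
proof (intro conjI)
  show "(\<lambda>x. x) ` carrier (sub_cplx S \<ss>) = {x \<in> carrier S. \<pi> x = \<zero>\<^bsub>Aas\<^esub>}"
    using pi_as_kernel ss.Icarr unfolding ss.N.sub_cplx_sel by blast
qed (simp_all add: pi_as_surj)

lemma exact_incl: "short_exact A \<iota> S (sym_ge2_proj R A) (sym_ge2_cplx R A)"
  unfolding short_exact_def a_kernel_eq
proof (intro conjI)
  show "\<iota> ` carrier A = {x \<in> carrier S. sym_ge2_proj R A x = \<zero>\<^bsub>sym_ge2_cplx R A\<^esub>}"
    using ge2_proj_zero_iff sym_incl_closed by blast
qed (fact sym_incl_inj ge2_carrier[symmetric])+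

lemma exact_le1: "short_exact (sub_cplx S \<ss>1) j A q Aas"
  unfolding short_exact_def a_kernel_eq le1_ideal_cplx
proof (intro conjI)
  show "inj_on j (\<iota> ` N)"
    by (rule inj_on_inverseI[of _ \<iota>]) (auto dest: N.N.Y_closed)
  show "j ` \<iota> ` N = {a \<in> carrier A. q a = \<zero>\<^bsub>Aas\<^esub>}"
  proof -
    have "j ` \<iota> ` N = (\<lambda>a. a) ` N"
      unfolding image_image by (rule image_cong[OF refl], rule j_incl, rule N.N.Y_closed)
    also have "\<dots> = N" by (rule image_ident)
    also have "N = {a \<in> carrier A. q a = \<zero>\<^bsub>Aas\<^esub>}"
    proof (rule Set.set_eqI)
      fix a
      show "a \<in> N \<longleftrightarrow> a \<in> {a \<in> carrier A. q a = \<zero>\<^bsub>Aas\<^esub>}"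
        using N.N.Y_closed[of a] max_assoc_proj_zero_iff[of a] by (simp only: mem_Collect_eq) metis
    qed
    finally show ?thesis .
  qed
qed (rule max_assoc_proj_surj)

lemma le1_ideal_kernel:
  "\<ss>1 = a_kernel (sub_cplx S \<ss>) (sym_ge2_cplx R A) (sym_ge2_proj R A)"
proof (rule Set.set_eqI)
  fix x
  show "x \<in> \<ss>1 \<longleftrightarrow> x \<in> a_kernel (sub_cplx S \<ss>) (sym_ge2_cplx R A) (sym_ge2_proj R A)"
    unfolding a_kernel_eq sym_le1_eq ss.N.sub_cplx_sel mem_Collect_eq Int_iff
    using ge2_proj_zero_iff[of x] ss.Icarr[of x] by metis
qed

lemma exact_le1_ideal:
  "short_exact (sub_cplx S \<ss>1) (\<lambda>x. x) (sub_cplx S \<ss>) (sym_ge2_proj R A) (sym_ge2_cplx R A)"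
  unfolding short_exact_def
proof (intro conjI)
  show "(\<lambda>x. x) ` carrier (sub_cplx S \<ss>1)
      = a_kernel (sub_cplx S \<ss>) (sym_ge2_cplx R A) (sym_ge2_proj R A)"
    unfolding le1_ideal_kernel[symmetric] by (simp add: sub_cplx_def)
  show "sym_ge2_proj R A ` carrier (sub_cplx S \<ss>) = carrier (sym_ge2_cplx R A)"
  proof
    show "sym_ge2_proj R A ` carrier (sub_cplx S \<ss>) \<subseteq> carrier (sym_ge2_cplx R A)"
      unfolding ge2_carrier using ss.Icarr by auto
    show "carrier (sym_ge2_cplx R A) \<subseteq> sym_ge2_proj R A ` carrier (sub_cplx S \<ss>)"
      unfolding ge2_carrier
    proof
      fix u assume "u \<in> sym_ge2_proj R A ` carrier S"
      then obtain x where x: "x \<in> carrier S" "u = sym_ge2_proj R A x" by blast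
      \<comment> \<open>Subtracting \<open>\<iota> a\<close> moves \<open>x\<close> into
        \<open>\<ss>\<close> without changing its class modulo \<open>A\<close>, so
        \<open>\<ss>\<close> already maps onto the quotient.\<close>
      obtain a where a: "a \<in> carrier A" "x \<ominus>\<^bsub>S\<^esub> \<iota> a \<in> \<ss>" using sym_congruent_incl[OF x(1)] .
      have "x \<ominus>\<^bsub>S\<^esub> (x \<ominus>\<^bsub>S\<^esub> \<iota> a) = \<iota> a"
        using x a by (simp add: a_minus_def S.M.minus_add S.M.minus_minus S.M.r_neg1 S.M.r_neg2
            flip: S.M.a_assoc) (simp add: S.M.r_neg)
      then have "sym_ge2_proj R A x = sym_ge2_proj R A (x \<ominus>\<^bsub>S\<^esub> \<iota> a)"
        using ge2_proj_eq_iff[of x "x \<ominus>\<^bsub>S\<^esub> \<iota> a"] x a by simp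
      then show "u \<in> sym_ge2_proj R A ` carrier (sub_cplx S \<ss>)" using x a by auto
    qed
  qed
qed (auto intro: inj_onI)

end

theorem theorem5p3:
  fixes R :: "('r, 'p) ring_scheme" and A :: "('r, 'a, 'm) graded_complex_scheme"
  assumes "cring R" and "mdg_algebra R A" and "centered_at_base R A"
  shows
   "let S = sym_dg R A; \<iota> = sym_incl R A;
        \<ss> = mult_ideal R A; Scoker = quot_cplx S \<ss>; p = (\<lambda>s\<in>carrier S. \<ss> +>\<^bsub>S\<^esub> s);
        Aas = max_assoc R A; q = max_assoc_proj R A; \<pi> = pi_as R A;
        S2 = sym_ge2_cplx R A; \<rho> = sym_ge2_proj R A;
        \<ss>1 = \<ss> \<inter> sym_le1 R A; j = inv_into (carrier A) \<iota>;
        cs = sub_cplx S \<ss>; cs1 = sub_cplx S \<ss>1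
    in
      \<comment> \<open>the DG \<open>S\<close>-algebras \<open>A\<^bsup>as\<^esup>\<close> and \<open>S/\<ss>\<close>, and the unique isomorphism between them\<close>
      (\<exists>!\<pi>'. is_pi_as R A \<pi>') \<and>
      dg_algebra_hom R S Aas \<pi> \<and>
      dg_algebra_hom R S Scoker p \<and>
      (\<exists>!\<phi>. \<phi> \<in> extensional (carrier Aas) \<and> dg_over_iso R S Aas \<pi> Scoker p \<phi>) \<and>
      \<comment> \<open>\<open>A = S\<^bsup>\<le>1\<^esup>\<close> and \<open>S/A = S\<^bsup>\<ge>2\<^esup>\<close>\<close>
      \<iota> ` carrier A = sym_le1 R A \<and>
      bij_betw \<rho> (sym_ge2 R A) (carrier S2) \<and>
      \<comment> \<open>the descriptions of \<open>\<langle>A\<rangle>\<close>, as a subset of \<open>A\<close> inside \<open>S\<close>\<close>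
      \<iota> ` assoc_sub R A = \<iota> ` carrier A \<inter> \<ss> \<and>
      \<iota> ` carrier A \<inter> \<ss> = \<ss>1 \<and>
      \<ss>1 = a_kernel cs S2 \<rho> \<and>
      \<comment> \<open>the commutative diagram; \<open>j\<close> is the inclusion of \<open>\<ss>\<^bsup>\<le>1\<^esup>\<close> into \<open>A\<close>\<close>
      (\<forall>x\<in>\<ss>1. \<iota> (j x) = x) \<and>
      (\<forall>a\<in>carrier A. \<pi> (\<iota> a) = q a) \<and>
      short_exact cs (\<lambda>x. x) S \<pi> Aas \<and>
      short_exact A \<iota> S \<rho> S2 \<and>
      short_exact cs1 j A q Aas \<and>
      short_exact cs1 (\<lambda>x. x) cs \<rho> S2 \<and>
      \<comment> \<open>the structure respected by the maps\<close>
      dg_module_hom R S cs (mult S) S (mult S) (\<lambda>x. x) \<and>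
      dg_module_hom R S S (mult S) Aas (\<lambda>s x. \<pi> s \<otimes>\<^bsub>Aas\<^esub> x) \<pi> \<and>
      chain_map R A S \<iota> \<and>
      chain_map R S S2 \<rho> \<and>
      chain_map R cs1 cs (\<lambda>x. x) \<and>
      chain_map R cs S2 \<rho> \<and>
      mdg_module_hom R A cs1 (\<lambda>a x. \<iota> (a \<otimes>\<^bsub>A\<^esub> j x)) A (mult A) j \<and>
      mdg_module_hom R A A (mult A) Aas (\<lambda>a x. q a \<otimes>\<^bsub>Aas\<^esub> x) q"
proof -
  \<comment> \<open>The abbreviations of this context stand for the terms bound by
    \<open>let\<close>, so most conjuncts are facts of the context as they are.\<close>
  interpret centered_mdg R A
  proof (intro centered_mdg.intro centered_complex.intro centered_complex_axioms.intro)
    show "mdg_algebra R A" by fact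
    then show "rcomplex R A" "\<one>\<^bsub>A\<^esub> \<in> homog A 0"
      by (auto simp: mdg_algebra_def mdg_algebra_axioms_def chain_pairing_def)
  qed fact
  show ?thesis
    unfolding Let_def
  proof (intro conjI)
    show "\<iota> ` carrier A \<inter> \<ss> = \<ss>1" unfolding sym_le1_eq by blast
    show "\<forall>x\<in>\<ss>1. \<iota> (j x) = x" unfolding sym_le1_eq by (auto intro: f_inv_into_f)
    show "\<forall>a\<in>carrier A. \<pi> (\<iota> a) = q a" using pi_as_incl by blast
    show "dg_module_hom R S (sub_cplx S \<ss>) (mult S) S (mult S) (\<lambda>x. x)"
      by (rule dg_module_sub[OF sym_dg_algebra mult_ideal_subcomplex ss.I_l_closed])
    show "chain_map R (sub_cplx S \<ss>1) (sub_cplx S \<ss>) (\<lambda>x. x)"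
      by (rule subcomplex_of.sub_cplx_incl_sub)
        (auto intro!: subcomplex_of.intro subcomplex_of_axioms.intro S.A.rcomplex_axioms
          le1_ideal_subcomplex mult_ideal_subcomplex)
    show "chain_map R (sub_cplx S \<ss>) (sym_ge2_cplx R A) (sym_ge2_proj R A)"
      by (rule chain_map_comp[OF ss.N.sub_cplx_incl ge2_proj_chain_map])
    show "dg_module_hom R S S (mult S) Aas (\<lambda>s x. \<pi> s \<otimes>\<^bsub>Aas\<^esub> x) \<pi>"
      by (rule dg_module_hom_via[OF pi_as_hom])
  qed (fact is_pi_as_ex1 pi_as_hom coker_proj_hom coker_iso sym_le1_eq[symmetric] ge2_bij
      assoc_sub_image le1_ideal_kernel exact_ideal exact_incl exact_le1 exact_le1_ideal
      sym_incl_chain_map ge2_proj_chain_map j_module_hom q_module_hom)+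
qed

end
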